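(* Let $\theta > 0$, $\theta \neq 1$, $N \in \mathbb{N}$, $k \in \{1,\dots,N\}$, $M \in \mathbb{Z}_{\geq 0}$, let $w_N$ be a positive function on $[-N\theta, M-\theta]$, and let $\mathbb{P}^{\theta,M}_{N,k}$ be the probability measure on $\mathfrak{X}^{\theta,M}_{N,k}$ defined in the context. Let $\mathcal{M} \subseteq \mathbb{C}$ be an open set with $[-N\theta, M+1-\theta] \subseteq \mathcal{M}$. Suppose that there exist holomorphic functions $\Phi_N^+, \Phi_N^-$ on $\mathcal{M}$ such that $$\frac{w_N(x)}{w_N(x-1)} = \frac{\Phi_N^+(x)}{\Phi_N^-(x)} \quad \text{for } x \in [-N\theta+1, M-\theta], \qquad \Phi_N^-(-N\theta) = \Phi_N^+(M+1-\theta) = 0.$$ Then the following functions $R_1(z)$, $R_2(z)$ are analytic in $\mathcal{M}$: $$R_1(z) := \Phi_N^-(z)\, \mathbb{E}\left[\prod_{p=1}^N \frac{z-\ell^N_p-\theta}{z-\ell^N_p}\right] + \Phi_N^+(z)\, \mathbb{E}\left[\prod_{p=1}^k \frac{z-\ell^k_p+\theta-1}{z-\ell^k_p-1}\right] + \frac{\theta\,\Phi_N^+(z)}{1-\theta} \sum_{j=k+1}^N \mathbb{E}\left[\prod_{p=1}^j \frac{z-\ell^j_p-\theta}{z-\ell^j_p-1} \prod_{p=1}^{j-1} \frac{z-\ell^{j-1}_p+\theta-1}{z-\ell^{j-1}_p}\right],$$ $$R_2(z) := \Phi_N^+(z)\, \mathbb{E}\left[\prod_{p=1}^N \frac{z-\ell^N_p+\theta-1}{z-\ell^N_p-1}\right]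 + \Phi_N^-(z)\, \mathbb{E}\left[\prod_{p=1}^k \frac{z-\ell^k_p+(N-k-1)\theta}{z-\ell^k_p+(N-k)\theta}\right]$$ $$\qquad + \frac{\theta\,\Phi_N^-(z)}{1-\theta} \sum_{j=k+1}^N \mathbb{E}\left[\prod_{p=1}^j \frac{z-\ell^j_p+(N-j+1)\theta-1}{z-\ell^j_p+(N-j)\theta} \prod_{p=1}^{j-1} \frac{z-\ell^{j-1}_p+(N-j)\theta}{z-\ell^{j-1}_p+(N-j+1)\theta-1}\right],$$ where the expectations are with respect to $\mathbb{P}^{\theta,M}_{N,k}$.
   Context: State space. For $n\in\mathbb{N}$ let $\Lambda^M_n = \{(\lambda_1,\dots,\lambda_n)\in\mathbb{Z}^n : M \geq \lambda_1\geq\cdots\geq\lambda_n\geq 0\}$ and $\mathbb{W}^{\theta,M}_n = \{(\ell_1,\dots,\ell_n) : \ell_i = \lambda_i - i\theta,\ (\lambda_1,\dots,\lambda_n)\in\Lambda^M_n\}$. For $\ell\in\mathbb{W}^{\theta,M}_{n}$ and $m\in\mathbb{W}^{\theta,M}_{n-1}$ with $\ell_i=\lambda_i-i\theta$, $m_i=\mu_i-i\theta$, write $\ell\succeq m$ if $\lambda_1\geq\mu_1\geq\lambda_2\geq\mu_2\geq\cdots\geq\mu_{n-1}\geq\lambda_n$. Set $$\mathfrak{X}^{\theta,M}_{N,k} = \{(\ell^N,\ell^{N-1},\dots,\ell^k)\in\mathbb{W}^{\theta,M}_N\times\cdots\times\mathbb{W}^{\theta,M}_k : \ell^N\succeq\ell^{N-1}\succeq\cdots\succeq\ell^k\}.$$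 Measure. With $\Gamma$ the Euler gamma function, $$\mathbb{P}^{\theta,M}_{N,k}(\ell^N,\dots,\ell^k) = Z^{-1}\, H^t(\ell^N)\, H^b(\ell^k) \prod_{j=k}^{N-1} I(\ell^{j+1},\ell^j),$$ where $Z$ is the normalization constant (making the total mass $1$) and $$I(\ell^{j+1},\ell^j) = \prod_{1\leq p<q\leq j+1}\frac{\Gamma(\ell^{j+1}_p-\ell^{j+1}_q+1-\theta)}{\Gamma(\ell^{j+1}_p-\ell^{j+1}_q)} \prod_{1\leq p<q\leq j}\frac{\Gamma(\ell^j_p-\ell^j_q+1)}{\Gamma(\ell^j_p-\ell^j_q+\theta)} \prod_{1\leq p<q\leq j+1}\frac{\Gamma(\ell^j_p-\ell^{j+1}_q)}{\Gamma(\ell^j_p-\ell^{j+1}_q+1-\theta)} \prod_{1\leq p\leq q\leq j}\frac{\Gamma(\ell^{j+1}_p-\ell^j_q+\theta)}{\Gamma(\ell^{j+1}_p-\ell^j_q+1)},$$ $$H^t(\ell^N) = \prod_{1\leq p<q\leq N}\frac{\Gamma(\ell^N_p-\ell^N_q+1)}{\Gamma(\ell^N_p-\ell^N_q+1-\theta)}\prod_{p=1}^N w_N(\ell^N_p), \qquad H^b(\ell^k) = \prod_{1\leq p<q\leq k}\frac{\Gamma(\ell^k_p-\ell^k_q+\theta)}{\Gamma(\ell^k_p-\ell^k_q)}.$$ Conventions. Empty products are $1$, empty sums are $0$. The functions $R_1,R_2$ are a priori meromorphic on $\mathcal{M}$ (finite sums of rational functions times holomorphic functions); "analytic in $\mathcal{M}$"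 means all their singularities in $\mathcal{M}$ are removable. The ratio identity for $w_N$ presupposes that the denominators do not vanish on the indicated interval. *)

theory Defs
  imports "HOL-Complex_Analysis.Complex_Analysis"
begin

text \<open>
  Vectors of length \<open>n\<close> are extensional functions on \<open>{1..n}\<close>, and tuples
  \<open>L = (l\<^sup>N, \<dots>, l\<^sup>k)\<close> are extensional functions on \<open>{k..N}\<close>, so that the
  state spaces below are finite sets; \<open>L j p\<close> stands for the \<open>p\<close>-th coordinate of
  the vector at level \<open>j\<close>.
\<close>

definition Lam :: "nat \<Rightarrow> nat \<Rightarrow> (nat \<Rightarrow> int) set" where
  "Lam M n = {\<kappa> \<in> {1..n} \<rightarrow>\<^sub>E {0..int M}. \<forall>i\<in>{1..n}. \<forall>j\<in>{1..n}. i \<le> j \<longrightarrow> \<kappa> j \<le> \<kappa> i}"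

definition WW :: "real \<Rightarrow> nat \<Rightarrow> nat \<Rightarrow> (nat \<Rightarrow> real) set" where
  "WW \<theta> M n = (\<lambda>\<kappa>. \<lambda>i\<in>{1..n}. of_int (\<kappa> i) - real i * \<theta>) ` Lam M n"

text \<open>Here \<open>l\<close> has length \<open>n\<close> and \<open>m\<close> has length \<open>n - 1\<close>; the integer
  coordinates \<open>\<lambda>\<^sub>i\<close>, \<open>\<mu>\<^sub>i\<close> are recovered as \<open>l i + i \<theta>\<close>, \<open>m i + i \<theta>\<close>.\<close>

definition interlaces :: "real \<Rightarrow> nat \<Rightarrow> (nat \<Rightarrow> real) \<Rightarrow> (nat \<Rightarrow> real) \<Rightarrow> bool" where
  "interlaces \<theta> n l m \<longleftrightarrow>
     (\<forall>i\<in>{1..<n}. l i + real i * \<theta> \<ge> m i + real i * \<theta> \<and>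
                  m i + real i * \<theta> \<ge> l (i + 1) + real (i + 1) * \<theta>)"

definition XX :: "real \<Rightarrow> nat \<Rightarrow> nat \<Rightarrow> nat \<Rightarrow> (nat \<Rightarrow> nat \<Rightarrow> real) set" where
  "XX \<theta> M N k = {L \<in> (\<Pi>\<^sub>E j\<in>{k..N}. WW \<theta> M j).
                   \<forall>j\<in>{k..<N}. interlaces \<theta> (j + 1) (L (j + 1)) (L j)}"

definition I_weight :: "real \<Rightarrow> nat \<Rightarrow> (nat \<Rightarrow> real) \<Rightarrow> (nat \<Rightarrow> real) \<Rightarrow> real" where
  "I_weight \<theta> j l m =
     (\<Prod>q\<in>{1..j+1}. \<Prod>p\<in>{1..<q}. Gamma (l p - l q + 1 - \<theta>) / Gamma (l p - l q)) *
     (\<Prod>q\<in>{1..j}. \<Prod>p\<in>{1..<q}. Gamma (m p - m q + 1) / Gamma (m p - m q + \<theta>)) *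
     (\<Prod>q\<in>{1..j+1}. \<Prod>p\<in>{1..<q}. Gamma (m p - l q) / Gamma (m p - l q + 1 - \<theta>)) *
     (\<Prod>q\<in>{1..j}. \<Prod>p\<in>{1..q}. Gamma (l p - m q + \<theta>) / Gamma (l p - m q + 1))"

definition H_top :: "real \<Rightarrow> (real \<Rightarrow> real) \<Rightarrow> nat \<Rightarrow> (nat \<Rightarrow> real) \<Rightarrow> real" where
  "H_top \<theta> w N l =
     (\<Prod>q\<in>{1..N}. \<Prod>p\<in>{1..<q}. Gamma (l p - l q + 1) / Gamma (l p - l q + 1 - \<theta>)) *
     (\<Prod>p\<in>{1..N}. w (l p))"

definition H_bot :: "real \<Rightarrow> nat \<Rightarrow> (nat \<Rightarrow> real) \<Rightarrow> real" where
  "H_bot \<theta> k l =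
     (\<Prod>q\<in>{1..k}. \<Prod>p\<in>{1..<q}. Gamma (l p - l q + \<theta>) / Gamma (l p - l q))"

definition weight ::
  "real \<Rightarrow> (real \<Rightarrow> real) \<Rightarrow> nat \<Rightarrow> nat \<Rightarrow> (nat \<Rightarrow> nat \<Rightarrow> real) \<Rightarrow> real" where
  "weight \<theta> w N k L =
     H_top \<theta> w N (L N) * H_bot \<theta> k (L k) * (\<Prod>j\<in>{k..<N}. I_weight \<theta> j (L (j + 1)) (L j))"

definition partition_fun :: "real \<Rightarrow> (real \<Rightarrow> real) \<Rightarrow> nat \<Rightarrow> nat \<Rightarrow> nat \<Rightarrow> real" where
  "partition_fun \<theta> w M N k = (\<Sum>L\<in>XX \<theta> M N k. weight \<theta> w N k L)"

definition PP ::
  "real \<Rightarrow> (real \<Rightarrow> real) \<Rightarrow> nat \<Rightarrow> nat \<Rightarrow> nat \<Rightarrow> (nat \<Rightarrow> nat \<Rightarrow> real) measure" where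
  "PP \<theta> w M N k =
     point_measure (XX \<theta> M N k) (\<lambda>L. ennreal (weight \<theta> w N k L / partition_fun \<theta> w M N k))"

abbreviation EE ::
  "real \<Rightarrow> (real \<Rightarrow> real) \<Rightarrow> nat \<Rightarrow> nat \<Rightarrow> nat \<Rightarrow> ((nat \<Rightarrow> nat \<Rightarrow> real) \<Rightarrow> complex) \<Rightarrow> complex" where
  "EE \<theta> w M N k f \<equiv> integral\<^sup>L (PP \<theta> w M N k) f"

definition R1 ::
  "real \<Rightarrow> (real \<Rightarrow> real) \<Rightarrow> nat \<Rightarrow> nat \<Rightarrow> nat \<Rightarrow> (complex \<Rightarrow> complex) \<Rightarrow> (complex \<Rightarrow> complex)
   \<Rightarrow> complex \<Rightarrow> complex" where
  "R1 \<theta> w M N k \<Phi>p \<Phi>m z =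
     \<Phi>m z * EE \<theta> w M N k (\<lambda>L. \<Prod>p=1..N. (z - of_real (L N p) - of_real \<theta>) / (z - of_real (L N p))) +
     \<Phi>p z * EE \<theta> w M N k (\<lambda>L. \<Prod>p=1..k. (z - of_real (L k p) + of_real \<theta> - 1) / (z - of_real (L k p) - 1)) +
     of_real \<theta> * \<Phi>p z / (1 - of_real \<theta>) *
       (\<Sum>j=k+1..N. EE \<theta> w M N k (\<lambda>L.
          (\<Prod>p=1..j. (z - of_real (L j p) - of_real \<theta>) / (z - of_real (L j p) - 1)) *
          (\<Prod>p=1..j-1. (z - of_real (L (j-1) p) + of_real \<theta> - 1) / (z - of_real (L (j-1) p)))))"

definition R2 ::
  "real \<Rightarrow> (real \<Rightarrow> real) \<Rightarrow> nat \<Rightarrow> nat \<Rightarrow> nat \<Rightarrow> (complex \<Rightarrow> complex) \<Rightarrow> (complex \<Rightarrow> complex)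
   \<Rightarrow> complex \<Rightarrow> complex" where
  "R2 \<theta> w M N k \<Phi>p \<Phi>m z =
     \<Phi>p z * EE \<theta> w M N k (\<lambda>L. \<Prod>p=1..N. (z - of_real (L N p) + of_real \<theta> - 1) / (z - of_real (L N p) - 1)) +
     \<Phi>m z * EE \<theta> w M N k (\<lambda>L.
       \<Prod>p=1..k. (z - of_real (L k p) + of_real ((real N - real k - 1) * \<theta>)) /
                (z - of_real (L k p) + of_real ((real N - real k) * \<theta>))) +
     of_real \<theta> * \<Phi>m z / (1 - of_real \<theta>) *
       (\<Sum>j=k+1..N. EE \<theta> w M N k (\<lambda>L.
          (\<Prod>p=1..j. (z - of_real (L j p) + of_real ((real N - real j + 1) * \<theta>) - 1) /
                     (z - of_real (L j p) + of_real ((real N - real j) * \<theta>))) *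
          (\<Prod>p=1..j-1. (z - of_real (L (j-1) p) + of_real ((real N - real j) * \<theta>)) /
                       (z - of_real (L (j-1) p) + of_real ((real N - real j + 1) * \<theta>) - 1))))"

text \<open>
  The finite sets of points at which some denominator in the defining formula of \<open>R1\<close>,
  respectively \<open>R2\<close>, vanishes. At these points the values of \<open>R1\<close> and \<open>R2\<close> are
  artefacts of division by zero. In \<open>R2\<close> the second product of the \<open>j\<close>-th summand has
  denominators \<open>z - L i p + (N - i) \<theta> - 1\<close> with \<open>i = j - 1\<close>.
\<close>

definition R1_sing :: "real \<Rightarrow> nat \<Rightarrow> nat \<Rightarrow> nat \<Rightarrow> complex set" where
  "R1_sing \<theta> M N k =
     (\<Union>L\<in>XX \<theta> M N k. \<Union>j\<in>{k..N}. \<Union>p\<in>{1..j}.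
        {complex_of_real (L j p), complex_of_real (L j p + 1)})"

definition R2_sing :: "real \<Rightarrow> nat \<Rightarrow> nat \<Rightarrow> nat \<Rightarrow> complex set" where
  "R2_sing \<theta> M N k =
     (\<Union>L\<in>XX \<theta> M N k. \<Union>j\<in>{k..N}. \<Union>p\<in>{1..j}.
        {complex_of_real (L j p - (real N - real j) * \<theta>),
         complex_of_real (L j p - (real N - real j) * \<theta> + 1)})"

end

theory Submission
  imports Defs
begin

text \<open>
  Integrating out the bottom level reduces everything to a single level. Given \<open>l = L (k + 1)\<close>,
  put \<open>A x = \<Prod>q. x - l q\<close> and \<open>B x = \<Prod>q. x - l q - \<theta>\<close>. The conditional weight of \<open>m = L k\<close> is
  the Vandermonde product of \<open>m\<close> times one-variable weights \<open>\<tau>\<^sub>p (m p)\<close> that satisfy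
  \<open>\<tau>\<^sub>p (x + 1) B (x + 1) = \<tau>\<^sub>p x A x\<close>, with \<open>B\<close> and \<open>A\<close> vanishing at the lower and upper end
  of the range of \<open>m p\<close>. Interpolate \<open>f x = A x (z - x) - B x (z - 1 - x)\<close>, of degree at most
  \<open>k + 1\<close>, at the nodes \<open>m 1, \<dots>, m k, z, z - 1\<close> and evaluate at \<open>y\<close>: the terms with \<open>f (m p)\<close>
  telescope under summation over \<open>m p\<close>, so conditionally on \<open>l\<close>
  \<open>(1 + y - z) B z E[\<Prod>p. (y - m p) / (z - m p)] - (y - z) A (z - 1) E[\<Prod>p. (y - m p) / (z - 1 - m p)]
     = (1 + y - z) B y - (y - z) A y\<close>.
  The choice \<open>y = z + \<theta> - 1\<close> shows that passing from \<open>k\<close> to \<open>k + 1\<close> changes \<open>R1\<close> by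
  \<open>\<theta> / (1 - \<theta>) \<Phi>p\<close>; for \<open>R2\<close> take \<open>z + (N - k - 1) \<theta>\<close> and \<open>z + (N - k) \<theta>\<close> in place of \<open>y\<close> and \<open>z\<close>, which
  gives \<open>\<theta> / (1 - \<theta>) \<Phi>m\<close>. The same interpolation, with a polynomial comparing \<open>l\<close> and
  \<open>l + e\<^sub>r\<close>, shows that the total conditional weight is a constant multiple of \<open>H_bot l\<close>.
  For \<open>k = N\<close> the functions \<open>R1\<close> and \<open>R2\<close> coincide, and expanding in partial fractions leaves simple
  poles whose residues cancel between the configurations \<open>\<kappa>\<close> and \<open>\<kappa> - e\<^sub>p\<close>.
\<close>

section \<open>Interpolation and Vandermonde sums\<close>

text \<open>The extra nodes \<open>z\<close> and \<open>z - 1\<close> serve the telescoping: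
  dividing \<open>f x\<close> by \<open>(z - x) * (z - 1 - x)\<close> gives
  \<open>A x / (z - 1 - x) - B x / (z - x)\<close>, and the second denominator at
  \<open>x + 1\<close> is the first one at \<open>x\<close>. Once the Vandermonde product has
  cancelled the denominators, the other factors of an interpolation term no longer contain
  \<open>m p\<close>, so a multiple sum reduces to sums over one coordinate. The value of
  \<open>y\<close> is forced: \<open>y = z + \<theta> - 1\<close> gives
  \<open>B y = A (z - 1)\<close>, so division by \<open>(1 - \<theta>) * A (z - 1)\<close> turns one
  term on the right into the constant \<open>\<theta> / (1 - \<theta>)\<close> and the other into
  the same kind of product one level higher. The obstacle is the normalization: a conditional
  identity becomes one of expectations only if the total conditional weight is
  \<open>H_bot l\<close> times a factor independent of \<open>l\<close>. That sum is not evaluated;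
  only its ratio under adding one box to \<open>l\<close> is compared with the ratio for
  \<open>H_bot\<close>. The ranges of \<open>m\<close> for the two vectors differ, hence a common
  weight on their union.\<close>

lemma prod_pairs_split:
  fixes F :: "nat \<Rightarrow> nat \<Rightarrow> 'a::comm_monoid_mult"
  assumes i: "i \<in> {1..n}"
  shows "(\<Prod>q\<in>{1..n}. \<Prod>p\<in>{1..<q}. F p q) =
    (\<Prod>q\<in>{1..n}-{i}. if q < i then F q i else F i q) *
    (\<Prod>q\<in>{1..n}-{i}. \<Prod>p\<in>{1..<q}-{i}. F p q)"
proof -
  have below: "(\<Prod>p\<in>{1..<i}. F p i) = (\<Prod>q\<in>{1..n}-{i}. if q < i then F q i else 1)"
  proof -
    have "(\<Prod>q\<in>{1..n}-{i}. if q < i then F q i else 1) = (\<Prod>q\<in>{q\<in>{1..n}-{i}. q < i}. F q i)"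
      by (subst prod.inter_filter) auto
    also have "{q\<in>{1..n}-{i}. q < i} = {1..<i}" using i by auto
    finally show ?thesis by simp
  qed
  have above: "(\<Prod>p\<in>{1..<q}. F p q) = (if q < i then 1 else F i q) * (\<Prod>p\<in>{1..<q}-{i}. F p q)"
    if "q \<in> {1..n}-{i}" for q
  proof (cases "q < i")
    case True
    then have "{1..<q} - {i} = {1..<q}" by auto
    then show ?thesis using True by simp
  next
    case False
    then have "i \<in> {1..<q}" using i that by auto
    then show ?thesis using False by (simp add: prod.remove)
  qed
  have "(\<Prod>q\<in>{1..n}. \<Prod>p\<in>{1..<q}. F p q) =
      (\<Prod>p\<in>{1..<i}. F p i) * (\<Prod>q\<in>{1..n}-{i}. \<Prod>p\<in>{1..<q}. F p q)"
    using i by (subst prod.remove[of _ i]) auto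
  also have "\<dots> = (\<Prod>q\<in>{1..n}-{i}. if q < i then F q i else 1) *
      (\<Prod>q\<in>{1..n}-{i}. (if q < i then 1 else F i q) * (\<Prod>p\<in>{1..<q}-{i}. F p q))"
    by (simp only: below above cong: prod.cong)
  also have "\<dots> = (\<Prod>q\<in>{1..n}-{i}. (if q < i then F q i else 1) * (if q < i then 1 else F i q)) *
    (\<Prod>q\<in>{1..n}-{i}. \<Prod>p\<in>{1..<q}-{i}. F p q)"
    by (simp only: prod.distrib mult.assoc)
  also have "(\<Prod>q\<in>{1..n}-{i}. (if q < i then F q i else 1) * (if q < i then 1 else F i q)) =
     (\<Prod>q\<in>{1..n}-{i}. if q < i then F q i else F i q)"
    by (rule prod.cong) auto
  finally show ?thesis .
qed

text \<open>The degree may equal the number of nodes, so the values at the nodes determine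
  \<open>f\<close> only up to a multiple of the nodal polynomial; the leading coefficient fixes that
  multiple. The difference \<open>g\<close> of both sides has no coefficient in this degree and a
  root at every node, hence is zero.\<close>

lemma lagrange_interpolation:
  fixes x :: "'i \<Rightarrow> 'a::field" and f :: "'a poly"
  assumes S: "finite S" and inj: "inj_on x S" and deg: "degree f \<le> card S"
  shows "poly f y = coeff f (card S) * (\<Prod>p\<in>S. y - x p) +
    (\<Sum>p\<in>S. poly f (x p) * (\<Prod>q\<in>S-{p}. (y - x q) / (x p - x q)))"
proof -
  define P where "P = (\<lambda>T. \<Prod>q\<in>T. [:- x q, 1:])"
  define g where "g = f - smult (coeff f (card S)) (P S) -
    (\<Sum>p\<in>S. smult (poly f (x p) / (\<Prod>q\<in>S-{p}. x p - x q)) (P (S-{p})))"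
  have pP: "poly (P T) u = (\<Prod>q\<in>T. u - x q)" for T u
    by (simp add: P_def poly_prod)
  have dP: "degree (P T) = card T" for T
    by (simp add: P_def degree_prod_eq_sum_degree)
  have lP: "lead_coeff (P T) = 1" for T
    unfolding P_def lead_coeff_prod by simp
  have sum_poly: "poly (\<Sum>p\<in>S. smult (poly f (x p) / (\<Prod>q\<in>S-{p}. x p - x q)) (P (S-{p}))) u =
     (\<Sum>p\<in>S. poly f (x p) * (\<Prod>q\<in>S-{p}. (u - x q) / (x p - x q)))" for u
    by (simp add: poly_sum pP prod_dividef)
  have root: "poly g (x r) = 0" if r: "r \<in> S" for r
  proof -
    have "(\<Prod>p\<in>S. x r - x p) = 0" using r S by (auto simp: prod_zero_iff)
    moreover have "(\<Sum>p\<in>S. poly f (x p) * (\<Prod>q\<in>S-{p}. (x r - x q) / (x p - x q))) = poly f (x r)"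
    proof -
      have "(\<Sum>p\<in>S. poly f (x p) * (\<Prod>q\<in>S-{p}. (x r - x q) / (x p - x q))) =
         (\<Sum>p\<in>S. if p = r then poly f (x r) else 0)"
      proof (rule sum.cong[OF refl])
        fix p assume p: "p \<in> S"
        show "poly f (x p) * (\<Prod>q\<in>S-{p}. (x r - x q) / (x p - x q)) = (if p = r then poly f (x r) else 0)"
        proof (cases "p = r")
          case True
          have "(\<Prod>q\<in>S-{p}. (x r - x q) / (x p - x q)) = (\<Prod>q\<in>S-{p}. 1)"
            using inj p by (intro prod.cong) (auto simp: True inj_on_def)
          then show ?thesis using True by simp
        next
          case False
          then have "(\<Prod>q\<in>S-{p}. (x r - x q) / (x p - x q)) = 0"
            using r S by (auto simp: prod_zero_iff)
          then show ?thesis using False by simp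
        qed
      qed
      then show ?thesis using r S by simp
    qed
    ultimately show ?thesis by (simp add: g_def sum_poly pP)
  qed
  have "degree g \<le> card S"
    unfolding g_def
    by (intro degree_diff_le deg order.trans[OF degree_smult_le] degree_sum_le S)
       (auto simp: dP card_Diff1_le)
  moreover have "coeff g (card S) = 0"
  proof -
    have "coeff (P (S-{p})) (card S) = 0" if "p \<in> S" for p
      using that S by (intro coeff_eq_0) (unfold dP, rule card_Diff1_less)
    moreover have "coeff (P S) (card S) = 1" using lP[of S] by (simp add: dP)
    ultimately show ?thesis by (simp add: g_def coeff_sum)
  qed
  moreover have "card S \<le> card {u. poly g u = 0}" if "g \<noteq> 0"
    using root inj poly_roots_finite[OF that]
    by (intro card_inj_on_le[of x]) auto
  ultimately have "g = 0"
    by (metis card_poly_roots_bound le_antisym le_trans leading_coeff_0_iff)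
  then have "poly g y = 0" by simp
  then show ?thesis by (simp add: g_def sum_poly pP algebra_simps)
qed

lemma sum_PiE_remove:
  assumes S: "finite S" "p \<in> S"
  shows "(\<Sum>\<mu>\<in>PiE S J. F \<mu>) = (\<Sum>\<mu>\<in>PiE (S-{p}) J. \<Sum>i\<in>J p. F (\<mu>(p := i)))"
proof -
  have ins: "S = insert p (S-{p})" using S by auto
  have "(\<Sum>\<mu>\<in>PiE S J. F \<mu>) = (\<Sum>\<mu>\<in>PiE (insert p (S-{p})) J. F \<mu>)" using ins by simp
  also have "\<dots> = (\<Sum>\<mu>\<in>(\<lambda>(y, g). g(p := y)) ` (J p \<times> PiE (S-{p}) J). F \<mu>)"
    by (simp only: PiE_insert_eq)
  also have "\<dots> = (\<Sum>u\<in>J p \<times> PiE (S-{p}) J. F ((\<lambda>(y, g). g(p := y)) u))"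
    by (subst sum.reindex[OF inj_combinator]) simp_all
  also have "\<dots> = (\<Sum>i\<in>J p. \<Sum>\<mu>\<in>PiE (S-{p}) J. F (\<mu>(p := i)))"
    by (simp add: sum.cartesian_product case_prod_beta)
  finally show ?thesis by (simp add: sum.swap[of _ "J p"])
qed

text \<open>The factors are oriented so that the product is positive on strictly decreasing
  vectors.\<close>

definition vand :: "nat \<Rightarrow> (nat \<Rightarrow> 'a::comm_ring_1) \<Rightarrow> 'a" where
  "vand n x = (\<Prod>q\<in>{1..n}. \<Prod>p\<in>{1..<q}. x p - x q)"

text \<open>After the denominators are cancelled, the Vandermonde product retains only factors
  without the \<open>p\<close>-th coordinate, and \<open>G\<close> and the other weights do not
  contain it either. The inner sum over that coordinate is then the vanishing sum of
  \<open>t p i * \<phi> i\<close>.\<close>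

lemma sum_vand_annihilate:
  fixes X t :: "nat \<Rightarrow> int \<Rightarrow> 'a::field"
  assumes p: "p \<in> {1..n}"
    and zero: "(\<Sum>i\<in>J p. t p i * \<phi> i) = 0"
    and G: "\<And>\<mu> i. i \<in> J p \<Longrightarrow> G (\<mu>(p := i)) = G \<mu>"
    and dist: "\<And>q i j. q \<in> {1..n} \<Longrightarrow> q \<noteq> p \<Longrightarrow> i \<in> J p \<Longrightarrow> j \<in> J q \<Longrightarrow> X p i \<noteq> X q j"
  shows "(\<Sum>\<mu>\<in>PiE {1..n} J. vand n (\<lambda>q. X q (\<mu> q)) * (\<Prod>q\<in>{1..n}. t q (\<mu> q)) *
     (\<phi> (\<mu> p) * G \<mu> / (\<Prod>q\<in>{1..n}-{p}. X p (\<mu> p) - X q (\<mu> q)))) = 0"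
proof -
  \<comment> \<open>Sign from the pairs \<open>(q, p)\<close> with \<open>q < p\<close>, where the
    Vandermonde factor is the negative of the factor in the denominator.\<close>
  define c where "c = (\<Prod>q\<in>{1..n}-{p}. if q < p then - 1 else (1::'a))"
  define V where "V = (\<lambda>\<mu>. \<Prod>q\<in>{1..n}-{p}. \<Prod>r\<in>{1..<q}-{p}. X r (\<mu> r) - X q (\<mu> q))"
  define T where "T = (\<lambda>\<mu>. \<Prod>q\<in>{1..n}-{p}. t q (\<mu> q))"
  have V: "vand n (\<lambda>q. X q (\<mu> q)) = c * (\<Prod>q\<in>{1..n}-{p}. X p (\<mu> p) - X q (\<mu> q)) * V \<mu>" for \<mu>
  proof -
    have "(\<Prod>q\<in>{1..n}-{p}. if q < p then X q (\<mu> q) - X p (\<mu> p) else X p (\<mu> p) - X q (\<mu> q)) =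
       c * (\<Prod>q\<in>{1..n}-{p}. X p (\<mu> p) - X q (\<mu> q))"
      unfolding c_def prod.distrib[symmetric] by (rule prod.cong) auto
    then show ?thesis
      unfolding vand_def V_def by (subst prod_pairs_split[OF p]) simp
  qed
  have "vand n (\<lambda>q. X q (\<mu> q)) * (\<Prod>q\<in>{1..n}. t q (\<mu> q)) *
     (\<phi> (\<mu> p) * G \<mu> / (\<Prod>q\<in>{1..n}-{p}. X p (\<mu> p) - X q (\<mu> q))) =
     (t p (\<mu> p) * \<phi> (\<mu> p)) * (c * V \<mu> * T \<mu> * G \<mu>)" if "\<mu> \<in> PiE {1..n} J" for \<mu>
  proof -
    have "(\<Prod>q\<in>{1..n}-{p}. X p (\<mu> p) - X q (\<mu> q)) \<noteq> 0"
      using that p dist[of _ "\<mu> p"] by (force simp: prod_zero_iff PiE_iff)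
    moreover have "(\<Prod>q\<in>{1..n}. t q (\<mu> q)) = t p (\<mu> p) * T \<mu>"
      unfolding T_def using p by (simp add: prod.remove)
    ultimately show ?thesis by (simp add: V field_simps)
  qed
  then have "(\<Sum>\<mu>\<in>PiE {1..n} J. vand n (\<lambda>q. X q (\<mu> q)) * (\<Prod>q\<in>{1..n}. t q (\<mu> q)) *
     (\<phi> (\<mu> p) * G \<mu> / (\<Prod>q\<in>{1..n}-{p}. X p (\<mu> p) - X q (\<mu> q)))) =
     (\<Sum>\<mu>\<in>PiE {1..n} J. (t p (\<mu> p) * \<phi> (\<mu> p)) * (c * V \<mu> * T \<mu> * G \<mu>))"
    by (intro sum.cong) auto
  also have "\<dots> = (\<Sum>\<mu>\<in>PiE ({1..n}-{p}) J. \<Sum>i\<in>J p. (t p i * \<phi> i) * (c * V \<mu> * T \<mu> * G \<mu>))"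
  proof (subst sum_PiE_remove[OF _ p], simp, intro sum.cong refl)
    fix \<mu> i assume i: "i \<in> J p"
    have "V (\<mu>(p := i)) = V \<mu>" "T (\<mu>(p := i)) = T \<mu>"
      unfolding V_def T_def by (auto intro!: prod.cong)
    then show "t p ((\<mu>(p := i)) p) * \<phi> ((\<mu>(p := i)) p) * (c * V (\<mu>(p := i)) * T (\<mu>(p := i)) * G (\<mu>(p := i))) =
        (t p i * \<phi> i) * (c * V \<mu> * T \<mu> * G \<mu>)"
      using G[OF i] by simp
  qed
  also have "\<dots> = 0" by (simp add: sum_distrib_right[symmetric] zero)
  finally show ?thesis .
qed

text \<open>Interpolation at the \<open>n\<close> coordinates together with \<open>z\<close> and
  \<open>z - 1\<close>: the two extra nodes give the products on the left, \<open>poly f y\<close>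
  gives the right-hand side, and each remaining term carries the quotient in \<open>zero\<close>,
  which is \<open>f x / ((z - x) * (z - 1 - x))\<close> in partial fractions.\<close>

lemma sum_vand_two_point:
  fixes X t :: "nat \<Rightarrow> int \<Rightarrow> 'a::field" and A B :: "'a poly"
  assumes A: "degree A = Suc n" "lead_coeff A = 1" and B: "degree B = Suc n" "lead_coeff B = 1"
    and zero: "\<And>p. p \<in> {1..n} \<Longrightarrow>
      (\<Sum>i\<in>J p. t p i * (poly A (X p i) / (z - 1 - X p i) - poly B (X p i) / (z - X p i))) = 0"
    and zX: "\<And>p i. p \<in> {1..n} \<Longrightarrow> i \<in> J p \<Longrightarrow> z \<noteq> X p i \<and> z - 1 \<noteq> X p i"
    and dist: "\<And>p q i j. p \<in> {1..n} \<Longrightarrow> q \<in> {1..n} \<Longrightarrow> q \<noteq> p \<Longrightarrow> i \<in> J p \<Longrightarrow> j \<in> J q \<Longrightarrow> X p i \<noteq> X q j"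
  shows "(\<Sum>\<mu>\<in>PiE {1..n} J. vand n (\<lambda>q. X q (\<mu> q)) * (\<Prod>q\<in>{1..n}. t q (\<mu> q)) *
       ((1 + y - z) * poly B z * (\<Prod>p\<in>{1..n}. (y - X p (\<mu> p)) / (z - X p (\<mu> p)))
        - (y - z) * poly A (z - 1) * (\<Prod>p\<in>{1..n}. (y - X p (\<mu> p)) / (z - 1 - X p (\<mu> p))))) =
     (\<Sum>\<mu>\<in>PiE {1..n} J. vand n (\<lambda>q. X q (\<mu> q)) * (\<Prod>q\<in>{1..n}. t q (\<mu> q)) *
       ((1 + y - z) * poly B y - (y - z) * poly A y))"
proof -
  \<comment> \<open>This form of \<open>A x * (z - x) - B x * (z - 1 - x)\<close> shows the degree:
    \<open>A\<close> and \<open>B\<close> are monic of equal degree, so it is at most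
    \<open>n + 1\<close>, one below the number of nodes, and the leading term of the interpolation
    formula drops out.\<close>
  define f where "f = (A - B) * [:z, -1:] + B"
  define \<phi> where "\<phi> = (\<lambda>p i. poly A (X p i) / (z - 1 - X p i) - poly B (X p i) / (z - X p i))"
  define G where "G = (\<lambda>p \<mu>. (y - z) * (1 + y - z) * (\<Prod>q\<in>{1..n}-{p}. y - X q (\<mu> q)))"
  have pf: "poly f x = poly A x * (z - x) - poly B x * (z - 1 - x)" for x
    by (simp add: f_def algebra_simps)
  have deg: "degree f \<le> n + 2"
  proof -
    have "degree (A - B) \<le> Suc n" using A B by (intro degree_diff_le) auto
    moreover have "degree ([:z, -1:] :: 'a poly) \<le> 1" by simp
    ultimately have "degree ((A - B) * [:z, -1:]) \<le> n + 2"
      using degree_mult_le[of "A - B" "[:z, -1:]"] by linarith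
    then show ?thesis unfolding f_def using B by (intro degree_add_le) auto
  qed
  have cf: "coeff f (n + 2) = 0"
  proof -
    have "A - B \<noteq> 0 \<Longrightarrow> degree (A - B) < Suc n"
      using A B by (metis coeff_diff degree_diff_le diff_self leading_coeff_0_iff le_neq_implies_less order_refl)
    then have "degree ((A - B) * [:z, -1:]) \<le> n + 1"
      using degree_mult_le[of "A - B" "[:z, -1:]"] by (cases "A - B = 0") auto
    then have "degree f \<le> n + 1" unfolding f_def using B by (intro degree_add_le) auto
    then show ?thesis by (intro coeff_eq_0) simp
  qed
  have main: "(1 + y - z) * poly B z * (\<Prod>p\<in>{1..n}. (y - X p (\<mu> p)) / (z - X p (\<mu> p)))
        - (y - z) * poly A (z - 1) * (\<Prod>p\<in>{1..n}. (y - X p (\<mu> p)) / (z - 1 - X p (\<mu> p))) =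
      poly f y - (\<Sum>p\<in>{1..n}. \<phi> p (\<mu> p) * G p \<mu> / (\<Prod>q\<in>{1..n}-{p}. X p (\<mu> p) - X q (\<mu> q)))"
    if \<mu>: "\<mu> \<in> PiE {1..n} J" for \<mu>
  proof -
    \<comment> \<open>The indices \<open>0\<close> and \<open>Suc n\<close> lie outside
      \<open>{1..n}\<close> and carry the two extra nodes.\<close>
    define x where "x = (\<lambda>q. if q = 0 then z else if q = Suc n then z - 1 else X q (\<mu> q))"
    define S where "S = {0..Suc n}"
    have S: "S = insert 0 (insert (Suc n) {1..n})" by (auto simp: S_def)
    have mem: "\<mu> p \<in> J p" if "p \<in> {1..n}" for p using \<mu> that by (auto simp: PiE_iff)
    have "inj_on x S"
      unfolding S x_def inj_on_def using zX dist mem by (auto split: if_splits) (metis+)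
    then have "poly f y = coeff f (card S) * (\<Prod>p\<in>S. y - x p) +
      (\<Sum>p\<in>S. poly f (x p) * (\<Prod>q\<in>S-{p}. (y - x q) / (x p - x q)))"
      using deg by (intro lagrange_interpolation) (auto simp: S_def)
    also have "\<dots> = (\<Sum>p\<in>S. poly f (x p) * (\<Prod>q\<in>S-{p}. (y - x q) / (x p - x q)))"
      using cf by (simp add: S_def)
    also have "\<dots> = poly f z * (\<Prod>q\<in>S-{0}. (y - x q) / (z - x q)) +
        poly f (z - 1) * (\<Prod>q\<in>S-{Suc n}. (y - x q) / (z - 1 - x q)) +
        (\<Sum>p\<in>{1..n}. poly f (x p) * (\<Prod>q\<in>S-{p}. (y - x q) / (x p - x q)))"
      unfolding S by (simp add: x_def)
    also have "(\<Prod>q\<in>S-{0}. (y - x q) / (z - x q)) =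
       (1 + y - z) * (\<Prod>p\<in>{1..n}. (y - X p (\<mu> p)) / (z - X p (\<mu> p)))"
    proof -
      have "S - {0} = insert (Suc n) {1..n}" by (auto simp: S)
      then have "(\<Prod>q\<in>S-{0}. (y - x q) / (z - x q)) = (1 + y - z) * (\<Prod>q\<in>{1..n}. (y - x q) / (z - x q))"
        by (simp add: x_def algebra_simps)
      also have "(\<Prod>q\<in>{1..n}. (y - x q) / (z - x q)) = (\<Prod>p\<in>{1..n}. (y - X p (\<mu> p)) / (z - X p (\<mu> p)))"
        by (rule prod.cong) (auto simp: x_def)
      finally show ?thesis .
    qed
    also have "(\<Prod>q\<in>S-{Suc n}. (y - x q) / (z - 1 - x q)) =
       - (y - z) * (\<Prod>p\<in>{1..n}. (y - X p (\<mu> p)) / (z - 1 - X p (\<mu> p)))"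
    proof -
      have "S - {Suc n} = insert 0 {1..n}" by (auto simp: S)
      then have "(\<Prod>q\<in>S-{Suc n}. (y - x q) / (z - 1 - x q)) = - (y - z) * (\<Prod>q\<in>{1..n}. (y - x q) / (z - 1 - x q))"
        by (simp add: x_def)
      also have "(\<Prod>q\<in>{1..n}. (y - x q) / (z - 1 - x q)) = (\<Prod>p\<in>{1..n}. (y - X p (\<mu> p)) / (z - 1 - X p (\<mu> p)))"
        by (rule prod.cong) (auto simp: x_def)
      finally show ?thesis .
    qed
    also have "(\<Sum>p\<in>{1..n}. poly f (x p) * (\<Prod>q\<in>S-{p}. (y - x q) / (x p - x q))) =
      (\<Sum>p\<in>{1..n}. \<phi> p (\<mu> p) * G p \<mu> / (\<Prod>q\<in>{1..n}-{p}. X p (\<mu> p) - X q (\<mu> q)))"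
    proof (rule sum.cong[OF refl])
      fix p assume p: "p \<in> {1..n}"
      define v where "v = X p (\<mu> p)"
      have v: "z - v \<noteq> 0" "z - 1 - v \<noteq> 0" using zX[OF p mem[OF p]] by (auto simp: v_def)
      have xp: "x p = v" using p by (simp add: x_def v_def)
      have "S - {p} = insert 0 (insert (Suc n) ({1..n}-{p}))" using p by (auto simp: S)
      then have "(\<Prod>q\<in>S-{p}. (y - x q) / (x p - x q)) =
         ((y - z) / (v - z)) * ((y - (z - 1)) / (v - (z - 1))) * (\<Prod>q\<in>{1..n}-{p}. (y - x q) / (v - x q))"
        by (simp add: xp) (simp add: x_def)
      also have "(\<Prod>q\<in>{1..n}-{p}. (y - x q) / (v - x q)) = (\<Prod>q\<in>{1..n}-{p}. (y - X q (\<mu> q)) / (v - X q (\<mu> q)))"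
        by (rule prod.cong) (auto simp: x_def)
      also have "((y - z) / (v - z)) * ((y - (z - 1)) / (v - (z - 1))) = (y - z) * (1 + y - z) / ((z - v) * (z - 1 - v))"
      proof -
        have "(v - z) * (v - (z - 1)) = (z - v) * (z - 1 - v)" by (simp add: algebra_simps)
        then show ?thesis by (simp add: algebra_simps)
      qed
      finally have e: "(\<Prod>q\<in>S-{p}. (y - x q) / (x p - x q)) =
         (y - z) * (1 + y - z) / ((z - v) * (z - 1 - v)) * (\<Prod>q\<in>{1..n}-{p}. (y - X q (\<mu> q)) / (v - X q (\<mu> q)))" .
      have \<phi>: "\<phi> p (\<mu> p) = poly f v / ((z - v) * (z - 1 - v))"
        unfolding \<phi>_def pf v_def[symmetric] using v by (simp add: field_simps)
      show "poly f (x p) * (\<Prod>q\<in>S-{p}. (y - x q) / (x p - x q)) =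
         \<phi> p (\<mu> p) * G p \<mu> / (\<Prod>q\<in>{1..n}-{p}. X p (\<mu> p) - X q (\<mu> q))"
        unfolding e \<phi> G_def by (simp add: xp prod_dividef v_def)
    qed
    finally show ?thesis by (simp add: pf algebra_simps)
  qed
  have ann: "(\<Sum>\<mu>\<in>PiE {1..n} J. vand n (\<lambda>q. X q (\<mu> q)) * (\<Prod>q\<in>{1..n}. t q (\<mu> q)) *
     (\<phi> p (\<mu> p) * G p \<mu> / (\<Prod>q\<in>{1..n}-{p}. X p (\<mu> p) - X q (\<mu> q)))) = 0" if p: "p \<in> {1..n}" for p
    using p zero[OF p] dist[OF p]
    by (intro sum_vand_annihilate) (auto simp: G_def \<phi>_def intro!: prod.cong)
  have "(\<Sum>\<mu>\<in>PiE {1..n} J. vand n (\<lambda>q. X q (\<mu> q)) * (\<Prod>q\<in>{1..n}. t q (\<mu> q)) *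
       ((1 + y - z) * poly B z * (\<Prod>p\<in>{1..n}. (y - X p (\<mu> p)) / (z - X p (\<mu> p)))
        - (y - z) * poly A (z - 1) * (\<Prod>p\<in>{1..n}. (y - X p (\<mu> p)) / (z - 1 - X p (\<mu> p))))) =
     (\<Sum>\<mu>\<in>PiE {1..n} J. vand n (\<lambda>q. X q (\<mu> q)) * (\<Prod>q\<in>{1..n}. t q (\<mu> q)) * poly f y) -
     (\<Sum>p\<in>{1..n}. \<Sum>\<mu>\<in>PiE {1..n} J. vand n (\<lambda>q. X q (\<mu> q)) * (\<Prod>q\<in>{1..n}. t q (\<mu> q)) *
     (\<phi> p (\<mu> p) * G p \<mu> / (\<Prod>q\<in>{1..n}-{p}. X p (\<mu> p) - X q (\<mu> q))))"
    by (subst sum.swap) (simp only: main right_diff_distrib sum_subtractf sum_distrib_left cong: sum.cong)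
  also have "poly f y = (1 + y - z) * poly B y - (y - z) * poly A y"
    by (simp add: pf algebra_simps)
  finally show ?thesis using ann by simp
qed

text \<open>With only \<open>n\<close> nodes and degree up to \<open>n\<close>, the interpolation
  formula keeps its leading term. Combining the formulas at \<open>u\<close> and \<open>v\<close>
  crosswise eliminates it, and the terms left over are annihilated coordinate by coordinate.\<close>

lemma sum_vand_one_point:
  fixes X t :: "nat \<Rightarrow> int \<Rightarrow> 'a::field" and f :: "'a poly"
  assumes deg: "degree f \<le> n"
    and zero: "\<And>p. p \<in> {1..n} \<Longrightarrow> (\<Sum>i\<in>J p. t p i * poly f (X p i)) = 0"
    and dist: "\<And>p q i j. p \<in> {1..n} \<Longrightarrow> q \<in> {1..n} \<Longrightarrow> q \<noteq> p \<Longrightarrow> i \<in> J p \<Longrightarrow> j \<in> J q \<Longrightarrow> X p i \<noteq> X q j"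
  shows "poly f u * (\<Sum>\<mu>\<in>PiE {1..n} J. vand n (\<lambda>q. X q (\<mu> q)) * (\<Prod>q\<in>{1..n}. t q (\<mu> q)) * (\<Prod>q\<in>{1..n}. v - X q (\<mu> q))) =
         poly f v * (\<Sum>\<mu>\<in>PiE {1..n} J. vand n (\<lambda>q. X q (\<mu> q)) * (\<Prod>q\<in>{1..n}. t q (\<mu> q)) * (\<Prod>q\<in>{1..n}. u - X q (\<mu> q)))"
proof -
  define D where "D = (\<lambda>p \<mu>. \<Prod>q\<in>{1..n}-{p}. X p (\<mu> p) - X q (\<mu> q))"
  define G where "G = (\<lambda>p \<mu>. (v - u) * ((\<Prod>q\<in>{1..n}-{p}. u - X q (\<mu> q)) * (\<Prod>q\<in>{1..n}-{p}. v - X q (\<mu> q))))"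
  have main: "poly f u * (\<Prod>q\<in>{1..n}. v - X q (\<mu> q)) - poly f v * (\<Prod>q\<in>{1..n}. u - X q (\<mu> q)) =
      (\<Sum>p\<in>{1..n}. poly f (X p (\<mu> p)) * G p \<mu> / D p \<mu>)"
    if \<mu>: "\<mu> \<in> PiE {1..n} J" for \<mu>
  proof -
    have mem: "\<mu> p \<in> J p" if "p \<in> {1..n}" for p using \<mu> that by (auto simp: PiE_iff)
    have "inj_on (\<lambda>p. X p (\<mu> p)) {1..n}"
      unfolding inj_on_def using dist mem by blast
    then have L: "poly f y = coeff f n * (\<Prod>p\<in>{1..n}. y - X p (\<mu> p)) +
        (\<Sum>p\<in>{1..n}. poly f (X p (\<mu> p)) * (\<Prod>q\<in>{1..n}-{p}. y - X q (\<mu> q)) / D p \<mu>)" for y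
      using lagrange_interpolation[of "{1..n}" "\<lambda>p. X p (\<mu> p)" f y] deg
      by (simp add: prod_dividef D_def)
    have P: "(\<Prod>q\<in>{1..n}. y - X q (\<mu> q)) = (y - X p (\<mu> p)) * (\<Prod>q\<in>{1..n}-{p}. y - X q (\<mu> q))"
      if "p \<in> {1..n}" for p y
      using that by (simp add: prod.remove)
    have "poly f u * (\<Prod>q\<in>{1..n}. v - X q (\<mu> q)) - poly f v * (\<Prod>q\<in>{1..n}. u - X q (\<mu> q)) =
      (\<Sum>p\<in>{1..n}. poly f (X p (\<mu> p)) * (\<Prod>q\<in>{1..n}-{p}. u - X q (\<mu> q)) / D p \<mu> * (\<Prod>q\<in>{1..n}. v - X q (\<mu> q)))
     - (\<Sum>p\<in>{1..n}. poly f (X p (\<mu> p)) * (\<Prod>q\<in>{1..n}-{p}. v - X q (\<mu> q)) / D p \<mu> * (\<Prod>q\<in>{1..n}. u - X q (\<mu> q)))"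
      by (simp only: L[of u] L[of v] sum_distrib_right[symmetric]) (simp add: algebra_simps)
    also have "\<dots> = (\<Sum>p\<in>{1..n}. poly f (X p (\<mu> p)) * G p \<mu> / D p \<mu>)"
      unfolding sum_subtractf[symmetric]
    proof (rule sum.cong[OF refl])
      fix p assume p: "p \<in> {1..n}"
      show "poly f (X p (\<mu> p)) * (\<Prod>q\<in>{1..n}-{p}. u - X q (\<mu> q)) / D p \<mu> * (\<Prod>q\<in>{1..n}. v - X q (\<mu> q)) -
         poly f (X p (\<mu> p)) * (\<Prod>q\<in>{1..n}-{p}. v - X q (\<mu> q)) / D p \<mu> * (\<Prod>q\<in>{1..n}. u - X q (\<mu> q)) =
         poly f (X p (\<mu> p)) * G p \<mu> / D p \<mu>"
        unfolding P[OF p] G_def by (simp add: algebra_simps diff_divide_distrib add_divide_distrib)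
    qed
    finally show ?thesis .
  qed
  have ann: "(\<Sum>\<mu>\<in>PiE {1..n} J. vand n (\<lambda>q. X q (\<mu> q)) * (\<Prod>q\<in>{1..n}. t q (\<mu> q)) *
     (poly f (X p (\<mu> p)) * G p \<mu> / D p \<mu>)) = 0" if p: "p \<in> {1..n}" for p
    unfolding D_def using p zero[OF p] dist[OF p]
    by (intro sum_vand_annihilate[where \<phi> = "\<lambda>i. poly f (X p i)"])
       (auto simp: G_def intro!: prod.cong arg_cong2[where f = "(*)"])
  have "poly f u * (\<Sum>\<mu>\<in>PiE {1..n} J. vand n (\<lambda>q. X q (\<mu> q)) * (\<Prod>q\<in>{1..n}. t q (\<mu> q)) * (\<Prod>q\<in>{1..n}. v - X q (\<mu> q))) -
      poly f v * (\<Sum>\<mu>\<in>PiE {1..n} J. vand n (\<lambda>q. X q (\<mu> q)) * (\<Prod>q\<in>{1..n}. t q (\<mu> q)) * (\<Prod>q\<in>{1..n}. u - X q (\<mu> q))) =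
     (\<Sum>\<mu>\<in>PiE {1..n} J. vand n (\<lambda>q. X q (\<mu> q)) * (\<Prod>q\<in>{1..n}. t q (\<mu> q)) *
       (poly f u * (\<Prod>q\<in>{1..n}. v - X q (\<mu> q)) - poly f v * (\<Prod>q\<in>{1..n}. u - X q (\<mu> q))))"
    by (simp add: sum_distrib_left sum_subtractf algebra_simps)
  also have "\<dots> = (\<Sum>p\<in>{1..n}. \<Sum>\<mu>\<in>PiE {1..n} J. vand n (\<lambda>q. X q (\<mu> q)) * (\<Prod>q\<in>{1..n}. t q (\<mu> q)) *
     (poly f (X p (\<mu> p)) * G p \<mu> / D p \<mu>))"
    by (subst sum.swap) (simp only: main sum_distrib_left cong: sum.cong)
  also have "\<dots> = 0" using ann by simp
  finally show ?thesis by simp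
qed

section \<open>Interlacing sums\<close>

lemma sum_telescope_int:
  fixes u T :: "int \<Rightarrow> 'a::ab_group_add"
  assumes ab: "a \<le> b" and T: "T a = 0" and u: "u b = 0" and step: "\<And>i. a \<le> i \<Longrightarrow> i < b \<Longrightarrow> u i = T (i + 1)"
  shows "(\<Sum>i\<in>{a..b}. u i - T i) = 0"
proof -
  have "(\<Sum>i\<in>{a..b}. u i) = (\<Sum>i\<in>{a..<b}. u i)"
    using ab u by (subst sum.remove[of _ b]) (auto intro!: sum.cong)
  also have "\<dots> = (\<Sum>i\<in>{a..<b}. T (i + 1))" using step by (intro sum.cong) auto
  also have "\<dots> = (\<Sum>i\<in>{a+1..b}. T i)"
    by (rule sum.reindex_bij_witness[of _ "\<lambda>i. i - 1" "\<lambda>i. i + 1"]) auto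
  also have "\<dots> = (\<Sum>i\<in>{a..b}. T i)"
    using ab T by (subst (2) sum.remove[of _ a]) (auto intro!: sum.cong)
  finally show ?thesis by (simp add: sum_subtractf)
qed

section \<open>One-variable weights on the interlacing ranges\<close>

definition lat :: "real \<Rightarrow> (nat \<Rightarrow> int) \<Rightarrow> nat \<Rightarrow> real" where
  "lat \<theta> \<kappa> i = of_int (\<kappa> i) - real i * \<theta>"

text \<open>The same coordinate as \<open>lat\<close>, with the integer part as a separate argument,
  so that the weight of one coordinate becomes a function on an interval of integers.\<close>

definition pt :: "real \<Rightarrow> nat \<Rightarrow> int \<Rightarrow> real" where
  "pt \<theta> p i = of_int i - real p * \<theta>"

text \<open>The factor of the third (\<open>p < q\<close>) or fourth (\<open>q \<le> p\<close>)
  product of \<open>I_weight\<close> that joins the coordinate \<open>x = m p\<close> to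
  \<open>l q\<close>.\<close>

definition hfac :: "real \<Rightarrow> (nat \<Rightarrow> real) \<Rightarrow> nat \<Rightarrow> nat \<Rightarrow> real \<Rightarrow> real" where
  "hfac \<theta> l p q x = (if p < q then Gamma (x - l q) / Gamma (x - l q + 1 - \<theta>)
                     else Gamma (l q - x + \<theta>) / Gamma (l q - x + 1))"

text \<open>The range below zero is needed: for \<open>\<theta> < 1\<close> some arguments used
  later, such as \<open>\<theta> - 1\<close>, lie between \<open>-1\<close> and
  \<open>0\<close>.\<close>

lemma Gamma_real_plus1':
  fixes x :: real
  assumes "x > -1" "x \<noteq> 0" shows "Gamma (x + 1) = x * Gamma x"
proof (rule Gamma_plus1)
  show "x \<notin> \<int>\<^sub>\<le>\<^sub>0"
  proof
    assume "x \<in> \<int>\<^sub>\<le>\<^sub>0"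
    then obtain k :: int where "x = of_int k" "k \<le> 0" by (auto elim!: nonpos_Ints_cases)
    then show False using assms by auto
  qed
qed

corollary Gamma_real_plus1: "x > 0 \<Longrightarrow> Gamma (x + 1) = x * Gamma (x :: real)"
  by (rule Gamma_real_plus1') auto

text \<open>Both Gamma quotients solve the same first-order difference equation in \<open>x\<close>.
  The case distinction only selects the solution whose Gamma arguments are positive on the range of
  the coordinate, so the product over all \<open>q\<close> telescopes regardless of the order of
  \<open>p\<close> and \<open>q\<close>.\<close>

lemma hfac_step:
  assumes "p < q \<Longrightarrow> 0 < x - l q \<and> 0 < x - l q + 1 - \<theta>"
    and "\<not> p < q \<Longrightarrow> 0 < l q - x \<and> 0 < l q - x - 1 + \<theta>"
  shows "hfac \<theta> l p q (x + 1) * (x + 1 - l q - \<theta>) = hfac \<theta> l p q x * (x - l q)"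
proof (cases "p < q")
  case True
  have "Gamma (x + 1 - l q) = (x - l q) * Gamma (x - l q)"
    "Gamma (x + 1 - l q + 1 - \<theta>) = (x - l q + 1 - \<theta>) * Gamma (x - l q + 1 - \<theta>)"
    using assms(1)[OF True] Gamma_real_plus1[of "x - l q"] Gamma_real_plus1[of "x - l q + 1 - \<theta>"]
    by (simp_all add: algebra_simps)
  moreover define v where "v = x - l q + 1 - \<theta>"
  moreover define g where "g = Gamma v"
  ultimately have "hfac \<theta> l p q (x + 1) = (x - l q) * Gamma (x - l q) / (v * g)"
    "hfac \<theta> l p q x = Gamma (x - l q) / g"
    using True by (simp_all add: hfac_def)
  moreover have "x + 1 - l q - \<theta> = v" "v \<noteq> 0" using assms(1)[OF True] by (auto simp: v_def)
  ultimately show ?thesis by simp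
next
  case False
  define u where "u = l q - x"
  have u: "u > 0" "u - 1 + \<theta> > 0" using assms(2)[OF False] by (auto simp: u_def)
  define v where "v = u - 1 + \<theta>"
  have "Gamma (u + 1) = u * Gamma u" "Gamma (v + 1) = v * Gamma v" "v > 0"
    using u Gamma_real_plus1[of u] Gamma_real_plus1[of v] by (simp_all add: v_def)
  moreover have "hfac \<theta> l p q (x + 1) = Gamma v / Gamma u" "hfac \<theta> l p q x = Gamma (v + 1) / Gamma (u + 1)"
    using False by (simp_all add: hfac_def u_def v_def algebra_simps)
  moreover have "x + 1 - l q - \<theta> = - v" "x - l q = - u"
    by (simp_all add: u_def v_def)
  ultimately show ?thesis using u by simp
qed

lemma lat_pt_pos:
  assumes \<theta>: "\<theta> > 0" and anti: "antimono_on {1..Suc n} \<kappa>"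
    and p: "p \<in> {1..n}" and q: "q \<in> {1..Suc n}" and i: "\<kappa> (Suc p) \<le> i"
  shows "p < q \<Longrightarrow> pt \<theta> p i - lat \<theta> \<kappa> q \<ge> \<theta>"
    and "\<not> p < q \<Longrightarrow> lat \<theta> \<kappa> q - pt \<theta> p i \<ge> of_int (\<kappa> q - i)"
proof -
  show "pt \<theta> p i - lat \<theta> \<kappa> q \<ge> \<theta>" if "p < q"
  proof -
    have "\<kappa> q \<le> i" using monotone_onD[OF anti, of "Suc p" q] that p q i by auto
    moreover have "real q \<ge> real p + 1" using that by linarith
    then have "real q * \<theta> \<ge> real p * \<theta> + \<theta>"
      using \<theta> by (metis distrib_right mult_le_cancel_right mult_1 not_less_iff_gr_or_eq)
    ultimately show ?thesis by (simp add: pt_def lat_def)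
  qed
  show "lat \<theta> \<kappa> q - pt \<theta> p i \<ge> of_int (\<kappa> q - i)" if "\<not> p < q"
    using that \<theta> by (simp add: pt_def lat_def mult_right_mono)
qed

text \<open>The index set \<open>Q\<close> is a parameter because the comparison of two adjacent
  vectors \<open>l\<close> leaves out the one index at which they differ.\<close>

definition tau :: "real \<Rightarrow> (nat \<Rightarrow> int) \<Rightarrow> nat set \<Rightarrow> nat \<Rightarrow> int \<Rightarrow> real" where
  "tau \<theta> \<kappa> Q p i = (\<Prod>q\<in>Q. hfac \<theta> (lat \<theta> \<kappa>) p q (pt \<theta> p i))"

text \<open>The strict upper bound on \<open>i\<close> concerns only the \<open>q\<close> in
  \<open>Q\<close>; with an index \<open>r\<close> removed from \<open>Q\<close>, the step may go
  past \<open>\<kappa> r\<close>.\<close>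

lemma tau_step:
  assumes \<theta>: "\<theta> > 0" and anti: "antimono_on {1..Suc n} \<kappa>"
    and p: "p \<in> {1..n}" and Q: "Q \<subseteq> {1..Suc n}"
    and i: "\<kappa> (Suc p) \<le> i" "\<And>q. q \<in> Q \<Longrightarrow> q \<le> p \<Longrightarrow> i < \<kappa> q"
  shows "tau \<theta> \<kappa> Q p (i + 1) * (\<Prod>q\<in>Q. pt \<theta> p (i + 1) - lat \<theta> \<kappa> q - \<theta>) =
         tau \<theta> \<kappa> Q p i * (\<Prod>q\<in>Q. pt \<theta> p i - lat \<theta> \<kappa> q)"
  unfolding tau_def prod.distrib[symmetric]
proof (rule prod.cong[OF refl])
  fix q assume "q \<in> Q"
  with Q have q: "q \<in> {1..Suc n}" by auto
  have e: "pt \<theta> p (i + 1) = pt \<theta> p i + 1" by (simp add: pt_def)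
  note * = lat_pt_pos[OF \<theta> anti p q i(1)]
  have ge1: "of_int (\<kappa> q - i) \<ge> (1::real)" if "\<not> p < q"
    using i(2)[OF \<open>q \<in> Q\<close>] that by simp
  show "hfac \<theta> (lat \<theta> \<kappa>) p q (pt \<theta> p (i + 1)) * (pt \<theta> p (i + 1) - lat \<theta> \<kappa> q - \<theta>) =
     hfac \<theta> (lat \<theta> \<kappa>) p q (pt \<theta> p i) * (pt \<theta> p i - lat \<theta> \<kappa> q)"
    unfolding e using * \<theta> ge1 by (intro hfac_step) force+
qed

text \<open>Neighbouring integer ranges share an end point; the shift by multiples of
  \<open>\<theta>\<close> is what separates them.\<close>

lemma pt_less:
  assumes \<theta>: "\<theta> > 0" and anti: "antimono_on {1..Suc n} \<kappa>"
    and p: "p \<in> {1..n}" "q \<in> {1..n}" "p < q" and i: "i \<in> {\<kappa> (Suc p)..\<kappa> p}" "j \<in> {\<kappa> (Suc q)..\<kappa> q}"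
  shows "pt \<theta> q j < pt \<theta> p i"
proof -
  have "\<kappa> q \<le> \<kappa> (Suc p)" using p by (intro monotone_onD[OF anti]) auto
  then have "j \<le> i" using i by auto
  moreover have "real p * \<theta> < real q * \<theta>" using p \<theta> by simp
  ultimately show ?thesis by (simp add: pt_def)
qed

lemma pt_distinct:
  assumes "\<theta> > 0" and "antimono_on {1..Suc n} \<kappa>"
    and "p \<in> {1..n}" "q \<in> {1..n}" "q \<noteq> p" and "i \<in> {\<kappa> (Suc p)..\<kappa> p}" "j \<in> {\<kappa> (Suc q)..\<kappa> q}"
  shows "pt \<theta> p i \<noteq> pt \<theta> q j"
  using pt_less[OF assms(1-4), of i j] pt_less[OF assms(1,2,4,3), of j i] assms(5-7)
  by (cases "p < q") force+

lemma sum_interlacing_two_point: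
  fixes y z :: complex
  assumes \<theta>: "\<theta> > 0" and anti: "antimono_on {1..Suc n} \<kappa>"
    and z: "\<And>p i. p \<in> {1..n} \<Longrightarrow> i \<in> {\<kappa> (Suc p)..\<kappa> p} \<Longrightarrow>
               z \<noteq> of_real (pt \<theta> p i) \<and> z - 1 \<noteq> of_real (pt \<theta> p i)"
  defines "J \<equiv> \<lambda>p. {\<kappa> (Suc p)..\<kappa> p}" and "l \<equiv> lat \<theta> \<kappa>"
  shows "(\<Sum>\<mu>\<in>PiE {1..n} J. of_real (vand n (\<lambda>q. pt \<theta> q (\<mu> q)) * (\<Prod>q\<in>{1..n}. tau \<theta> \<kappa> {1..Suc n} q (\<mu> q))) *
       ((1 + y - z) * (\<Prod>q\<in>{1..Suc n}. z - of_real (l q) - of_real \<theta>) *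
          (\<Prod>p\<in>{1..n}. (y - of_real (pt \<theta> p (\<mu> p))) / (z - of_real (pt \<theta> p (\<mu> p))))
        - (y - z) * (\<Prod>q\<in>{1..Suc n}. z - 1 - of_real (l q)) *
          (\<Prod>p\<in>{1..n}. (y - of_real (pt \<theta> p (\<mu> p))) / (z - 1 - of_real (pt \<theta> p (\<mu> p)))))) =
     (\<Sum>\<mu>\<in>PiE {1..n} J. of_real (vand n (\<lambda>q. pt \<theta> q (\<mu> q)) * (\<Prod>q\<in>{1..n}. tau \<theta> \<kappa> {1..Suc n} q (\<mu> q))) *
       ((1 + y - z) * (\<Prod>q\<in>{1..Suc n}. y - of_real (l q) - of_real \<theta>)
        - (y - z) * (\<Prod>q\<in>{1..Suc n}. y - of_real (l q))))"
proof -
  define A where "A = (\<Prod>q\<in>{1..Suc n}. [:- complex_of_real (l q), 1:])"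
  define B where "B = (\<Prod>q\<in>{1..Suc n}. [:- complex_of_real (l q + \<theta>), 1:])"
  have pA: "poly A u = (\<Prod>q\<in>{1..Suc n}. u - of_real (l q))" for u
    unfolding A_def poly_prod by simp
  have pB: "poly B u = (\<Prod>q\<in>{1..Suc n}. u - of_real (l q) - of_real \<theta>)" for u
    unfolding B_def poly_prod by (simp add: algebra_simps)
  have "degree A = Suc n" "degree B = Suc n"
    unfolding A_def B_def by (subst degree_prod_eq_sum_degree; simp)+
  moreover have "lead_coeff A = 1" "lead_coeff B = 1"
    unfolding A_def B_def lead_coeff_prod by simp_all
  moreover have "(\<Sum>i\<in>J p. of_real (tau \<theta> \<kappa> {1..Suc n} p i) *
      (poly A (of_real (pt \<theta> p i)) / (z - 1 - of_real (pt \<theta> p i)) - poly B (of_real (pt \<theta> p i)) / (z - of_real (pt \<theta> p i)))) = 0"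
    if p: "p \<in> {1..n}" for p
  proof -
    define u where "u = (\<lambda>i. of_real (tau \<theta> \<kappa> {1..Suc n} p i) * poly A (of_real (pt \<theta> p i)) / (z - 1 - of_real (pt \<theta> p i)))"
    define T where "T = (\<lambda>i. of_real (tau \<theta> \<kappa> {1..Suc n} p i) * poly B (of_real (pt \<theta> p i)) / (z - of_real (pt \<theta> p i)))"
    have "(\<Sum>i\<in>{\<kappa> (Suc p)..\<kappa> p}. u i - T i) = 0"
    proof (rule sum_telescope_int)
      show "\<kappa> (Suc p) \<le> \<kappa> p" using p by (intro monotone_onD[OF anti]) auto
      \<comment> \<open>\<open>pt \<theta> p (\<kappa> (Suc p))\<close> equals
        \<open>l (Suc p) + \<theta>\<close>, a root of \<open>B\<close>; likewise the upper end is
        \<open>l p\<close>, a root of \<open>A\<close>.\<close>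
      have "poly B (of_real (pt \<theta> p (\<kappa> (Suc p)))) = 0"
        unfolding pB using p by (intro prod_zero) (auto intro!: bexI[of _ "Suc p"] simp: pt_def l_def lat_def algebra_simps)
      then show "T (\<kappa> (Suc p)) = 0" by (simp add: T_def)
      have "poly A (of_real (pt \<theta> p (\<kappa> p))) = 0"
        unfolding pA using p by (intro prod_zero) (auto intro!: bexI[of _ p] simp: pt_def l_def lat_def)
      then show "u (\<kappa> p) = 0" by (simp add: u_def)
      fix i assume i: "\<kappa> (Suc p) \<le> i" "i < \<kappa> p"
      have less: "i < \<kappa> q" if "q \<in> {1..Suc n}" "q \<le> p" for q
        using monotone_onD[OF anti that(1), of p] that p i by auto
      have "of_real (tau \<theta> \<kappa> {1..Suc n} p (i + 1)) * poly B (of_real (pt \<theta> p (i + 1))) =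
         of_real (tau \<theta> \<kappa> {1..Suc n} p i) * poly A (of_real (pt \<theta> p i))"
        unfolding pA pB l_def using arg_cong[OF tau_step[OF \<theta> anti p order.refl i(1) less], of complex_of_real]
        by (simp only: of_real_mult of_real_prod of_real_diff)
      moreover have "z - of_real (pt \<theta> p (i + 1)) = z - 1 - of_real (pt \<theta> p i)" by (simp add: pt_def)
      ultimately show "u i = T (i + 1)" by (simp add: u_def T_def)
    qed
    then show ?thesis by (simp add: u_def T_def J_def right_diff_distrib)
  qed
  moreover have "of_real (pt \<theta> p i) \<noteq> complex_of_real (pt \<theta> q j)"
    if "p \<in> {1..n}" "q \<in> {1..n}" "q \<noteq> p" "i \<in> J p" "j \<in> J q" for p q i j
    using pt_distinct[OF \<theta> anti that(1-3)] that(4,5) by (simp add: J_def)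
  moreover have "z \<noteq> of_real (pt \<theta> p i) \<and> z - 1 \<noteq> of_real (pt \<theta> p i)" if "p \<in> {1..n}" "i \<in> J p" for p i
    using z that by (simp add: J_def)
  ultimately have *: "(\<Sum>\<mu>\<in>PiE {1..n} J. vand n (\<lambda>q. complex_of_real (pt \<theta> q (\<mu> q))) * (\<Prod>q\<in>{1..n}. of_real (tau \<theta> \<kappa> {1..Suc n} q (\<mu> q))) *
       ((1 + y - z) * poly B z * (\<Prod>p\<in>{1..n}. (y - of_real (pt \<theta> p (\<mu> p))) / (z - of_real (pt \<theta> p (\<mu> p))))
        - (y - z) * poly A (z - 1) * (\<Prod>p\<in>{1..n}. (y - of_real (pt \<theta> p (\<mu> p))) / (z - 1 - of_real (pt \<theta> p (\<mu> p)))))) =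
     (\<Sum>\<mu>\<in>PiE {1..n} J. vand n (\<lambda>q. complex_of_real (pt \<theta> q (\<mu> q))) * (\<Prod>q\<in>{1..n}. of_real (tau \<theta> \<kappa> {1..Suc n} q (\<mu> q))) *
       ((1 + y - z) * poly B y - (y - z) * poly A y))"
    by (intro sum_vand_two_point) auto
  have v: "complex_of_real (vand n x) = vand n (\<lambda>q. of_real (x q))" for x
    by (simp add: vand_def)
  show ?thesis using * by (simp only: pA pB v of_real_mult of_real_prod)
qed

text \<open>
  The common divisor of the factors \<open>hfac\<close> for \<open>l i = a\<close> and for \<open>l i = a + 1\<close>, up to linear
  factors. It lets both weights be summed over the union of the two interlacing ranges,
  including the end points that belong to one range only.
\<close>

definition efac :: "real \<Rightarrow> real \<Rightarrow> bool \<Rightarrow> real \<Rightarrow> real" where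
  "efac \<theta> a b x = (if b then - Gamma (x - a - 1) / Gamma (x - a + 1 - \<theta>)
                   else Gamma (a - x + \<theta>) / Gamma (a - x + 2))"

text \<open>For \<open>p = i\<close> the linear factor vanishes at \<open>x = l i + 1\<close>, the
  one point that the range gains at its top when \<open>l i\<close> grows by one. The sign in
  \<open>efac\<close> makes the linear factor the same in both branches.\<close>

lemma efac_lower:
  assumes "p < i \<Longrightarrow> x - l i > 0 \<and> x - l i \<noteq> 1" and "\<not> p < i \<Longrightarrow> l i - x \<ge> 0"
  shows "hfac \<theta> l p i x = efac \<theta> (l i) (p < i) x * (l i + 1 - x)"
proof (cases "p < i")
  case True
  define v where "v = x - l i - 1"
  have "Gamma (v + 1) = v * Gamma v"
    using assms(1)[OF True] Gamma_real_plus1'[of v] by (simp_all add: v_def)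
  moreover have "hfac \<theta> l p i x = Gamma (v + 1) / Gamma (x - l i + 1 - \<theta>)"
    "efac \<theta> (l i) (p < i) x = - Gamma v / Gamma (x - l i + 1 - \<theta>)" "l i + 1 - x = - v"
    using True by (simp_all add: hfac_def efac_def v_def)
  ultimately show ?thesis by simp
next
  case False
  define v where "v = l i - x + 1"
  have "Gamma (v + 1) = v * Gamma v" "v > 0"
    using assms(2)[OF False] Gamma_real_plus1'[of v] by (simp_all add: v_def)
  moreover have "hfac \<theta> l p i x = Gamma (l i - x + \<theta>) / Gamma v"
    "efac \<theta> (l i) (p < i) x = Gamma (l i - x + \<theta>) / Gamma (v + 1)" "l i + 1 - x = v"
    using False by (simp_all add: hfac_def efac_def v_def algebra_simps)
  ultimately show ?thesis by simp
qed

text \<open>Here \<open>l i\<close> is the enlarged value. The linear factor vanishes at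
  \<open>x = a + \<theta>\<close>, the bottom point that the range of coordinate
  \<open>i - 1\<close> loses.\<close>

lemma efac_upper:
  assumes "p < i \<Longrightarrow> x - a - \<theta> > 0" and "\<not> p < i \<Longrightarrow> a - x + \<theta> > -1 \<and> a - x + \<theta> \<noteq> 0"
    and l: "l i = a + 1"
  shows "hfac \<theta> l p i x = efac \<theta> a (p < i) x * (a + \<theta> - x)"
proof (cases "p < i")
  case True
  define v where "v = x - a - \<theta>"
  have "Gamma (v + 1) = v * Gamma v" "v > 0"
    using assms(1)[OF True] Gamma_real_plus1'[of v] by (simp_all add: v_def)
  moreover have "hfac \<theta> l p i x = Gamma (x - a - 1) / Gamma v"
    "efac \<theta> a (p < i) x = - Gamma (x - a - 1) / Gamma (v + 1)" "a + \<theta> - x = - v"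
    using True by (simp_all add: hfac_def efac_def v_def l algebra_simps)
  ultimately show ?thesis by simp
next
  case False
  define v where "v = a - x + \<theta>"
  have "Gamma (v + 1) = v * Gamma v"
    using assms(2)[OF False] Gamma_real_plus1'[of v] by (simp_all add: v_def)
  moreover have "hfac \<theta> l p i x = Gamma (v + 1) / Gamma (a - x + 2)"
    "efac \<theta> a (p < i) x = Gamma v / Gamma (a - x + 2)" "a + \<theta> - x = v"
    using False by (simp_all add: hfac_def efac_def v_def l algebra_simps)
  ultimately show ?thesis by simp
qed

text \<open>This is the recursion of \<open>hfac\<close> with \<open>x - a - 1\<close> in place of
  \<open>x - a\<close>; it yields the telescoping of the common weight between \<open>B\<close> and
  \<open>(x - l r - 1) * Ar\<close> in \<open>K_sum_step\<close>.\<close>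

lemma efac_step:
  assumes "b \<Longrightarrow> x - a > 0 \<and> x - a \<noteq> 1 \<and> x - a + 1 - \<theta> > 0"
    and "\<not> b \<Longrightarrow> a - x + 1 > 0 \<and> a - x - 1 + \<theta> > -1 \<and> a - x - 1 + \<theta> \<noteq> 0"
  shows "efac \<theta> a b (x + 1) * (x + 1 - a - \<theta>) = efac \<theta> a b x * (x - a - 1)"
proof (cases b)
  case True
  define v where "v = x - a + 1 - \<theta>"
  define w where "w = x - a - 1"
  have "Gamma (v + 1) = v * Gamma v" "v > 0" "Gamma (w + 1) = w * Gamma w"
    using assms(1)[OF True] Gamma_real_plus1'[of v] Gamma_real_plus1'[of w] by (simp_all add: v_def w_def)
  moreover have "efac \<theta> a b (x + 1) = - Gamma (w + 1) / Gamma (v + 1)"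
    "efac \<theta> a b x = - Gamma w / Gamma v" "x + 1 - a - \<theta> = v" "x - a - 1 = w"
    using True by (simp_all add: efac_def v_def w_def algebra_simps)
  ultimately show ?thesis by simp
next
  case False
  define v where "v = a - x - 1 + \<theta>"
  define w where "w = a - x + 1"
  have "Gamma (v + 1) = v * Gamma v" "w > 0" "Gamma (w + 1) = w * Gamma w"
    using assms(2)[OF False] Gamma_real_plus1'[of v] Gamma_real_plus1'[of w] by (simp_all add: v_def w_def)
  moreover have "efac \<theta> a b (x + 1) = Gamma v / Gamma w"
    "efac \<theta> a b x = Gamma (v + 1) / Gamma (w + 1)" "x + 1 - a - \<theta> = - v" "x - a - 1 = - w"
    using False by (simp_all add: efac_def v_def w_def algebra_simps)
  ultimately show ?thesis by simp
qed

text \<open>The total conditional weight of level \<open>n\<close> without the factor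
  \<open>C_top\<close>, which depends on the upper level alone.\<close>

definition K_sum :: "real \<Rightarrow> nat \<Rightarrow> (nat \<Rightarrow> int) \<Rightarrow> real" where
  "K_sum \<theta> n \<kappa> = (\<Sum>\<mu>\<in>PiE {1..n} (\<lambda>p. {\<kappa> (Suc p)..\<kappa> p}).
     vand n (\<lambda>q. pt \<theta> q (\<mu> q)) * (\<Prod>q\<in>{1..n}. tau \<theta> \<kappa> {1..Suc n} q (\<mu> q)))"

text \<open>Both sums can be taken over one range with one weight, and then differ only in the
  point, \<open>l r + 1\<close> or \<open>l r + \<theta>\<close>, at which a product of linear
  factors is evaluated. The polynomial \<open>f\<close> relates two such products, and at each of
  the points only one of its two parts survives.\<close>

lemma K_sum_step:
  assumes \<theta>: "\<theta> > 0" "\<theta> \<noteq> 1" and anti: "antimono_on {1..Suc n} \<kappa>"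
    and r: "r \<in> {1..Suc n}" and anti': "antimono_on {1..Suc n} (\<kappa>(r := \<kappa> r + 1))"
  defines "l \<equiv> lat \<theta> \<kappa>"
  shows "K_sum \<theta> n (\<kappa>(r := \<kappa> r + 1)) * (\<Prod>q\<in>{1..Suc n}-{r}. l r + 1 - l q - \<theta>) =
         K_sum \<theta> n \<kappa> * (\<Prod>q\<in>{1..Suc n}-{r}. l r + \<theta> - l q)"
proof -
  define \<kappa>' where "\<kappa>' = \<kappa>(r := \<kappa> r + 1)"
  define Q where "Q = {1..Suc n} - {r}"
  have anti'': "antimono_on {1..Suc n} \<kappa>'" using anti' by (simp add: \<kappa>'_def)
  \<comment> \<open>The union of both ranges: that of \<open>\<kappa>\<close> lacks only the top
    point for \<open>p = r\<close>, that of \<open>\<kappa>'\<close> only the bottom point for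
    \<open>Suc p = r\<close>.\<close>
  define J where "J = (\<lambda>p. {\<kappa> (Suc p)..\<kappa>' p})"
  define t where "t = (\<lambda>p j. efac \<theta> (l r) (p < r) (pt \<theta> p j) * tau \<theta> \<kappa> Q p j)"
  have \<kappa>'r: "\<kappa>' r = \<kappa> r + 1" and \<kappa>'q: "q \<noteq> r \<Longrightarrow> \<kappa>' q = \<kappa> q" for q by (simp_all add: \<kappa>'_def)
  have lt: "\<kappa> r + 1 \<le> \<kappa> q" if "q \<in> {1..Suc n}" "q < r" for q
    using monotone_onD[OF anti'' that(1) r] that \<kappa>'r \<kappa>'q[of q] by auto
  have gt: "\<kappa> q \<le> \<kappa> r" if "q \<in> {1..Suc n}" "q \<ge> r" for q
    using monotone_onD[OF anti r that(1)] that by auto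
  have mono_\<theta>: "real b * \<theta> \<ge> real a * \<theta> + \<theta>" if "a < b" for a b
  proof -
    have "(real a + 1) * \<theta> \<le> real b * \<theta>" using that \<theta> by (intro mult_right_mono) auto
    then show ?thesis by (simp add: algebra_simps)
  qed
  \<comment> \<open>The value \<open>1\<close> would be a pole of \<open>Gamma (x - l r - 1)\<close>
    in \<open>efac\<close>. It is excluded by \<open>\<theta> \<noteq> 1\<close> at the end point
    \<open>j = \<kappa> r\<close> with \<open>Suc p = r\<close>, and by a distance above
    \<open>1\<close> otherwise.\<close>
  have posA: "pt \<theta> p j - l r \<ge> \<theta> \<and> pt \<theta> p j - l r \<noteq> 1" if "p < r" "p \<in> {1..n}" "\<kappa> (Suc p) \<le> j" for p j
  proof (cases "Suc p = r")
    case True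
    have "pt \<theta> p j - l r = of_int (j - \<kappa> r) + \<theta>"
      unfolding True[symmetric] by (simp add: pt_def l_def lat_def algebra_simps)
    moreover have "j - \<kappa> r = 0 \<or> j - \<kappa> r \<ge> 1" using that True by auto
    ultimately show ?thesis using \<theta> by auto
  next
    case False
    then have "\<kappa> r + 1 \<le> \<kappa> (Suc p)" using that by (intro lt) auto
    then have "of_int j \<ge> of_int (\<kappa> r) + (1::real)" using that by linarith
    then show ?thesis using mono_\<theta>[of p r] that \<theta> by (auto simp: pt_def l_def lat_def)
  qed
  have posB: "l r - pt \<theta> p j \<ge> of_int (\<kappa> r - j)" if "\<not> p < r" for p j
    using that \<theta> by (simp add: pt_def l_def lat_def mult_right_mono)
  \<comment> \<open>For \<open>p = r\<close> and \<open>j = \<kappa> r + 1\<close> the value is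
    \<open>\<theta> - 1\<close>, possibly negative but above \<open>-1\<close>, and nonzero since
    \<open>\<theta> \<noteq> 1\<close>.\<close>
  have posC: "l r - pt \<theta> p j + \<theta> > -1 \<and> l r - pt \<theta> p j + \<theta> \<noteq> 0"
    if "\<not> p < r" "p \<in> {1..n}" "j \<le> \<kappa>' p" for p j
  proof (cases "p = r")
    case True
    have "j \<le> \<kappa> r \<or> j = \<kappa> r + 1" using that True \<kappa>'r by auto
    then show ?thesis using True \<theta> by (auto simp: pt_def l_def lat_def)
  next
    case False
    then have "j \<le> \<kappa> r" using that gt[of p] \<kappa>'q[of p] by auto
    then show ?thesis using posB[of p j] that \<theta> by auto
  qed
  have tau_split: "tau \<theta> \<kappa>'' {1..Suc n} p j = hfac \<theta> (lat \<theta> \<kappa>'') p r (pt \<theta> p j) * tau \<theta> \<kappa> Q p j"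
    if "\<And>q. q \<noteq> r \<Longrightarrow> \<kappa>'' q = \<kappa> q" for \<kappa>'' p j
  proof -
    have "tau \<theta> \<kappa>'' {1..Suc n} p j = hfac \<theta> (lat \<theta> \<kappa>'') p r (pt \<theta> p j) * tau \<theta> \<kappa>'' Q p j"
      unfolding tau_def Q_def using r by (intro prod.remove) auto
    also have "tau \<theta> \<kappa>'' Q p j = tau \<theta> \<kappa> Q p j"
      unfolding tau_def Q_def using that by (intro prod.cong refl) (simp add: hfac_def lat_def)
    finally show ?thesis .
  qed
  have lower: "tau \<theta> \<kappa> {1..Suc n} p j = t p j * (l r + 1 - pt \<theta> p j)"
    if "p \<in> {1..n}" "j \<in> {\<kappa> (Suc p)..\<kappa> p}" for p j
  proof -
    have "hfac \<theta> l p r (pt \<theta> p j) = efac \<theta> (l r) (p < r) (pt \<theta> p j) * (l r + 1 - pt \<theta> p j)"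
    proof (rule efac_lower)
      show "p < r \<Longrightarrow> 0 < pt \<theta> p j - l r \<and> pt \<theta> p j - l r \<noteq> 1"
        using posA[of p j] that \<theta> by auto
      assume "\<not> p < r"
      moreover from this have "j \<le> \<kappa> r" using gt[of p] that by auto
      ultimately show "0 \<le> l r - pt \<theta> p j" using posB[of p j] by simp
    qed
    then show ?thesis unfolding tau_split[of \<kappa>, OF refl] t_def by (simp add: l_def)
  qed
  have upper: "tau \<theta> \<kappa>' {1..Suc n} p j = t p j * (l r + \<theta> - pt \<theta> p j)"
    if "p \<in> {1..n}" "j \<in> {\<kappa>' (Suc p)..\<kappa>' p}" for p j
  proof -
    have "hfac \<theta> (lat \<theta> \<kappa>') p r (pt \<theta> p j) = efac \<theta> (l r) (p < r) (pt \<theta> p j) * (l r + \<theta> - pt \<theta> p j)"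
    proof (rule efac_upper)
      show "lat \<theta> \<kappa>' r = l r + 1" by (simp add: l_def lat_def \<kappa>'r)
      show "\<not> p < r \<Longrightarrow> - 1 < l r - pt \<theta> p j + \<theta> \<and> l r - pt \<theta> p j + \<theta> \<noteq> 0"
        using posC[of p j] that by auto
      assume "p < r"
      moreover from this have "\<kappa> r + 1 \<le> j"
        using monotone_onD[OF anti'' _ r, of "Suc p"] that \<kappa>'r by auto
      then have "of_int j \<ge> of_int (\<kappa> r) + (1::real)" by linarith
      ultimately show "0 < pt \<theta> p j - l r - \<theta>"
        using mono_\<theta>[of p r] by (simp add: l_def lat_def pt_def)
    qed
    moreover have "tau \<theta> \<kappa>' {1..Suc n} p j = hfac \<theta> (lat \<theta> \<kappa>') p r (pt \<theta> p j) * tau \<theta> \<kappa> Q p j"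
      by (rule tau_split) (rule \<kappa>'q)
    ultimately show ?thesis by (simp only: t_def mult_ac)
  qed
  have ext1: "K_sum \<theta> n \<kappa> = (\<Sum>\<mu>\<in>PiE {1..n} J. vand n (\<lambda>q. pt \<theta> q (\<mu> q)) *
      (\<Prod>q\<in>{1..n}. t q (\<mu> q)) * (\<Prod>q\<in>{1..n}. l r + 1 - pt \<theta> q (\<mu> q)))"
    unfolding K_sum_def
  proof (rule sum.mono_neutral_cong_left)
    show "finite (PiE {1..n} J)" by (simp add: finite_PiE J_def)
    show "PiE {1..n} (\<lambda>p. {\<kappa> (Suc p)..\<kappa> p}) \<subseteq> PiE {1..n} J"
      by (intro PiE_mono) (auto simp: J_def \<kappa>'_def)
    show "\<forall>\<mu>\<in>PiE {1..n} J - PiE {1..n} (\<lambda>p. {\<kappa> (Suc p)..\<kappa> p}). vand n (\<lambda>q. pt \<theta> q (\<mu> q)) *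
      (\<Prod>q\<in>{1..n}. t q (\<mu> q)) * (\<Prod>q\<in>{1..n}. l r + 1 - pt \<theta> q (\<mu> q)) = 0"
    proof
      fix \<mu> assume "\<mu> \<in> PiE {1..n} J - PiE {1..n} (\<lambda>p. {\<kappa> (Suc p)..\<kappa> p})"
      then obtain p where p: "p \<in> {1..n}" "\<mu> p \<in> J p" "\<mu> p \<notin> {\<kappa> (Suc p)..\<kappa> p}"
        by (auto simp: PiE_iff)
      then have "p = r" "\<mu> p = \<kappa> r + 1" using \<kappa>'q[of p] \<kappa>'r by (auto simp: J_def) (cases "p = r"; auto)+
      then have "l r + 1 - pt \<theta> p (\<mu> p) = 0" by (simp add: l_def lat_def pt_def)
      then have "(\<Prod>q\<in>{1..n}. l r + 1 - pt \<theta> q (\<mu> q)) = 0" using p by (intro prod_zero) auto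
      then show "vand n (\<lambda>q. pt \<theta> q (\<mu> q)) *
        (\<Prod>q\<in>{1..n}. t q (\<mu> q)) * (\<Prod>q\<in>{1..n}. l r + 1 - pt \<theta> q (\<mu> q)) = 0" by simp
    qed
    fix \<mu> assume "\<mu> \<in> PiE {1..n} (\<lambda>p. {\<kappa> (Suc p)..\<kappa> p})"
    then have "(\<Prod>q\<in>{1..n}. tau \<theta> \<kappa> {1..Suc n} q (\<mu> q)) = (\<Prod>q\<in>{1..n}. t q (\<mu> q) * (l r + 1 - pt \<theta> q (\<mu> q)))"
      by (intro prod.cong lower) (auto simp: PiE_iff)
    then show "vand n (\<lambda>q. pt \<theta> q (\<mu> q)) * (\<Prod>q\<in>{1..n}. tau \<theta> \<kappa> {1..Suc n} q (\<mu> q)) =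
        vand n (\<lambda>q. pt \<theta> q (\<mu> q)) *
      (\<Prod>q\<in>{1..n}. t q (\<mu> q)) * (\<Prod>q\<in>{1..n}. l r + 1 - pt \<theta> q (\<mu> q))"
      by (simp add: prod.distrib)
  qed
  have ext2: "K_sum \<theta> n \<kappa>' = (\<Sum>\<mu>\<in>PiE {1..n} J. vand n (\<lambda>q. pt \<theta> q (\<mu> q)) *
      (\<Prod>q\<in>{1..n}. t q (\<mu> q)) * (\<Prod>q\<in>{1..n}. l r + \<theta> - pt \<theta> q (\<mu> q)))"
    unfolding K_sum_def
  proof (rule sum.mono_neutral_cong_left)
    show "finite (PiE {1..n} J)" by (simp add: finite_PiE J_def)
    show "PiE {1..n} (\<lambda>p. {\<kappa>' (Suc p)..\<kappa>' p}) \<subseteq> PiE {1..n} J"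
      by (intro PiE_mono) (auto simp: J_def \<kappa>'_def)
    show "\<forall>\<mu>\<in>PiE {1..n} J - PiE {1..n} (\<lambda>p. {\<kappa>' (Suc p)..\<kappa>' p}). vand n (\<lambda>q. pt \<theta> q (\<mu> q)) *
      (\<Prod>q\<in>{1..n}. t q (\<mu> q)) * (\<Prod>q\<in>{1..n}. l r + \<theta> - pt \<theta> q (\<mu> q)) = 0"
    proof
      fix \<mu> assume "\<mu> \<in> PiE {1..n} J - PiE {1..n} (\<lambda>p. {\<kappa>' (Suc p)..\<kappa>' p})"
      then obtain p where p: "p \<in> {1..n}" "\<mu> p \<in> J p" "\<mu> p \<notin> {\<kappa>' (Suc p)..\<kappa>' p}"
        by (auto simp: PiE_iff)
      have r': "r = Suc p" using p \<kappa>'q[of "Suc p"] by (auto simp: J_def)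
      have "\<mu> p = \<kappa> r" using p \<kappa>'r unfolding r' by (auto simp: J_def)
      then have "l r + \<theta> - pt \<theta> p (\<mu> p) = 0" using r' by (simp add: l_def lat_def pt_def algebra_simps)
      then have "(\<Prod>q\<in>{1..n}. l r + \<theta> - pt \<theta> q (\<mu> q)) = 0" using p by (intro prod_zero) auto
      then show "vand n (\<lambda>q. pt \<theta> q (\<mu> q)) *
        (\<Prod>q\<in>{1..n}. t q (\<mu> q)) * (\<Prod>q\<in>{1..n}. l r + \<theta> - pt \<theta> q (\<mu> q)) = 0" by simp
    qed
    fix \<mu> assume "\<mu> \<in> PiE {1..n} (\<lambda>p. {\<kappa>' (Suc p)..\<kappa>' p})"
    then have "(\<Prod>q\<in>{1..n}. tau \<theta> \<kappa>' {1..Suc n} q (\<mu> q)) = (\<Prod>q\<in>{1..n}. t q (\<mu> q) * (l r + \<theta> - pt \<theta> q (\<mu> q)))"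
      by (intro prod.cong upper) (auto simp: PiE_iff)
    then show "vand n (\<lambda>q. pt \<theta> q (\<mu> q)) * (\<Prod>q\<in>{1..n}. tau \<theta> \<kappa>' {1..Suc n} q (\<mu> q)) =
        vand n (\<lambda>q. pt \<theta> q (\<mu> q)) *
      (\<Prod>q\<in>{1..n}. t q (\<mu> q)) * (\<Prod>q\<in>{1..n}. l r + \<theta> - pt \<theta> q (\<mu> q))"
      by (simp add: prod.distrib)
  qed
  define B where "B = (\<Prod>q\<in>{1..Suc n}. [:- (l q + \<theta>), 1:])"
  define A where "A = (\<Prod>q\<in>{1..Suc n}. [:- l q, 1:])"
  define Ar where "Ar = (\<Prod>q\<in>Q. [:- l q, 1:])"
  \<comment> \<open>Equal to \<open>B u + (l r + 1 - u) * Ar u\<close>: the second summand vanishes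
    at \<open>l r + 1\<close>, the first at \<open>l r + \<theta>\<close>. Subtracting
    \<open>A\<close> brings the degree down to \<open>n\<close>.\<close>
  define f where "f = (B - A) + Ar"
  have pB: "poly B u = (\<Prod>q\<in>{1..Suc n}. u - l q - \<theta>)" for u
    unfolding B_def poly_prod by (simp add: algebra_simps)
  have pAr: "poly Ar u = (\<Prod>q\<in>Q. u - l q)" for u
    unfolding Ar_def poly_prod by simp
  have A_Ar: "A = [:- l r, 1:] * Ar"
    unfolding A_def Ar_def Q_def using r by (subst prod.remove[of _ r]) auto
  have pf: "poly f u = poly B u + (l r + 1 - u) * poly Ar u" for u
    by (simp add: f_def A_Ar algebra_simps)
  have B_r: "poly B u = (u - l r - \<theta>) * (\<Prod>q\<in>Q. u - l q - \<theta>)" for u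
    unfolding pB Q_def using r by (subst prod.remove[of _ r]) auto
  have "degree f \<le> n"
  proof -
    have dA: "degree A = Suc n" "degree B = Suc n"
      unfolding A_def B_def by (subst degree_prod_eq_sum_degree; simp)+
    have "lead_coeff A = 1" "lead_coeff B = 1"
      unfolding A_def B_def lead_coeff_prod by simp_all
    then have "coeff (B - A) (Suc n) = 0" using dA by simp
    moreover have "degree (B - A) \<le> Suc n" using dA by (intro degree_diff_le) auto
    ultimately have "degree (B - A) \<le> n"
      by (metis degree_0 le_SucE leading_coeff_0_iff zero_le)
    moreover have "degree Ar \<le> n"
      unfolding Ar_def Q_def using r by (subst degree_prod_eq_sum_degree) auto
    ultimately show ?thesis unfolding f_def by (intro degree_add_le)
  qed
  moreover have "(\<Sum>j\<in>J p. t p j * poly f (pt \<theta> p j)) = 0" if p: "p \<in> {1..n}" for p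
  proof -
    define u where "u = (\<lambda>j. t p j * (pt \<theta> p j - l r - 1) * poly Ar (pt \<theta> p j))"
    define T where "T = (\<lambda>j. t p j * poly B (pt \<theta> p j))"
    have "(\<Sum>j\<in>{\<kappa> (Suc p)..\<kappa>' p}. u j - T j) = 0"
    proof (rule sum_telescope_int)
      have "\<kappa> (Suc p) \<le> \<kappa> p" using p by (intro monotone_onD[OF anti]) auto
      then show "\<kappa> (Suc p) \<le> \<kappa>' p" using \<kappa>'q[of p] \<kappa>'r by (cases "p = r") auto
      have "poly B (pt \<theta> p (\<kappa> (Suc p))) = 0"
        unfolding pB using p by (intro prod_zero) (auto intro!: bexI[of _ "Suc p"] simp: pt_def l_def lat_def algebra_simps)
      then show "T (\<kappa> (Suc p)) = 0" by (simp add: T_def)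
      show "u (\<kappa>' p) = 0"
      proof (cases "p = r")
        case True
        then show ?thesis using \<kappa>'r by (simp add: u_def pt_def l_def lat_def)
      next
        case False
        then have "poly Ar (pt \<theta> p (\<kappa>' p)) = 0"
          unfolding pAr Q_def using p \<kappa>'q[OF False]
          by (intro prod_zero) (auto intro!: bexI[of _ p] simp: pt_def l_def lat_def)
        then show ?thesis by (simp add: u_def)
      qed
      fix j assume j: "\<kappa> (Suc p) \<le> j" "j < \<kappa>' p"
      have less: "j < \<kappa> q" if "q \<in> Q" "q \<le> p" for q
        using monotone_onD[OF anti'', of q p] that p j \<kappa>'q[of q] by (auto simp: Q_def)
      have e: "pt \<theta> p (j + 1) = pt \<theta> p j + 1" by (simp add: pt_def)
      have 1: "tau \<theta> \<kappa> Q p (j + 1) * (\<Prod>q\<in>Q. pt \<theta> p (j + 1) - l q - \<theta>) = tau \<theta> \<kappa> Q p j * (\<Prod>q\<in>Q. pt \<theta> p j - l q)"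
        unfolding l_def by (rule tau_step[OF \<theta>(1) anti p _ j(1) less]) (auto simp: Q_def)
      have 2: "efac \<theta> (l r) (p < r) (pt \<theta> p j + 1) * (pt \<theta> p j + 1 - l r - \<theta>) =
          efac \<theta> (l r) (p < r) (pt \<theta> p j) * (pt \<theta> p j - l r - 1)"
      proof (rule efac_step)
        show "p < r \<Longrightarrow> 0 < pt \<theta> p j - l r \<and> pt \<theta> p j - l r \<noteq> 1 \<and> 0 < pt \<theta> p j - l r + 1 - \<theta>"
          using posA[of p j] p j \<theta> by auto
        assume nl: "\<not> p < r"
        then have "j \<le> \<kappa> r" using gt[of p] p j \<kappa>'r \<kappa>'q[of p] by (cases "p = r") auto
        then show "0 < l r - pt \<theta> p j + 1 \<and> - 1 < l r - pt \<theta> p j - 1 + \<theta> \<and> l r - pt \<theta> p j - 1 + \<theta> \<noteq> 0"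
          using posB[OF nl, of j] posC[OF nl p, of "j + 1"] j e by auto
      qed
      have "T (j + 1) = (efac \<theta> (l r) (p < r) (pt \<theta> p j + 1) * (pt \<theta> p j + 1 - l r - \<theta>)) *
          (tau \<theta> \<kappa> Q p (j + 1) * (\<Prod>q\<in>Q. pt \<theta> p (j + 1) - l q - \<theta>))"
        by (simp add: T_def t_def B_r e)
      also have "\<dots> = u j" unfolding 1 2 by (simp add: u_def t_def pAr)
      finally show "u j = T (j + 1)" ..
    qed
    then have "(\<Sum>j\<in>J p. - (t p j * poly f (pt \<theta> p j))) = 0"
      by (simp add: J_def u_def T_def pf algebra_simps)
    then show ?thesis by (simp add: sum_negf)
  qed
  moreover have "pt \<theta> p i \<noteq> pt \<theta> q j"
    if pq: "p \<in> {1..n}" "q \<in> {1..n}" "q \<noteq> p" "i \<in> J p" "j \<in> J q" for p q i j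
  proof -
    have *: "pt \<theta> p i \<noteq> pt \<theta> q j"
      if "p < q" "p \<in> {1..n}" "q \<in> {1..n}" "i \<in> J p" "j \<in> J q" for p q i j
    \<comment> \<open>The extended ranges of \<open>r - 1\<close> and \<open>r\<close> overlap in
      two integers, so \<open>j = i + 1\<close> can occur; the points then differ by
      \<open>1 - \<theta>\<close>.\<close>
    proof (cases "Suc p = r \<and> q = r \<and> j = i + 1")
      case True
      then have q: "q = Suc p" "j = i + 1" by auto
      then show ?thesis using \<theta> by (simp add: pt_def algebra_simps)
    next
      case False
      have "\<kappa> q \<le> \<kappa> (Suc p)" using that by (intro monotone_onD[OF anti]) auto
      moreover have "q = r \<Longrightarrow> Suc p \<noteq> r \<Longrightarrow> \<kappa> r + 1 \<le> \<kappa> (Suc p)" using that by (intro lt) auto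
      ultimately have "j \<le> i" using that False \<kappa>'q[of q] \<kappa>'r by (cases "q = r") (auto simp: J_def)
      then show ?thesis using mono_\<theta>[OF that(1)] \<theta> by (auto simp: pt_def)
    qed
    show ?thesis using *[of p q i j] *[of q p j i] pq by (cases "p < q") force+
  qed
  ultimately have "poly f (l r + 1) * K_sum \<theta> n \<kappa>' = poly f (l r + \<theta>) * K_sum \<theta> n \<kappa>"
    unfolding ext1 ext2 by (rule sum_vand_one_point)
  moreover have "poly f (l r + 1) = (1 - \<theta>) * (\<Prod>q\<in>Q. l r + 1 - l q - \<theta>)"
    by (simp add: pf B_r)
  moreover have "poly f (l r + \<theta>) = (1 - \<theta>) * (\<Prod>q\<in>Q. l r + \<theta> - l q)"
    by (simp add: pf B_r pAr)
  ultimately have "(1 - \<theta>) * (K_sum \<theta> n \<kappa>' * (\<Prod>q\<in>Q. l r + 1 - l q - \<theta>)) =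
      (1 - \<theta>) * (K_sum \<theta> n \<kappa> * (\<Prod>q\<in>Q. l r + \<theta> - l q))"
    by (simp only: mult_ac)
  then show ?thesis using \<theta> by (simp add: Q_def \<kappa>'_def)
qed

section \<open>The total conditional weight up to a constant\<close>

lemma Lam_antimono: "\<kappa> \<in> Lam M n \<Longrightarrow> antimono_on {1..n} \<kappa>"
  by (auto simp: Lam_def intro!: monotone_onI)

lemma lat_diff_ge:
  assumes \<theta>: "\<theta> > 0" and anti: "antimono_on {1..n} \<kappa>" and p: "p \<in> {1..n}" "q \<in> {1..n}" "p < q"
  shows "lat \<theta> \<kappa> p - lat \<theta> \<kappa> q \<ge> of_int (\<kappa> p - \<kappa> q) + \<theta>" "\<kappa> q \<le> \<kappa> p"
proof -
  show "\<kappa> q \<le> \<kappa> p" using p by (intro monotone_onD[OF anti]) auto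
  have "(real p + 1) * \<theta> \<le> real q * \<theta>" using p \<theta> by (intro mult_right_mono) auto
  then show "lat \<theta> \<kappa> p - lat \<theta> \<kappa> q \<ge> of_int (\<kappa> p - \<kappa> q) + \<theta>" by (simp add: lat_def algebra_simps)
qed

text \<open>This is \<open>H_bot\<close> divided by \<open>C_top\<close>, hence the value expected
  of \<open>K_sum\<close> up to a constant.\<close>

definition rho :: "real \<Rightarrow> nat \<Rightarrow> (nat \<Rightarrow> real) \<Rightarrow> real" where
  "rho \<theta> n l = (\<Prod>q\<in>{1..n}. \<Prod>p\<in>{1..<q}. Gamma (l p - l q + \<theta>) / Gamma (l p - l q + 1 - \<theta>))"

lemma rho_pos:
  assumes \<theta>: "\<theta> > 0" and anti: "antimono_on {1..n} \<kappa>"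
  shows "rho \<theta> n (lat \<theta> \<kappa>) > 0"
  unfolding rho_def
proof (intro prod_pos divide_pos_pos Gamma_real_pos ballI)
  fix q p assume "q \<in> {1..n}" "p \<in> {1..<q}"
  then have "lat \<theta> \<kappa> p - lat \<theta> \<kappa> q \<ge> \<theta>"
    using lat_diff_ge[OF \<theta> anti, of p q] by force
  then show "lat \<theta> \<kappa> p - lat \<theta> \<kappa> q + \<theta> > 0" "lat \<theta> \<kappa> p - lat \<theta> \<kappa> q + 1 - \<theta> > 0"
    using \<theta> by simp_all
qed

text \<open>The recursion of \<open>K_sum_step\<close> again, obtained pair by pair from the Gamma
  recurrence. The second claim permits division by the common factor; its terms are nonzero because
  the vectors before and after adding the box are both weakly decreasing.\<close>

lemma rho_step:
  assumes \<theta>: "\<theta> > 0" and anti: "antimono_on {1..n} \<kappa>"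
    and r: "r \<in> {1..n}" and anti': "antimono_on {1..n} (\<kappa>(r := \<kappa> r + 1))"
  defines "l \<equiv> lat \<theta> \<kappa>"
  shows "rho \<theta> n (lat \<theta> (\<kappa>(r := \<kappa> r + 1))) * (\<Prod>q\<in>{1..n}-{r}. l r + 1 - l q - \<theta>) =
         rho \<theta> n l * (\<Prod>q\<in>{1..n}-{r}. l r + \<theta> - l q)"
    and "(\<Prod>q\<in>{1..n}-{r}. l r + 1 - l q - \<theta>) \<noteq> 0"
proof -
  define l' where "l' = lat \<theta> (\<kappa>(r := \<kappa> r + 1))"
  have l'r: "l' r = l r + 1" and l'q: "q \<noteq> r \<Longrightarrow> l' q = l q" for q
    by (simp_all add: l'_def l_def lat_def)
  have above: "l q - l r \<ge> 1 + \<theta>" if "q \<in> {1..n}" "q < r" for q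
    using lat_diff_ge[OF \<theta> anti' that(1) r that(2)] that l'q[of q] l'r unfolding l'_def[symmetric]
    by auto
  have below: "l r - l q \<ge> \<theta>" if "q \<in> {1..n}" "q > r" for q
    using lat_diff_ge[OF \<theta> anti r that(1,2)] unfolding l_def[symmetric] by auto
  have nz: "l r + 1 - l q - \<theta> \<noteq> 0" if "q \<in> {1..n} - {r}" for q
    using above[of q] below[of q] that \<theta> by (cases "q < r") auto
  then show "(\<Prod>q\<in>{1..n}-{r}. l r + 1 - l q - \<theta>) \<noteq> 0" by (simp add: prod_zero_iff)
  define F where "F = (\<lambda>(l :: nat \<Rightarrow> real) p q. Gamma (l p - l q + \<theta>) / Gamma (l p - l q + 1 - \<theta>))"
  define R where "R = (\<Prod>q\<in>{1..n}-{r}. \<Prod>p\<in>{1..<q}-{r}. F l p q)"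
  have R: "(\<Prod>q\<in>{1..n}-{r}. \<Prod>p\<in>{1..<q}-{r}. F l' p q) = R"
    unfolding R_def F_def by (intro prod.cong refl) (simp add: l'q)
  have 1: "(if q < r then F l' q r else F l' r q) * (l r + 1 - l q - \<theta>) =
      (if q < r then F l q r else F l r q) * (l r + \<theta> - l q)" if q: "q \<in> {1..n} - {r}" for q
  proof (cases "q < r")
    case True
    define e where "e = l q - l r - \<theta>"
    define v where "v = l q - l r - 1 + \<theta>"
    have "e > 0" "v > 0" using above[of q] q True \<theta> by (auto simp: e_def v_def)
    then have "Gamma (e + 1) = e * Gamma e" "Gamma (v + 1) = v * Gamma v" by (simp_all add: Gamma_real_plus1)
    moreover have "F l' q r = Gamma v / Gamma e" "F l q r = Gamma (v + 1) / Gamma (e + 1)"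
      "l r + 1 - l q - \<theta> = - v" "l r + \<theta> - l q = - e"
      using q l'q[of q] by (simp_all add: F_def l'r e_def v_def algebra_simps)
    ultimately show ?thesis using True \<open>e > 0\<close> \<open>v > 0\<close> by simp
  next
    case False
    define e where "e = l r - l q + 1 - \<theta>"
    define v where "v = l r - l q + \<theta>"
    have "e > 0" "v > 0" using below[of q] q False \<theta> by (auto simp: e_def v_def)
    then have "Gamma (e + 1) = e * Gamma e" "Gamma (v + 1) = v * Gamma v" by (simp_all add: Gamma_real_plus1)
    moreover have "F l' r q = Gamma (v + 1) / Gamma (e + 1)" "F l r q = Gamma v / Gamma e"
      "l r + 1 - l q - \<theta> = e" "l r + \<theta> - l q = v"
      using q l'q[of q] by (simp_all add: F_def l'r e_def v_def algebra_simps)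
    ultimately show ?thesis using False \<open>e > 0\<close> \<open>v > 0\<close> by simp
  qed
  have rhoF: "rho \<theta> n m = (\<Prod>q\<in>{1..n}. \<Prod>p\<in>{1..<q}. F m p q)" for m
    by (simp add: rho_def F_def)
  have "rho \<theta> n l' * (\<Prod>q\<in>{1..n}-{r}. l r + 1 - l q - \<theta>) =
     (\<Prod>q\<in>{1..n}-{r}. (if q < r then F l' q r else F l' r q) * (l r + 1 - l q - \<theta>)) * R"
    unfolding rhoF prod_pairs_split[OF r] R by (simp only: prod.distrib mult_ac)
  also have "\<dots> = (\<Prod>q\<in>{1..n}-{r}. (if q < r then F l q r else F l r q) * (l r + \<theta> - l q)) * R"
    using 1 by simp
  also have "\<dots> = rho \<theta> n l * (\<Prod>q\<in>{1..n}-{r}. l r + \<theta> - l q)"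
    unfolding rhoF prod_pairs_split[OF r] R_def by (simp only: prod.distrib mult_ac)
  finally show "rho \<theta> n (lat \<theta> (\<kappa>(r := \<kappa> r + 1))) * (\<Prod>q\<in>{1..n}-{r}. l r + 1 - l q - \<theta>) =
         rho \<theta> n l * (\<Prod>q\<in>{1..n}-{r}. l r + \<theta> - l q)" by (simp add: l'_def)
qed

text \<open>The last nonzero row works: all rows after it are empty, so shortening it keeps the
  order.\<close>

lemma Lam_remove_box:
  assumes \<kappa>: "\<kappa> \<in> Lam M n" and nz: "\<kappa> \<noteq> (\<lambda>i\<in>{1..n}. 0)"
  obtains r where "r \<in> {1..n}" "0 < \<kappa> r" "\<kappa>(r := \<kappa> r - 1) \<in> Lam M n"
proof -
  define S where "S = {p\<in>{1..n}. \<kappa> p > 0}"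
  have ext: "\<kappa> \<in> {1..n} \<rightarrow>\<^sub>E {0..int M}" using \<kappa> by (simp add: Lam_def)
  have "S \<noteq> {}"
  proof
    assume "S = {}"
    then have "\<kappa> i = 0" if "i \<in> {1..n}" for i using ext that by (force simp: S_def PiE_iff)
    then have "\<kappa> = (\<lambda>i\<in>{1..n}. 0)" using ext by (auto simp: PiE_iff extensional_def restrict_def)
    then show False using nz by simp
  qed
  moreover have "finite S" by (simp add: S_def)
  ultimately have r: "Max S \<in> S" and mx: "\<And>p. p \<in> S \<Longrightarrow> p \<le> Max S" by simp_all
  have anti: "\<And>i j. i \<in> {1..n} \<Longrightarrow> j \<in> {1..n} \<Longrightarrow> i \<le> j \<Longrightarrow> \<kappa> j \<le> \<kappa> i"
    using \<kappa> by (auto simp: Lam_def)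
  show thesis
  proof
    show "Max S \<in> {1..n}" "0 < \<kappa> (Max S)" using r by (auto simp: S_def)
    have after: "\<kappa> q \<le> \<kappa> (Max S) - 1" if "q \<in> {1..n}" "q > Max S" for q
    proof -
      have "q \<notin> S" using mx[of q] that by auto
      then have "\<kappa> q \<le> 0" using that by (auto simp: S_def)
      moreover have "\<kappa> (Max S) > 0" using r by (auto simp: S_def)
      ultimately show ?thesis by linarith
    qed
    show "\<kappa>(Max S := \<kappa> (Max S) - 1) \<in> Lam M n"
      unfolding Lam_def
    proof (intro CollectI conjI ballI impI)
      show "\<kappa>(Max S := \<kappa> (Max S) - 1) \<in> {1..n} \<rightarrow>\<^sub>E {0..int M}"
        using ext r by (force simp: PiE_iff S_def extensional_def)
      fix i j assume ij: "i \<in> {1..n}" "j \<in> {1..n}" "i \<le> j"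
      show "(\<kappa>(Max S := \<kappa> (Max S) - 1)) j \<le> (\<kappa>(Max S := \<kappa> (Max S) - 1)) i"
        using anti[OF ij] after[of j] ij by (cases "i = Max S"; cases "j = Max S") auto
    qed
  qed
qed

lemma vand_tau_pos:
  assumes \<theta>: "\<theta> > 0" and anti: "antimono_on {1..Suc n} \<kappa>"
    and \<mu>: "\<mu> \<in> PiE {1..n} (\<lambda>p. {\<kappa> (Suc p)..\<kappa> p})"
  shows "vand n (\<lambda>q. pt \<theta> q (\<mu> q)) * (\<Prod>q\<in>{1..n}. tau \<theta> \<kappa> {1..Suc n} q (\<mu> q)) > 0"
proof (intro mult_pos_pos)
  have mem: "p \<in> {1..n} \<Longrightarrow> \<mu> p \<in> {\<kappa> (Suc p)..\<kappa> p}" for p using \<mu> by (auto simp: PiE_iff)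
  show "vand n (\<lambda>q. pt \<theta> q (\<mu> q)) > 0"
    unfolding vand_def using pt_less[OF \<theta> anti _ _ _ mem mem] by (intro prod_pos) force
  show "(\<Prod>q\<in>{1..n}. tau \<theta> \<kappa> {1..Suc n} q (\<mu> q)) > 0"
    unfolding tau_def
  proof (intro prod_pos ballI)
    fix p q assume p: "p \<in> {1..n}" and q: "q \<in> {1..Suc n}"
    note * = lat_pt_pos[OF \<theta> anti p q, of "\<mu> p"]
    have "\<not> p < q \<Longrightarrow> \<kappa> p \<le> \<kappa> q" using p q by (intro monotone_onD[OF anti]) auto
    then have "\<not> p < q \<Longrightarrow> lat \<theta> \<kappa> q - pt \<theta> p (\<mu> p) \<ge> 0" using * mem[OF p] by force
    then show "hfac \<theta> (lat \<theta> \<kappa>) p q (pt \<theta> p (\<mu> p)) > 0"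
      unfolding hfac_def using * mem[OF p] \<theta> by (auto intro!: divide_pos_pos Gamma_real_pos)
  qed
qed

lemma K_sum_pos:
  assumes \<theta>: "\<theta> > 0" and anti: "antimono_on {1..Suc n} \<kappa>"
  shows "K_sum \<theta> n \<kappa> > 0"
  unfolding K_sum_def
proof (rule sum_pos)
  have "\<kappa> (Suc p) \<le> \<kappa> p" if "p \<in> {1..n}" for p using that by (intro monotone_onD[OF anti]) auto
  then show "PiE {1..n} (\<lambda>p. {\<kappa> (Suc p)..\<kappa> p}) \<noteq> {}" by (simp add: PiE_eq_empty_iff)
qed (auto intro!: finite_PiE vand_tau_pos[OF \<theta> anti, simplified])

text \<open>\<open>K_sum\<close> and \<open>rho\<close> are multiplied by the same factor when one
  box is added, and every element of \<open>Lam\<close> is reached from the zero vector by adding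
  boxes. Hence \<open>c\<close> is the quotient at zero.\<close>

lemma K_sum_eq:
  assumes \<theta>: "\<theta> > 0" "\<theta> \<noteq> 1"
  obtains c where "c > 0" "\<And>\<kappa>. \<kappa> \<in> Lam M (Suc n) \<Longrightarrow> K_sum \<theta> n \<kappa> = c * rho \<theta> (Suc n) (lat \<theta> \<kappa>)"
proof
  define \<kappa>0 where "\<kappa>0 = (\<lambda>i\<in>{1..Suc n}. 0::int)"
  have \<kappa>0: "\<kappa>0 \<in> Lam M (Suc n)" by (auto simp: Lam_def \<kappa>0_def)
  define c where "c = K_sum \<theta> n \<kappa>0 / rho \<theta> (Suc n) (lat \<theta> \<kappa>0)"
  show "c > 0" unfolding c_def
    using \<kappa>0 \<theta>(1) by (intro divide_pos_pos K_sum_pos rho_pos Lam_antimono)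
  show "K_sum \<theta> n \<kappa> = c * rho \<theta> (Suc n) (lat \<theta> \<kappa>)" if "\<kappa> \<in> Lam M (Suc n)" for \<kappa>
    using that
  proof (induction "nat (\<Sum>i\<in>{1..Suc n}. \<kappa> i)" arbitrary: \<kappa> rule: less_induct)
    case less
    show ?case
    proof (cases "\<kappa> = \<kappa>0")
      case True
      then show ?thesis using rho_pos[OF \<theta>(1) Lam_antimono[OF \<kappa>0]] by (simp add: c_def)
    next
      case False
      then obtain r where r: "r \<in> {1..Suc n}" "0 < \<kappa> r" and \<kappa>': "\<kappa>(r := \<kappa> r - 1) \<in> Lam M (Suc n)"
        using Lam_remove_box[OF less.prems] by (auto simp: \<kappa>0_def)
      define \<kappa>' where "\<kappa>' = \<kappa>(r := \<kappa> r - 1)"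
      have \<kappa>: "\<kappa> = \<kappa>'(r := \<kappa>' r + 1)" by (simp add: \<kappa>'_def)
      have nn: "\<kappa>' i \<ge> 0" if "i \<in> {1..Suc n}" for i
        using \<kappa>' that unfolding \<kappa>'_def[symmetric] by (auto simp: Lam_def PiE_iff)
      have "(\<Sum>i\<in>{1..Suc n}. \<kappa>' i) < (\<Sum>i\<in>{1..Suc n}. \<kappa> i)"
        using r by (intro sum_strict_mono_ex1) (auto simp: \<kappa>'_def)
      moreover have "(\<Sum>i\<in>{1..Suc n}. \<kappa>' i) \<ge> 0" by (intro sum_nonneg nn)
      ultimately have "nat (\<Sum>i\<in>{1..Suc n}. \<kappa>' i) < nat (\<Sum>i\<in>{1..Suc n}. \<kappa> i)"
        by (simp only: nat_less_eq_zless)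
      then have IH: "K_sum \<theta> n \<kappa>' = c * rho \<theta> (Suc n) (lat \<theta> \<kappa>')"
        using less.hyps \<kappa>' by (simp add: \<kappa>'_def)
      have a: "antimono_on {1..Suc n} \<kappa>'" "antimono_on {1..Suc n} (\<kappa>'(r := \<kappa>' r + 1))"
        using Lam_antimono[OF \<kappa>'] Lam_antimono[OF less.prems] unfolding \<kappa>'_def[symmetric] \<kappa>[symmetric] .
      define x where "x = (\<Prod>q\<in>{1..Suc n}-{r}. lat \<theta> \<kappa>' r + 1 - lat \<theta> \<kappa>' q - \<theta>)"
      have "K_sum \<theta> n \<kappa> * x = c * rho \<theta> (Suc n) (lat \<theta> \<kappa>) * x"
        using K_sum_step[OF \<theta> a(1) r(1) a(2)] rho_step(1)[OF \<theta>(1) a(1) r(1) a(2)]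
        unfolding \<kappa>[symmetric] x_def[symmetric] IH by (simp add: mult_ac)
      moreover have "x \<noteq> 0" unfolding x_def by (rule rho_step(2)[OF \<theta>(1) a(1) r(1) a(2)])
      ultimately show ?thesis by simp
    qed
  qed
qed

section \<open>Conditional sums over interlacing vectors\<close>

lemma WW_eq: "WW \<theta> M n = (\<lambda>\<kappa>. \<lambda>i\<in>{1..n}. lat \<theta> \<kappa> i) ` Lam M n"
  by (simp add: WW_def lat_def)

definition inter :: "real \<Rightarrow> nat \<Rightarrow> nat \<Rightarrow> (nat \<Rightarrow> real) \<Rightarrow> (nat \<Rightarrow> real) set" where
  "inter \<theta> M n l = {m \<in> WW \<theta> M n. interlaces \<theta> (n + 1) l m}"

text \<open>Order and bounds of the lower vector follow from interlacing, so its integer parts range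
  over a full product of intervals; this is what permits summing one coordinate at a time.\<close>

lemma inter_eq:
  assumes \<kappa>: "\<kappa> \<in> Lam M (Suc n)" and l: "l = (\<lambda>i\<in>{1..Suc n}. lat \<theta> \<kappa> i)"
  shows "inter \<theta> M n l =
    (\<lambda>\<mu>. \<lambda>i\<in>{1..n}. pt \<theta> i (\<mu> i)) ` PiE {1..n} (\<lambda>p. {\<kappa> (Suc p)..\<kappa> p})" (is "_ = ?f ` ?P")
proof -
  have anti: "antimono_on {1..Suc n} \<kappa>" by (rule Lam_antimono[OF \<kappa>])
  have intl: "interlaces \<theta> (n + 1) l (\<lambda>i\<in>{1..n}. pt \<theta> i (\<mu> i)) \<longleftrightarrow> (\<forall>p\<in>{1..n}. \<mu> p \<in> {\<kappa> (Suc p)..\<kappa> p})" for \<mu>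
  proof -
    have "l i + real i * \<theta> \<ge> (\<lambda>i\<in>{1..n}. pt \<theta> i (\<mu> i)) i + real i * \<theta> \<and>
          (\<lambda>i\<in>{1..n}. pt \<theta> i (\<mu> i)) i + real i * \<theta> \<ge> l (i + 1) + real (i + 1) * \<theta> \<longleftrightarrow>
          \<mu> i \<in> {\<kappa> (Suc i)..\<kappa> i}" if "i \<in> {1..n}" for i
      using that by (auto simp: l lat_def pt_def)
    moreover have "{1..<n+1} = {1..n}" by auto
    ultimately show ?thesis unfolding interlaces_def by simp
  qed
  have inL: "\<mu> \<in> Lam M n" if \<mu>: "\<mu> \<in> ?P" for \<mu>
  proof -
    have mem: "\<kappa> (Suc p) \<le> \<mu> p \<and> \<mu> p \<le> \<kappa> p" if "p \<in> {1..n}" for p using \<mu> that by (auto simp: PiE_iff)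
    have bd: "0 \<le> \<kappa> p \<and> \<kappa> p \<le> int M" if "p \<in> {1..Suc n}" for p using \<kappa> that by (auto simp: Lam_def PiE_iff)
    have "\<mu> j \<le> \<mu> i" if "i \<in> {1..n}" "j \<in> {1..n}" "i \<le> j" for i j
    proof (cases "i = j")
      case False
      then have "\<kappa> j \<le> \<kappa> (Suc i)" using that by (intro monotone_onD[OF anti]) auto
      then show ?thesis using mem[OF that(1)] mem[OF that(2)] by linarith
    qed simp
    moreover have "\<mu> p \<in> {0..int M}" if "p \<in> {1..n}" for p
      using mem[OF that] bd[of p] bd[of "Suc p"] that by auto
    ultimately show ?thesis using \<mu> by (auto simp: Lam_def PiE_iff)
  qed
  show ?thesis
  proof (intro equalityI subsetI)
    fix m assume "m \<in> inter \<theta> M n l"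
    then obtain \<mu> where \<mu>: "\<mu> \<in> Lam M n" "m = ?f \<mu>" and i: "interlaces \<theta> (n + 1) l m"
      by (auto simp: inter_def WW_eq lat_def pt_def)
    then have "\<mu> \<in> ?P" using intl by (auto simp: Lam_def PiE_iff)
    then show "m \<in> ?f ` ?P" using \<mu> by blast
  next
    fix m assume "m \<in> ?f ` ?P"
    then obtain \<mu> where \<mu>: "\<mu> \<in> ?P" "m = ?f \<mu>" by blast
    then have "interlaces \<theta> (n + 1) l m" using intl by (auto simp: PiE_iff)
    moreover have "m \<in> WW \<theta> M n" unfolding WW_eq using inL[OF \<mu>(1)] \<mu>(2)
      by (intro image_eqI[of _ _ \<mu>]) (auto simp: lat_def pt_def restrict_def fun_eq_iff)
    ultimately show "m \<in> inter \<theta> M n l" by (simp add: inter_def)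
  qed
qed

lemma sum_inter:
  assumes "\<kappa> \<in> Lam M (Suc n)" and "l = (\<lambda>i\<in>{1..Suc n}. lat \<theta> \<kappa> i)"
  shows "(\<Sum>m\<in>inter \<theta> M n l. F m) =
    (\<Sum>\<mu>\<in>PiE {1..n} (\<lambda>p. {\<kappa> (Suc p)..\<kappa> p}). F (\<lambda>i\<in>{1..n}. pt \<theta> i (\<mu> i)))"
proof -
  have "inj_on (\<lambda>\<mu>. \<lambda>i\<in>{1..n}. pt \<theta> i (\<mu> i)) (PiE {1..n} (\<lambda>p. {\<kappa> (Suc p)..\<kappa> p}))"
  proof (rule inj_onI)
    fix \<mu> \<nu> assume \<mu>\<nu>: "\<mu> \<in> PiE {1..n} (\<lambda>p. {\<kappa> (Suc p)..\<kappa> p})" "\<nu> \<in> PiE {1..n} (\<lambda>p. {\<kappa> (Suc p)..\<kappa> p})"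
      and eq: "(\<lambda>i\<in>{1..n}. pt \<theta> i (\<mu> i)) = (\<lambda>i\<in>{1..n}. pt \<theta> i (\<nu> i))"
    show "\<mu> = \<nu>"
    proof (rule PiE_ext[OF \<mu>\<nu>])
      fix i assume "i \<in> {1..n}"
      then show "\<mu> i = \<nu> i" using fun_cong[OF eq, of i] by (simp add: pt_def)
    qed
  qed
  then show ?thesis unfolding inter_eq[OF assms] by (simp add: sum.reindex)
qed

text \<open>The first product of \<open>I_weight\<close>, the only one that does not contain the
  lower vector.\<close>

definition C_top :: "real \<Rightarrow> nat \<Rightarrow> (nat \<Rightarrow> real) \<Rightarrow> real" where
  "C_top \<theta> n l = (\<Prod>q\<in>{1..n}. \<Prod>p\<in>{1..<q}. Gamma (l p - l q + 1 - \<theta>) / Gamma (l p - l q))"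

lemma WW_diff_ge:
  assumes \<theta>: "\<theta> > 0" and l: "l \<in> WW \<theta> M n" and p: "p \<in> {1..n}" "q \<in> {1..n}" "p < q"
  shows "l p - l q \<ge> \<theta>"
proof -
  obtain \<kappa> where \<kappa>: "\<kappa> \<in> Lam M n" "l = (\<lambda>i\<in>{1..n}. lat \<theta> \<kappa> i)" using l by (auto simp: WW_eq)
  have "lat \<theta> \<kappa> p - lat \<theta> \<kappa> q \<ge> \<theta>" using lat_diff_ge[OF \<theta> Lam_antimono[OF \<kappa>(1)] p] by force
  then show ?thesis using p by (simp add: \<kappa>)
qed

lemma C_top_pos:
  assumes \<theta>: "\<theta> > 0" and l: "l \<in> WW \<theta> M n"
  shows "C_top \<theta> n l > 0"
  unfolding C_top_def
proof (intro prod_pos divide_pos_pos Gamma_real_pos ballI)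
  fix q p assume "q \<in> {1..n}" "p \<in> {1..<q}"
  then have "l p - l q \<ge> \<theta>" by (intro WW_diff_ge[OF \<theta> l]) auto
  then show "l p - l q + 1 - \<theta> > 0" "l p - l q > 0" using \<theta> by simp_all
qed

lemma H_bot_pos:
  assumes \<theta>: "\<theta> > 0" and l: "l \<in> WW \<theta> M n"
  shows "H_bot \<theta> n l > 0"
  unfolding H_bot_def
proof (intro prod_pos divide_pos_pos Gamma_real_pos ballI)
  fix q p assume "q \<in> {1..n}" "p \<in> {1..<q}"
  then have "l p - l q \<ge> \<theta>" by (intro WW_diff_ge[OF \<theta> l]) auto
  then show "l p - l q + \<theta> > 0" "l p - l q > 0" using \<theta> by simp_all
qed

lemma H_bot_eq:
  assumes \<theta>: "\<theta> > 0" and \<kappa>: "\<kappa> \<in> Lam M n" and l: "l = (\<lambda>i\<in>{1..n}. lat \<theta> \<kappa> i)"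
  shows "H_bot \<theta> n l = C_top \<theta> n l * rho \<theta> n (lat \<theta> \<kappa>)"
proof -
  have lW: "l \<in> WW \<theta> M n" unfolding WW_eq l by (rule imageI[OF \<kappa>])
  have "rho \<theta> n (lat \<theta> \<kappa>) = rho \<theta> n l"
    unfolding rho_def l by (intro prod.cong refl) auto
  moreover have "H_bot \<theta> n l = C_top \<theta> n l * rho \<theta> n l"
    unfolding H_bot_def C_top_def rho_def prod.distrib[symmetric]
  proof (intro prod.cong refl)
    fix q p assume "q \<in> {1..n}" "p \<in> {1..<q}"
    then have "l p - l q \<ge> \<theta>" by (intro WW_diff_ge[OF \<theta> lW]) auto
    then have "Gamma (l p - l q + 1 - \<theta>) > 0" by (intro Gamma_real_pos) simp
    then show "Gamma (l p - l q + \<theta>) / Gamma (l p - l q) =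
       Gamma (l p - l q + 1 - \<theta>) / Gamma (l p - l q) * (Gamma (l p - l q + \<theta>) / Gamma (l p - l q + 1 - \<theta>))"
      by simp
  qed
  ultimately show ?thesis by simp
qed

text \<open>\<open>H_bot\<close> cancels the Gamma functions in the second product of
  \<open>I_weight\<close> and leaves \<open>m p - m q\<close>, by
  \<open>Gamma (x + 1) = x * Gamma x\<close>. The third and fourth products, regrouped by the
  coordinate of \<open>m\<close>, form the factors \<open>tau\<close>.\<close>

lemma I_weight_H_bot:
  assumes \<theta>: "\<theta> > 0" and \<kappa>: "\<kappa> \<in> Lam M (Suc n)" and l: "l = (\<lambda>i\<in>{1..Suc n}. lat \<theta> \<kappa> i)"
    and \<mu>: "\<mu> \<in> PiE {1..n} (\<lambda>p. {\<kappa> (Suc p)..\<kappa> p})" and m: "m = (\<lambda>i\<in>{1..n}. pt \<theta> i (\<mu> i))"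
  shows "I_weight \<theta> n l m * H_bot \<theta> n m = C_top \<theta> (Suc n) l *
     (vand n (\<lambda>q. pt \<theta> q (\<mu> q)) * (\<Prod>q\<in>{1..n}. tau \<theta> \<kappa> {1..Suc n} q (\<mu> q)))"
proof -
  have mW: "m \<in> WW \<theta> M n" using inter_eq[OF \<kappa> l] \<mu> m by (auto simp: inter_def)
  define P2 where "P2 = (\<Prod>q\<in>{1..n}. \<Prod>p\<in>{1..<q}. Gamma (m p - m q + 1) / Gamma (m p - m q + \<theta>))"
  define P3 where "P3 = (\<Prod>q\<in>{1..Suc n}. \<Prod>p\<in>{1..<q}. Gamma (m p - l q) / Gamma (m p - l q + 1 - \<theta>))"
  define P4 where "P4 = (\<Prod>q\<in>{1..n}. \<Prod>p\<in>{1..q}. Gamma (l p - m q + \<theta>) / Gamma (l p - m q + 1))"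
  have I: "I_weight \<theta> n l m = C_top \<theta> (Suc n) l * P2 * P3 * P4"
    unfolding I_weight_def C_top_def P2_def P3_def P4_def Suc_eq_plus1 ..
  have "P2 * H_bot \<theta> n m = vand n m"
    unfolding P2_def H_bot_def vand_def prod.distrib[symmetric]
  proof (intro prod.cong refl)
    fix q p assume "q \<in> {1..n}" "p \<in> {1..<q}"
    then have "m p - m q \<ge> \<theta>" by (intro WW_diff_ge[OF \<theta> mW]) auto
    then have "m p - m q > 0" "Gamma (m p - m q + \<theta>) > 0" "Gamma (m p - m q) > 0"
      using \<theta> by (auto intro!: Gamma_real_pos)
    then have "m p - m q > 0" "Gamma (m p - m q + \<theta>) \<noteq> 0" "Gamma (m p - m q) \<noteq> 0"
      by linarith+
    then show "Gamma (m p - m q + 1) / Gamma (m p - m q + \<theta>) * (Gamma (m p - m q + \<theta>) / Gamma (m p - m q)) = m p - m q"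
      by (simp add: Gamma_real_plus1)
  qed
  also have "vand n m = vand n (\<lambda>q. pt \<theta> q (\<mu> q))"
    unfolding vand_def m by (intro prod.cong refl) auto
  finally have V: "P2 * H_bot \<theta> n m = vand n (\<lambda>q. pt \<theta> q (\<mu> q))" .
  have "P3 = (\<Prod>q\<in>{1..Suc n}. \<Prod>p\<in>{p\<in>{1..n}. p < q}. Gamma (m p - l q) / Gamma (m p - l q + 1 - \<theta>))"
    unfolding P3_def by (intro prod.cong refl) auto
  also have "\<dots> = (\<Prod>p\<in>{1..n}. \<Prod>q\<in>{q\<in>{1..Suc n}. p < q}. Gamma (m p - l q) / Gamma (m p - l q + 1 - \<theta>))"
    by (rule prod.swap_restrict) auto
  finally have P3: "P3 = (\<Prod>p\<in>{1..n}. \<Prod>q\<in>{q\<in>{1..Suc n}. p < q}. Gamma (m p - l q) / Gamma (m p - l q + 1 - \<theta>))" .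
  have P34: "P3 * P4 = (\<Prod>q\<in>{1..n}. tau \<theta> \<kappa> {1..Suc n} q (\<mu> q))"
    unfolding P3 P4_def prod.distrib[symmetric]
  proof (rule prod.cong[OF refl])
    fix p assume p: "p \<in> {1..n}"
    have "tau \<theta> \<kappa> {1..Suc n} p (\<mu> p) = (\<Prod>q\<in>{q\<in>{1..Suc n}. p < q} \<union> {1..p}. hfac \<theta> (lat \<theta> \<kappa>) p q (pt \<theta> p (\<mu> p)))"
      unfolding tau_def using p by (intro prod.cong refl) auto
    also have "\<dots> = (\<Prod>q\<in>{q\<in>{1..Suc n}. p < q}. hfac \<theta> (lat \<theta> \<kappa>) p q (pt \<theta> p (\<mu> p))) *
       (\<Prod>q\<in>{1..p}. hfac \<theta> (lat \<theta> \<kappa>) p q (pt \<theta> p (\<mu> p)))"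
      by (rule prod.union_disjoint) auto
    also have "(\<Prod>q\<in>{q\<in>{1..Suc n}. p < q}. hfac \<theta> (lat \<theta> \<kappa>) p q (pt \<theta> p (\<mu> p))) =
        (\<Prod>q\<in>{q\<in>{1..Suc n}. p < q}. Gamma (m p - l q) / Gamma (m p - l q + 1 - \<theta>))"
      using p by (intro prod.cong refl) (simp add: hfac_def m l)
    also have "(\<Prod>q\<in>{1..p}. hfac \<theta> (lat \<theta> \<kappa>) p q (pt \<theta> p (\<mu> p))) =
        (\<Prod>q\<in>{1..p}. Gamma (l q - m p + \<theta>) / Gamma (l q - m p + 1))"
      using p by (intro prod.cong refl) (simp add: hfac_def m l)
    finally show "(\<Prod>q\<in>{q\<in>{1..Suc n}. p < q}. Gamma (m p - l q) / Gamma (m p - l q + 1 - \<theta>)) *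
        (\<Prod>q\<in>{1..p}. Gamma (l q - m p + \<theta>) / Gamma (l q - m p + 1)) = tau \<theta> \<kappa> {1..Suc n} p (\<mu> p)" ..
  qed
  show ?thesis unfolding I V[symmetric] P34[symmetric] by (simp only: mult_ac)
qed

lemma I_weight_pos:
  assumes \<theta>: "\<theta> > 0" and l: "l \<in> WW \<theta> M (Suc n)" and m: "m \<in> inter \<theta> M n l"
  shows "I_weight \<theta> n l m > 0"
proof -
  obtain \<kappa> where \<kappa>: "\<kappa> \<in> Lam M (Suc n)" "l = (\<lambda>i\<in>{1..Suc n}. lat \<theta> \<kappa> i)" using l by (auto simp: WW_eq)
  obtain \<mu> where \<mu>: "\<mu> \<in> PiE {1..n} (\<lambda>p. {\<kappa> (Suc p)..\<kappa> p})" "m = (\<lambda>i\<in>{1..n}. pt \<theta> i (\<mu> i))"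
    using m inter_eq[OF \<kappa>] by blast
  have "I_weight \<theta> n l m * H_bot \<theta> n m > 0"
    unfolding I_weight_H_bot[OF \<theta> \<kappa> \<mu>]
    by (intro mult_pos_pos[OF C_top_pos[OF \<theta> l]] vand_tau_pos[OF \<theta> Lam_antimono[OF \<kappa>(1)] \<mu>(1)])
  moreover have "H_bot \<theta> n m > 0" using m by (intro H_bot_pos[OF \<theta>]) (auto simp: inter_def)
  ultimately show ?thesis by (simp add: zero_less_mult_iff)
qed

lemma finite_WW: "finite (WW \<theta> M n)"
  unfolding WW_eq Lam_def by (intro finite_imageI finite_subset[OF _ finite_PiE[of "{1..n}" "\<lambda>_. {0..int M}"]]) auto

lemma inter_nonempty:
  assumes l: "l \<in> WW \<theta> M (Suc n)"
  shows "inter \<theta> M n l \<noteq> {}"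
proof -
  obtain \<kappa> where \<kappa>: "\<kappa> \<in> Lam M (Suc n)" "l = (\<lambda>i\<in>{1..Suc n}. lat \<theta> \<kappa> i)" using l by (auto simp: WW_eq)
  have "\<kappa> (Suc p) \<le> \<kappa> p" if "p \<in> {1..n}" for p
    using that by (intro monotone_onD[OF Lam_antimono[OF \<kappa>(1)]]) auto
  then show ?thesis unfolding inter_eq[OF \<kappa>] by (simp add: PiE_eq_empty_iff)
qed

text \<open>The bottom factor reproduces itself: summing out level \<open>n\<close> leaves
  \<open>H_bot\<close> of level \<open>n + 1\<close>, so the marginal law on the upper levels is of
  the same type with \<open>k\<close> raised by one.\<close>

lemma sum_inter_weight:
  assumes \<theta>: "\<theta> > 0" "\<theta> \<noteq> 1"
  obtains c where "c > 0" "\<And>l. l \<in> WW \<theta> M (Suc n) \<Longrightarrow>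
     (\<Sum>m\<in>inter \<theta> M n l. I_weight \<theta> n l m * H_bot \<theta> n m) = c * H_bot \<theta> (Suc n) l"
proof -
  obtain c where c: "c > 0" "\<And>\<kappa>. \<kappa> \<in> Lam M (Suc n) \<Longrightarrow> K_sum \<theta> n \<kappa> = c * rho \<theta> (Suc n) (lat \<theta> \<kappa>)"
    using K_sum_eq[OF \<theta>, where M = M and n = n] by blast
  have "(\<Sum>m\<in>inter \<theta> M n l. I_weight \<theta> n l m * H_bot \<theta> n m) = c * H_bot \<theta> (Suc n) l"
    if l: "l \<in> WW \<theta> M (Suc n)" for l
  proof -
    obtain \<kappa> where \<kappa>: "\<kappa> \<in> Lam M (Suc n)" "l = (\<lambda>i\<in>{1..Suc n}. lat \<theta> \<kappa> i)" using l by (auto simp: WW_eq)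
    have "(\<Sum>m\<in>inter \<theta> M n l. I_weight \<theta> n l m * H_bot \<theta> n m) = C_top \<theta> (Suc n) l * K_sum \<theta> n \<kappa>"
      unfolding sum_inter[OF \<kappa>] K_sum_def sum_distrib_left
      by (intro sum.cong refl I_weight_H_bot[OF \<theta>(1) \<kappa>])
    then show ?thesis by (simp add: c(2)[OF \<kappa>(1)] H_bot_eq[OF \<theta>(1) \<kappa>])
  qed
  with c(1) show thesis using that by blast
qed

lemma sum_inter_two_point:
  fixes y z :: complex
  assumes \<theta>: "\<theta> > 0" and l: "l \<in> WW \<theta> M (Suc n)"
    and z: "\<And>m p. m \<in> inter \<theta> M n l \<Longrightarrow> p \<in> {1..n} \<Longrightarrow> z \<noteq> of_real (m p) \<and> z - 1 \<noteq> of_real (m p)"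
  shows "(\<Sum>m\<in>inter \<theta> M n l. of_real (I_weight \<theta> n l m * H_bot \<theta> n m) *
       ((1 + y - z) * (\<Prod>q\<in>{1..Suc n}. z - of_real (l q) - of_real \<theta>) *
          (\<Prod>p\<in>{1..n}. (y - of_real (m p)) / (z - of_real (m p)))
        - (y - z) * (\<Prod>q\<in>{1..Suc n}. z - 1 - of_real (l q)) *
          (\<Prod>p\<in>{1..n}. (y - of_real (m p)) / (z - 1 - of_real (m p))))) =
     (\<Sum>m\<in>inter \<theta> M n l. of_real (I_weight \<theta> n l m * H_bot \<theta> n m) *
       ((1 + y - z) * (\<Prod>q\<in>{1..Suc n}. y - of_real (l q) - of_real \<theta>)
        - (y - z) * (\<Prod>q\<in>{1..Suc n}. y - of_real (l q))))"
proof -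
  obtain \<kappa> where \<kappa>: "\<kappa> \<in> Lam M (Suc n)" "l = (\<lambda>i\<in>{1..Suc n}. lat \<theta> \<kappa> i)" using l by (auto simp: WW_eq)
  have anti: "antimono_on {1..Suc n} \<kappa>" by (rule Lam_antimono[OF \<kappa>(1)])
  have zpt: "z \<noteq> of_real (pt \<theta> p i) \<and> z - 1 \<noteq> of_real (pt \<theta> p i)"
    if p: "p \<in> {1..n}" and i: "i \<in> {\<kappa> (Suc p)..\<kappa> p}" for p i
  proof -
    \<comment> \<open>A point of one coordinate range is completed to an interlacing vector by
      taking the upper end of the range at every other coordinate.\<close>
    define \<mu> where "\<mu> = (\<lambda>q\<in>{1..n}. if q = p then i else \<kappa> q)"
    have "\<kappa> (Suc q) \<le> \<kappa> q" if "q \<in> {1..n}" for q using that by (intro monotone_onD[OF anti]) auto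
    then have "\<mu> \<in> PiE {1..n} (\<lambda>p. {\<kappa> (Suc p)..\<kappa> p})"
      using i by (auto simp: \<mu>_def)
    then have "(\<lambda>j\<in>{1..n}. pt \<theta> j (\<mu> j)) \<in> inter \<theta> M n l" unfolding inter_eq[OF \<kappa>] by blast
    from z[OF this p] show ?thesis using p by (simp add: \<mu>_def)
  qed
  have lp: "(\<Prod>q\<in>{1..Suc n}. F (l q)) = (\<Prod>q\<in>{1..Suc n}. F (lat \<theta> \<kappa> q))" for F :: "real \<Rightarrow> complex"
    by (intro prod.cong refl) (simp add: \<kappa>)
  have mp: "(\<Prod>p\<in>{1..n}. F ((\<lambda>i\<in>{1..n}. pt \<theta> i (\<mu> i)) p)) = (\<Prod>p\<in>{1..n}. F (pt \<theta> p (\<mu> p)))" for F :: "real \<Rightarrow> complex" and \<mu>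
    by (intro prod.cong refl) simp
  note key = sum_interlacing_two_point[OF \<theta> anti zpt, of y]
  have W: "of_real (I_weight \<theta> n l (\<lambda>i\<in>{1..n}. pt \<theta> i (\<mu> i)) * H_bot \<theta> n (\<lambda>i\<in>{1..n}. pt \<theta> i (\<mu> i))) =
      complex_of_real (C_top \<theta> (Suc n) l) * of_real (vand n (\<lambda>q. pt \<theta> q (\<mu> q)) * (\<Prod>q\<in>{1..n}. tau \<theta> \<kappa> {1..Suc n} q (\<mu> q)))"
    if "\<mu> \<in> PiE {1..n} (\<lambda>p. {\<kappa> (Suc p)..\<kappa> p})" for \<mu>
    unfolding I_weight_H_bot[OF \<theta> \<kappa> that refl] by (rule of_real_mult)
  show ?thesis
    unfolding sum_inter[OF \<kappa>]
    using arg_cong[OF key, of "\<lambda>u. of_real (C_top \<theta> (Suc n) l) * u"]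
    by (simp only: W lp[of "\<lambda>x. z - of_real x - of_real \<theta>"] lp[of "\<lambda>x. z - 1 - of_real x"]
          lp[of "\<lambda>x. y - of_real x - of_real \<theta>"] lp[of "\<lambda>x. y - of_real x"]
          mp[of "\<lambda>x. (y - of_real x) / (z - of_real x)"] mp[of "\<lambda>x. (y - of_real x) / (z - 1 - of_real x)"]
          sum_distrib_left mult.assoc cong: sum.cong)
qed

section \<open>Integrating out the bottom level\<close>

lemma finite_XX: "finite (XX \<theta> M N k)"
  unfolding XX_def
  by (rule finite_subset[OF _ finite_PiE[of "{k..N}" "WW \<theta> M"]]) (auto simp: finite_WW)

lemma XX_level: "L \<in> XX \<theta> M N k \<Longrightarrow> j \<in> {k..N} \<Longrightarrow> L j \<in> WW \<theta> M j"
  by (auto simp: XX_def PiE_iff)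

lemma XX_inter: "L \<in> XX \<theta> M N k \<Longrightarrow> j \<in> {k..<N} \<Longrightarrow> L j \<in> inter \<theta> M j (L (Suc j))"
  by (auto simp: XX_def inter_def PiE_iff)

lemma XX_extend:
  assumes k: "k < N" and L: "L \<in> XX \<theta> M N (Suc k)" and m: "m \<in> inter \<theta> M k (L (Suc k))"
  shows "L(k := m) \<in> XX \<theta> M N k"
proof -
  have "{k..N} = insert k {Suc k..N}" "{k..<N} = insert k {Suc k..<N}" using k by auto
  then show ?thesis using L m by (auto simp: XX_def inter_def PiE_iff extensional_def)
qed

text \<open>\<open>undefined\<close> is the prescribed value outside the index set of an extensional
  tuple, so this assignment deletes the bottom level.\<close>

lemma XX_restrict:
  assumes k: "k < N" and L: "L \<in> XX \<theta> M N k"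
  shows "L(k := undefined) \<in> XX \<theta> M N (Suc k)"
  using L k by (auto simp: XX_def PiE_iff extensional_def)

lemma sum_XX:
  assumes k: "k < N"
  shows "(\<Sum>L\<in>XX \<theta> M N k. F L) =
    (\<Sum>L\<in>XX \<theta> M N (Suc k). \<Sum>m\<in>inter \<theta> M k (L (Suc k)). F (L(k := m)))"
proof -
  have fin: "finite (inter \<theta> M k l)" for l by (simp add: inter_def finite_WW)
  have "(\<Sum>L\<in>XX \<theta> M N (Suc k). \<Sum>m\<in>inter \<theta> M k (L (Suc k)). F (L(k := m))) =
      (\<Sum>(L, m)\<in>Sigma (XX \<theta> M N (Suc k)) (\<lambda>L. inter \<theta> M k (L (Suc k))). F (L(k := m)))"
    by (rule sum.Sigma) (simp_all add: finite_XX fin)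
  also have "\<dots> = (\<Sum>L\<in>XX \<theta> M N k. F L)"
  proof (rule sum.reindex_bij_witness[of _ "\<lambda>L. (L(k := undefined), L k)" "\<lambda>(L, m). L(k := m)"], goal_cases)
    case (1 u)
    then have "fst u k = undefined" by (auto simp: XX_def PiE_iff extensional_def)
    then show ?case by (auto simp: fun_eq_iff split: prod.splits)
  next
    case (2 u)
    then show ?case using XX_extend[OF k] by auto
  next
    case (3 L)
    then show ?case by auto
  next
    case (4 L)
    then show ?case using XX_restrict[OF k] XX_inter[of L \<theta> M N k k] k by auto
  next
    case (5 u)
    then show ?case by auto
  qed
  finally show ?thesis ..
qed

text \<open>The part of the weight that stays fixed while the level directly below \<open>k\<close>
  is summed out.\<close>

definition base_weight :: "real \<Rightarrow> (real \<Rightarrow> real) \<Rightarrow> nat \<Rightarrow> nat \<Rightarrow> (nat \<Rightarrow> nat \<Rightarrow> real) \<Rightarrow> real" where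
  "base_weight \<theta> w N k L = H_top \<theta> w N (L N) * (\<Prod>j\<in>{k..<N}. I_weight \<theta> j (L (j + 1)) (L j))"

lemma weight_eq: "weight \<theta> w N k L = base_weight \<theta> w N k L * H_bot \<theta> k (L k)"
  by (simp add: weight_def base_weight_def mult_ac)

lemma weight_extend:
  assumes k: "k < N"
  shows "weight \<theta> w N k (L(k := m)) = base_weight \<theta> w N (Suc k) L * (I_weight \<theta> k (L (Suc k)) m * H_bot \<theta> k m)"
proof -
  have "{k..<N} = insert k {Suc k..<N}" using k by auto
  moreover have "(\<Prod>j\<in>{Suc k..<N}. I_weight \<theta> j ((L(k := m)) (j + 1)) ((L(k := m)) j)) =
      (\<Prod>j\<in>{Suc k..<N}. I_weight \<theta> j (L (j + 1)) (L j))"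
    by (intro prod.cong refl) auto
  ultimately show ?thesis using k by (simp add: weight_def base_weight_def)
qed

lemma weight_pos:
  assumes \<theta>: "\<theta> > 0" and w: "\<forall>x\<in>{- real N * \<theta> .. real M - \<theta>}. w x > 0"
    and k: "k \<le> N" and L: "L \<in> XX \<theta> M N k"
  shows "weight \<theta> w N k L > 0"
proof -
  have LN: "L N \<in> WW \<theta> M N" using L k by (intro XX_level) auto
  have "H_top \<theta> w N (L N) > 0"
    unfolding H_top_def
  proof (intro mult_pos_pos prod_pos ballI divide_pos_pos Gamma_real_pos bspec[OF w])
    fix q p assume "q \<in> {1..N}" "p \<in> {1..<q}"
    then have "L N p - L N q \<ge> \<theta>" by (intro WW_diff_ge[OF \<theta> LN]) auto
    then show "L N p - L N q + 1 > 0" "L N p - L N q + 1 - \<theta> > 0" using \<theta> by simp_all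
  next
    fix p assume p: "p \<in> {1..N}"
    obtain \<kappa> where \<kappa>: "\<kappa> \<in> Lam M N" "L N = (\<lambda>i\<in>{1..N}. lat \<theta> \<kappa> i)" using LN by (auto simp: WW_eq)
    then have "0 \<le> \<kappa> p" "\<kappa> p \<le> int M" using p by (auto simp: Lam_def PiE_iff)
    then have "0 \<le> real_of_int (\<kappa> p)" "real_of_int (\<kappa> p) \<le> real M" by linarith+
    moreover have "real p * \<theta> \<le> real N * \<theta>" "1 * \<theta> \<le> real p * \<theta>" using p \<theta> by (intro mult_right_mono; simp)+
    ultimately show "L N p \<in> {- real N * \<theta> .. real M - \<theta>}" using p by (simp add: \<kappa> lat_def)
  qed
  moreover have "(\<Prod>j\<in>{k..<N}. I_weight \<theta> j (L (j + 1)) (L j)) > 0"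
    using XX_level[OF L] XX_inter[OF L] by (intro prod_pos ballI I_weight_pos[OF \<theta>, of _ M]) auto
  moreover have "H_bot \<theta> k (L k) > 0" using XX_level[OF L] k by (intro H_bot_pos[OF \<theta>]) auto
  ultimately show ?thesis by (simp add: weight_def)
qed

lemma XX_nonempty:
  assumes "k \<le> N" shows "XX \<theta> M N k \<noteq> {}"
  using assms
proof (induction rule: inc_induct)
  case base
  have "WW \<theta> M N \<noteq> {}"
  proof -
    have "(\<lambda>i\<in>{1..N}. 0::int) \<in> Lam M N" by (auto simp: Lam_def)
    then show ?thesis by (auto simp: WW_eq)
  qed
  then show ?case by (auto simp: XX_def PiE_eq_empty_iff)
next
  case (step k)
  then obtain L where L: "L \<in> XX \<theta> M N (Suc k)" by auto
  then have "L (Suc k) \<in> WW \<theta> M (Suc k)" using step by (intro XX_level) auto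
  then obtain m where "m \<in> inter \<theta> M k (L (Suc k))" using inter_nonempty by blast
  then show ?case using XX_extend[OF _ L] step by blast
qed

section \<open>Expectations as finite sums\<close>

lemma partition_fun_pos:
  assumes "\<theta> > 0" and "\<forall>x\<in>{- real N * \<theta> .. real M - \<theta>}. w x > 0" and "k \<le> N"
  shows "partition_fun \<theta> w M N k > 0"
  unfolding partition_fun_def using XX_nonempty[OF assms(3)] finite_XX weight_pos[OF assms]
  by (intro sum_pos) auto

text \<open>Positivity of the weights makes the passage through \<open>ennreal\<close> lossless, so
  the integral is a weighted sum over a finite set.\<close>

lemma EE_eq:
  assumes "\<theta> > 0" and "\<forall>x\<in>{- real N * \<theta> .. real M - \<theta>}. w x > 0" and "k \<le> N"
  shows "EE \<theta> w M N k f = (\<Sum>L\<in>XX \<theta> M N k. of_real (weight \<theta> w N k L) * f L) / of_real (partition_fun \<theta> w M N k)"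
proof -
  have "EE \<theta> w M N k f = (\<Sum>L\<in>XX \<theta> M N k. (weight \<theta> w N k L / partition_fun \<theta> w M N k) *\<^sub>R f L)"
    unfolding PP_def using weight_pos[OF assms] partition_fun_pos[OF assms]
    by (intro lebesgue_integral_point_measure_finite finite_XX) (auto intro!: divide_nonneg_pos less_imp_le)
  then show ?thesis by (simp add: scaleR_conv_of_real sum_divide_distrib)
qed

lemma EE_const:
  assumes "\<theta> > 0" and "\<forall>x\<in>{- real N * \<theta> .. real M - \<theta>}. w x > 0" and "k \<le> N"
  shows "EE \<theta> w M N k (\<lambda>_. c) = c"
proof -
  have "(\<Sum>L\<in>XX \<theta> M N k. of_real (weight \<theta> w N k L) * c) = of_real (partition_fun \<theta> w M N k) * c"
    by (simp add: partition_fun_def sum_distrib_right)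
  then show ?thesis using partition_fun_pos[OF assms] by (subst EE_eq[OF assms]) simp
qed

lemma EE_lincomb:
  assumes "\<theta> > 0" and "\<forall>x\<in>{- real N * \<theta> .. real M - \<theta>}. w x > 0" and "k \<le> N"
  shows "EE \<theta> w M N k (\<lambda>L. f L + c * g L) = EE \<theta> w M N k f + c * EE \<theta> w M N k g"
  unfolding EE_eq[OF assms]
  by (simp add: distrib_left sum.distrib add_divide_distrib sum_distrib_left mult.left_commute)

text \<open>It suffices to compare the sums over the bottom level with the upper levels held fixed:
  \<open>base_weight\<close> factors out, and the constant of \<open>sum_inter_weight\<close>
  cancels between numerator and \<open>partition_fun\<close>.\<close>

lemma EE_marginal:
  assumes \<theta>: "\<theta> > 0" "\<theta> \<noteq> 1" and w: "\<forall>x\<in>{- real N * \<theta> .. real M - \<theta>}. w x > 0" and k: "k < N"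
    and fg: "\<And>L. L \<in> XX \<theta> M N (Suc k) \<Longrightarrow>
      (\<Sum>m\<in>inter \<theta> M k (L (Suc k)). of_real (I_weight \<theta> k (L (Suc k)) m * H_bot \<theta> k m) * f (L(k := m))) =
      (\<Sum>m\<in>inter \<theta> M k (L (Suc k)). of_real (I_weight \<theta> k (L (Suc k)) m * H_bot \<theta> k m) * g L)"
  shows "EE \<theta> w M N k f = EE \<theta> w M N (Suc k) g"
proof -
  obtain c where c: "c > 0" "\<And>l. l \<in> WW \<theta> M (Suc k) \<Longrightarrow>
     (\<Sum>m\<in>inter \<theta> M k l. I_weight \<theta> k l m * H_bot \<theta> k m) = c * H_bot \<theta> (Suc k) l"
    using sum_inter_weight[OF \<theta>, where M = M and n = k] by blast
  have mass: "(\<Sum>m\<in>inter \<theta> M k (L (Suc k)). weight \<theta> w N k (L(k := m))) = c * weight \<theta> w N (Suc k) L"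
    if "L \<in> XX \<theta> M N (Suc k)" for L
  proof -
    have "L (Suc k) \<in> WW \<theta> M (Suc k)" using that k by (intro XX_level) auto
    from c(2)[OF this] show ?thesis
      by (simp add: weight_extend[OF k] weight_eq[of _ _ _ "Suc k"] sum_distrib_left[symmetric])
  qed
  have Z: "partition_fun \<theta> w M N k = c * partition_fun \<theta> w M N (Suc k)"
    unfolding partition_fun_def sum_XX[OF k] sum_distrib_left by (intro sum.cong refl mass)
  have "(\<Sum>L\<in>XX \<theta> M N k. of_real (weight \<theta> w N k L) * f L) =
    (\<Sum>L\<in>XX \<theta> M N (Suc k). of_real (base_weight \<theta> w N (Suc k) L) *
      (\<Sum>m\<in>inter \<theta> M k (L (Suc k)). of_real (I_weight \<theta> k (L (Suc k)) m * H_bot \<theta> k m) * f (L(k := m))))"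
    unfolding sum_XX[OF k] weight_extend[OF k] of_real_mult[of "base_weight _ _ _ _ _"] mult.assoc sum_distrib_left ..
  also have "\<dots> = (\<Sum>L\<in>XX \<theta> M N (Suc k). of_real (base_weight \<theta> w N (Suc k) L) *
      (\<Sum>m\<in>inter \<theta> M k (L (Suc k)). of_real (I_weight \<theta> k (L (Suc k)) m * H_bot \<theta> k m) * g L))"
    by (intro sum.cong refl arg_cong2[where f = "(*)"] fg)
  also have "\<dots> = (\<Sum>L\<in>XX \<theta> M N (Suc k). (of_real (c * weight \<theta> w N (Suc k) L)) * g L)"
  proof (intro sum.cong refl)
    fix L assume L: "L \<in> XX \<theta> M N (Suc k)"
    show "of_real (base_weight \<theta> w N (Suc k) L) *
      (\<Sum>m\<in>inter \<theta> M k (L (Suc k)). of_real (I_weight \<theta> k (L (Suc k)) m * H_bot \<theta> k m) * g L) =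
      of_real (c * weight \<theta> w N (Suc k) L) * g L"
      unfolding mass[OF L, symmetric] weight_extend[OF k]
      by (simp add: sum_distrib_left sum_distrib_right mult_ac)
  qed
  also have "\<dots> = of_real c * (\<Sum>L\<in>XX \<theta> M N (Suc k). of_real (weight \<theta> w N (Suc k) L) * g L)"
    by (simp add: sum_distrib_left mult_ac)
  finally have S: "(\<Sum>L\<in>XX \<theta> M N k. of_real (weight \<theta> w N k L) * f L) =
     of_real c * (\<Sum>L\<in>XX \<theta> M N (Suc k). of_real (weight \<theta> w N (Suc k) L) * g L)" .
  have k': "k \<le> N" "Suc k \<le> N" using k by auto
  show ?thesis unfolding EE_eq[OF \<theta>(1) w k'(1)] EE_eq[OF \<theta>(1) w k'(2)] S Z using c(1) by simp
qed

lemma EE_upper: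
  assumes \<theta>: "\<theta> > 0" "\<theta> \<noteq> 1" and w: "\<forall>x\<in>{- real N * \<theta> .. real M - \<theta>}. w x > 0" and k: "k < N"
    and f: "\<And>L m. f (L(k := m)) = f L"
  shows "EE \<theta> w M N k f = EE \<theta> w M N (Suc k) f"
  by (rule EE_marginal[OF \<theta> w k]) (simp_all add: f)

text \<open>Only the product over level \<open>k\<close> and the summand with
  \<open>j = k + 1\<close> involve level \<open>k\<close>. \<open>EE_marginal\<close> reduces their
  combination to an identity for a fixed upper vector, which is the two-point formula divided by
  \<open>D\<close>.\<close>

lemma R1_step:
  assumes \<theta>: "\<theta> > 0" "\<theta> \<noteq> 1" and w: "\<forall>x\<in>{- real N * \<theta> .. real M - \<theta>}. w x > 0" and k: "1 \<le> k" "k < N"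
    and z: "z \<notin> R1_sing \<theta> M N k"
  shows "R1 \<theta> w M N k \<Phi>p \<Phi>m z = R1 \<theta> w M N (Suc k) \<Phi>p \<Phi>m z + of_real \<theta> * \<Phi>p z / (1 - of_real \<theta>)"
proof -
  define P where "P = (\<lambda>(j::nat) (L :: nat \<Rightarrow> nat \<Rightarrow> real). \<Prod>p=1..j. (z - of_real (L j p) + of_real \<theta> - 1) / (z - of_real (L j p) - 1))"
  define T where "T = (\<lambda>(j::nat) (L :: nat \<Rightarrow> nat \<Rightarrow> real).
     (\<Prod>p=1..j. (z - of_real (L j p) - of_real \<theta>) / (z - of_real (L j p) - 1)) *
          (\<Prod>p=1..j-1. (z - of_real (L (j-1) p) + of_real \<theta> - 1) / (z - of_real (L (j-1) p))))"
  define Q where "Q = (\<lambda>(L :: nat \<Rightarrow> nat \<Rightarrow> real). \<Prod>p=1..N. (z - of_real (L N p) - of_real \<theta>) / (z - of_real (L N p)))"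
  define c where "c = of_real \<theta> / (1 - of_real \<theta> :: complex)"
  have \<theta>1: "1 - complex_of_real \<theta> \<noteq> 0" using \<theta> by (metis eq_iff_diff_eq_0 of_real_1 of_real_eq_iff)
  have R: "R1 \<theta> w M N k \<Phi>p \<Phi>m z = \<Phi>m z * EE \<theta> w M N k Q + \<Phi>p z * (EE \<theta> w M N k (P k) + c * (\<Sum>j=k+1..N. EE \<theta> w M N k (T j)))" for k
    by (simp add: R1_def P_def T_def Q_def c_def distrib_left mult_ac)
  have Q: "EE \<theta> w M N k Q = EE \<theta> w M N (Suc k) Q"
    by (rule EE_upper[OF \<theta> w k(2)]) (use k in \<open>simp_all add: Q_def\<close>)
  have T: "(\<Sum>j=Suc k+1..N. EE \<theta> w M N k (T j)) = (\<Sum>j=Suc k+1..N. EE \<theta> w M N (Suc k) (T j))"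
    by (intro sum.cong refl EE_upper[OF \<theta> w k(2)]) (auto simp: T_def)
  have sing: "z \<noteq> of_real (L j p) \<and> z \<noteq> of_real (L j p) + 1"
    if "L \<in> XX \<theta> M N k" "j \<in> {k..N}" "p \<in> {1..j}" for L j p
    using z that unfolding R1_sing_def by auto
  have main: "EE \<theta> w M N k (\<lambda>L. P k L + c * T (Suc k) L) = EE \<theta> w M N (Suc k) (\<lambda>L. P (Suc k) L + c * 1)"
  proof (rule EE_marginal[OF \<theta> w k(2)])
    fix L assume L: "L \<in> XX \<theta> M N (Suc k)"
    define l where "l = L (Suc k)"
    have l: "l \<in> WW \<theta> M (Suc k)" unfolding l_def using L k by (intro XX_level) auto
    define W where "W = (\<lambda>m. complex_of_real (I_weight \<theta> k l m * H_bot \<theta> k m))"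
    \<comment> \<open>With this choice \<open>1 + y - z\<close> and \<open>- (y - z)\<close> are
      \<open>\<theta>\<close> and \<open>1 - \<theta>\<close>, whose quotient is the prefactor of
      the sum in \<open>R1\<close>.\<close>
    define y where "y = z + of_real \<theta> - 1"
    obtain m0 where m0: "m0 \<in> inter \<theta> M k l" using inter_nonempty[OF l] by blast
    have zl: "z - 1 - of_real (l q) \<noteq> 0" if "q \<in> {1..Suc k}" for q
    proof -
      have "z \<noteq> of_real (l q) + 1"
        using sing[OF XX_extend[OF k(2) L m0[unfolded l_def]], of "Suc k" q] that k by (auto simp: l_def)
      then show ?thesis by (simp add: diff_eq_eq)
    qed
    have zm: "z \<noteq> of_real (m p) \<and> z - 1 \<noteq> of_real (m p)" if "m \<in> inter \<theta> M k l" "p \<in> {1..k}" for m p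
      using sing[OF XX_extend[OF k(2) L that(1)[unfolded l_def]], of k p] that k by (auto simp: diff_eq_eq)
    define D where "D = (1 - of_real \<theta>) * (\<Prod>q\<in>{1..Suc k}. z - 1 - of_real (l q))"
    have D: "D \<noteq> 0" unfolding D_def using \<theta>1 zl by (simp add: prod_zero_iff)
    have yz: "1 + y - z = of_real \<theta>" "y - z = - (1 - of_real \<theta>)" by (simp_all add: y_def)
    have key: "(\<Sum>m\<in>inter \<theta> M k l. W m *
       ((1 + y - z) * (\<Prod>q\<in>{1..Suc k}. z - of_real (l q) - of_real \<theta>) *
          (\<Prod>p\<in>{1..k}. (y - of_real (m p)) / (z - of_real (m p)))
        - (y - z) * (\<Prod>q\<in>{1..Suc k}. z - 1 - of_real (l q)) *
          (\<Prod>p\<in>{1..k}. (y - of_real (m p)) / (z - 1 - of_real (m p))))) =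
     (\<Sum>m\<in>inter \<theta> M k l. W m *
       ((1 + y - z) * (\<Prod>q\<in>{1..Suc k}. y - of_real (l q) - of_real \<theta>)
        - (y - z) * (\<Prod>q\<in>{1..Suc k}. y - of_real (l q))))"
      unfolding W_def by (rule sum_inter_two_point[OF \<theta>(1) l]) (rule zm)
    have lhs: "(1 + y - z) * (\<Prod>q\<in>{1..Suc k}. z - of_real (l q) - of_real \<theta>) *
          (\<Prod>p\<in>{1..k}. (y - of_real (m p)) / (z - of_real (m p)))
        - (y - z) * (\<Prod>q\<in>{1..Suc k}. z - 1 - of_real (l q)) *
          (\<Prod>p\<in>{1..k}. (y - of_real (m p)) / (z - 1 - of_real (m p))) =
        D * (P k (L(k := m)) + c * T (Suc k) (L(k := m)))" for m
    proof -
      have P: "P k (L(k := m)) = (\<Prod>p\<in>{1..k}. (y - of_real (m p)) / (z - 1 - of_real (m p)))"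
        by (simp add: P_def y_def algebra_simps)
      have T: "T (Suc k) (L(k := m)) = (\<Prod>q\<in>{1..Suc k}. z - of_real (l q) - of_real \<theta>) / (\<Prod>q\<in>{1..Suc k}. z - 1 - of_real (l q)) *
          (\<Prod>p\<in>{1..k}. (y - of_real (m p)) / (z - of_real (m p)))"
        unfolding prod_dividef[symmetric] by (simp add: T_def y_def l_def algebra_simps)
      define E where "E = (\<Prod>q\<in>{1..Suc k}. z - 1 - complex_of_real (l q))"
      have "E \<noteq> 0" using zl by (simp add: E_def prod_zero_iff)
      then show ?thesis unfolding P T yz D_def c_def E_def[symmetric] using \<theta>1 by (simp add: field_simps)
    qed
    have rhs: "(1 + y - z) * (\<Prod>q\<in>{1..Suc k}. y - of_real (l q) - of_real \<theta>)
        - (y - z) * (\<Prod>q\<in>{1..Suc k}. y - of_real (l q)) = D * (P (Suc k) L + c * 1)"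
    proof -
      have P: "P (Suc k) L = (\<Prod>q\<in>{1..Suc k}. y - of_real (l q)) / (\<Prod>q\<in>{1..Suc k}. z - 1 - of_real (l q))"
        unfolding prod_dividef[symmetric] by (simp add: P_def y_def l_def algebra_simps)
      \<comment> \<open>Since \<open>y - \<theta> = z - 1\<close>, the first product on the right
        equals the one in \<open>D\<close>; this produces the constant increment.\<close>
      have Y: "(\<Prod>q\<in>{1..Suc k}. y - of_real (l q) - of_real \<theta>) = (\<Prod>q\<in>{1..Suc k}. z - 1 - of_real (l q))"
        by (intro prod.cong refl) (simp add: y_def)
      define E where "E = (\<Prod>q\<in>{1..Suc k}. z - 1 - complex_of_real (l q))"
      have "E \<noteq> 0" using zl by (simp add: E_def prod_zero_iff)
      then show ?thesis unfolding P Y yz D_def c_def E_def[symmetric] using \<theta>1 by (simp add: field_simps)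
    qed
    from key have "D * (\<Sum>m\<in>inter \<theta> M k l. W m * (P k (L(k := m)) + c * T (Suc k) (L(k := m)))) =
        D * (\<Sum>m\<in>inter \<theta> M k l. W m * (P (Suc k) L + c * 1))"
      unfolding lhs rhs by (simp only: mult.left_commute[of _ D] sum_distrib_left)
    with D show "(\<Sum>m\<in>inter \<theta> M k (L (Suc k)). of_real (I_weight \<theta> k (L (Suc k)) m * H_bot \<theta> k m) *
          (P k (L(k := m)) + c * T (Suc k) (L(k := m)))) =
        (\<Sum>m\<in>inter \<theta> M k (L (Suc k)). of_real (I_weight \<theta> k (L (Suc k)) m * H_bot \<theta> k m) * (P (Suc k) L + c * 1))"
      by (simp add: W_def l_def)
  qed
  have k': "k \<le> N" "Suc k \<le> N" using k by auto
  have main': "EE \<theta> w M N k (P k) + c * EE \<theta> w M N k (T (Suc k)) = EE \<theta> w M N (Suc k) (P (Suc k)) + c"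
    using main unfolding EE_lincomb[OF \<theta>(1) w k'(1)] EE_lincomb[OF \<theta>(1) w k'(2)] EE_const[OF \<theta>(1) w k'(2)] by simp
  have "(\<Sum>j=k+1..N. EE \<theta> w M N k (T j)) = EE \<theta> w M N k (T (Suc k)) + (\<Sum>j=Suc k+1..N. EE \<theta> w M N (Suc k) (T j))"
    unfolding T[symmetric] using k by (simp add: sum.atLeast_Suc_atMost)
  then have "EE \<theta> w M N k (P k) + c * (\<Sum>j=k+1..N. EE \<theta> w M N k (T j)) =
     EE \<theta> w M N (Suc k) (P (Suc k)) + c * (\<Sum>j=Suc k+1..N. EE \<theta> w M N (Suc k) (T j)) + c"
    using main' by (simp add: algebra_simps)
  then show ?thesis unfolding R Q by (simp add: c_def algebra_simps)
qed

text \<open>As for \<open>R1\<close>, with the two coefficients interchanged: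
  \<open>1 + y - v\<close> is now \<open>1 - \<theta>\<close>, the division is by a multiple of the
  product of \<open>y - l q\<close>, and the second product on the right yields the
  constant.\<close>

lemma R2_step:
  assumes \<theta>: "\<theta> > 0" "\<theta> \<noteq> 1" and w: "\<forall>x\<in>{- real N * \<theta> .. real M - \<theta>}. w x > 0" and k: "1 \<le> k" "k < N"
    and z: "z \<notin> R2_sing \<theta> M N k"
  shows "R2 \<theta> w M N k \<Phi>p \<Phi>m z = R2 \<theta> w M N (Suc k) \<Phi>p \<Phi>m z + of_real \<theta> * \<Phi>m z / (1 - of_real \<theta>)"
proof -
  define P where "P = (\<lambda>(j::nat) (L :: nat \<Rightarrow> nat \<Rightarrow> real). \<Prod>p=1..j. (z - of_real (L j p) + of_real ((real N - real j - 1) * \<theta>)) /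
                (z - of_real (L j p) + of_real ((real N - real j) * \<theta>)))"
  define T where "T = (\<lambda>(j::nat) (L :: nat \<Rightarrow> nat \<Rightarrow> real).
     (\<Prod>p=1..j. (z - of_real (L j p) + of_real ((real N - real j + 1) * \<theta>) - 1) /
                     (z - of_real (L j p) + of_real ((real N - real j) * \<theta>))) *
          (\<Prod>p=1..j-1. (z - of_real (L (j-1) p) + of_real ((real N - real j) * \<theta>)) /
                       (z - of_real (L (j-1) p) + of_real ((real N - real j + 1) * \<theta>) - 1)))"
  define Q where "Q = (\<lambda>(L :: nat \<Rightarrow> nat \<Rightarrow> real). \<Prod>p=1..N. (z - of_real (L N p) + of_real \<theta> - 1) / (z - of_real (L N p) - 1))"
  define c where "c = of_real \<theta> / (1 - of_real \<theta> :: complex)"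
  have \<theta>1: "1 - complex_of_real \<theta> \<noteq> 0" using \<theta> by (metis eq_iff_diff_eq_0 of_real_1 of_real_eq_iff)
  have R: "R2 \<theta> w M N k \<Phi>p \<Phi>m z = \<Phi>p z * EE \<theta> w M N k Q + \<Phi>m z * (EE \<theta> w M N k (P k) + c * (\<Sum>j=k+1..N. EE \<theta> w M N k (T j)))" for k
    by (simp add: R2_def P_def T_def Q_def c_def distrib_left mult_ac)
  have Q: "EE \<theta> w M N k Q = EE \<theta> w M N (Suc k) Q"
    by (rule EE_upper[OF \<theta> w k(2)]) (use k in \<open>simp_all add: Q_def\<close>)
  have T: "(\<Sum>j=Suc k+1..N. EE \<theta> w M N k (T j)) = (\<Sum>j=Suc k+1..N. EE \<theta> w M N (Suc k) (T j))"
    by (intro sum.cong refl EE_upper[OF \<theta> w k(2)]) (auto simp: T_def)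
  have sing: "z \<noteq> of_real (L j p - (real N - real j) * \<theta>) \<and> z \<noteq> of_real (L j p - (real N - real j) * \<theta> + 1)"
    if "L \<in> XX \<theta> M N k" "j \<in> {k..N}" "p \<in> {1..j}" for L j p
    using z that unfolding R2_sing_def by blast
  have main: "EE \<theta> w M N k (\<lambda>L. P k L + c * T (Suc k) L) = EE \<theta> w M N (Suc k) (\<lambda>L. P (Suc k) L + c * 1)"
  proof (rule EE_marginal[OF \<theta> w k(2)])
    fix L assume L: "L \<in> XX \<theta> M N (Suc k)"
    define l where "l = L (Suc k)"
    have l: "l \<in> WW \<theta> M (Suc k)" unfolding l_def using L k by (intro XX_level) auto
    define W where "W = (\<lambda>m. complex_of_real (I_weight \<theta> k l m * H_bot \<theta> k m))"
    define y where "y = z + of_real ((real N - real k - 1) * \<theta>)"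
    \<comment> \<open>\<open>v\<close> takes the place of \<open>z\<close> in the two-point formula;
      since \<open>v - l q - \<theta> = y - l q\<close>, the first product on the left cancels
      against \<open>D\<close>.\<close>
    define v where "v = y + of_real \<theta>"
    obtain m0 where m0: "m0 \<in> inter \<theta> M k l" using inter_nonempty[OF l] by blast
    have zl: "y - of_real (l q) \<noteq> 0" if "q \<in> {1..Suc k}" for q
    proof -
      have "z \<noteq> of_real (l q - (real N - real (Suc k)) * \<theta>)"
        using sing[OF XX_extend[OF k(2) L m0[unfolded l_def]], of "Suc k" q] that k by (auto simp: l_def)
      then show ?thesis by (auto simp: y_def algebra_simps)
    qed
    have zm: "v \<noteq> of_real (m p) \<and> v - 1 \<noteq> of_real (m p)" if "m \<in> inter \<theta> M k l" "p \<in> {1..k}" for m p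
    proof -
      have "z \<noteq> of_real (m p - (real N - real k) * \<theta>) \<and> z \<noteq> of_real (m p - (real N - real k) * \<theta> + 1)"
        using sing[OF XX_extend[OF k(2) L that(1)[unfolded l_def]], of k p] that k by auto
      then show ?thesis by (auto simp: v_def y_def algebra_simps)
    qed
    define D where "D = (1 - of_real \<theta>) * (\<Prod>q\<in>{1..Suc k}. y - of_real (l q))"
    have D: "D \<noteq> 0" unfolding D_def using \<theta>1 zl by (simp add: prod_zero_iff)
    have yv: "1 + y - v = 1 - of_real \<theta>" "y - v = - of_real \<theta>" by (simp_all add: v_def)
    have key: "(\<Sum>m\<in>inter \<theta> M k l. W m *
       ((1 + y - v) * (\<Prod>q\<in>{1..Suc k}. v - of_real (l q) - of_real \<theta>) *
          (\<Prod>p\<in>{1..k}. (y - of_real (m p)) / (v - of_real (m p)))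
        - (y - v) * (\<Prod>q\<in>{1..Suc k}. v - 1 - of_real (l q)) *
          (\<Prod>p\<in>{1..k}. (y - of_real (m p)) / (v - 1 - of_real (m p))))) =
     (\<Sum>m\<in>inter \<theta> M k l. W m *
       ((1 + y - v) * (\<Prod>q\<in>{1..Suc k}. y - of_real (l q) - of_real \<theta>)
        - (y - v) * (\<Prod>q\<in>{1..Suc k}. y - of_real (l q))))"
      unfolding W_def by (rule sum_inter_two_point[OF \<theta>(1) l]) (rule zm)
    define E where "E = (\<Prod>q\<in>{1..Suc k}. y - complex_of_real (l q))"
    have E: "E \<noteq> 0" using zl by (simp add: E_def prod_zero_iff)
    have lhs: "(1 + y - v) * (\<Prod>q\<in>{1..Suc k}. v - of_real (l q) - of_real \<theta>) *
          (\<Prod>p\<in>{1..k}. (y - of_real (m p)) / (v - of_real (m p)))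
        - (y - v) * (\<Prod>q\<in>{1..Suc k}. v - 1 - of_real (l q)) *
          (\<Prod>p\<in>{1..k}. (y - of_real (m p)) / (v - 1 - of_real (m p))) =
        D * (P k (L(k := m)) + c * T (Suc k) (L(k := m)))" for m
    proof -
      have P: "P k (L(k := m)) = (\<Prod>p\<in>{1..k}. (y - of_real (m p)) / (v - of_real (m p)))"
        by (simp add: P_def y_def v_def algebra_simps)
      have T: "T (Suc k) (L(k := m)) = (\<Prod>q\<in>{1..Suc k}. v - 1 - of_real (l q)) / E *
          (\<Prod>p\<in>{1..k}. (y - of_real (m p)) / (v - 1 - of_real (m p)))"
        unfolding E_def prod_dividef[symmetric] by (simp add: T_def y_def v_def l_def algebra_simps)
      have Y: "(\<Prod>q\<in>{1..Suc k}. v - of_real (l q) - of_real \<theta>) = E"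
        unfolding E_def by (intro prod.cong refl) (simp add: v_def)
      show ?thesis unfolding P T Y yv D_def c_def E_def[symmetric] using \<theta>1 E by (simp add: field_simps)
    qed
    have rhs: "(1 + y - v) * (\<Prod>q\<in>{1..Suc k}. y - of_real (l q) - of_real \<theta>)
        - (y - v) * (\<Prod>q\<in>{1..Suc k}. y - of_real (l q)) = D * (P (Suc k) L + c * 1)"
    proof -
      have P: "P (Suc k) L = (\<Prod>q\<in>{1..Suc k}. y - of_real (l q) - of_real \<theta>) / E"
        unfolding E_def prod_dividef[symmetric] by (simp add: P_def y_def l_def algebra_simps)
      show ?thesis unfolding P yv D_def c_def E_def[symmetric] using \<theta>1 E by (simp add: field_simps)
    qed
    from key have "D * (\<Sum>m\<in>inter \<theta> M k l. W m * (P k (L(k := m)) + c * T (Suc k) (L(k := m)))) =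
        D * (\<Sum>m\<in>inter \<theta> M k l. W m * (P (Suc k) L + c * 1))"
      unfolding lhs rhs by (simp only: mult.left_commute[of _ D] sum_distrib_left)
    with D show "(\<Sum>m\<in>inter \<theta> M k (L (Suc k)). of_real (I_weight \<theta> k (L (Suc k)) m * H_bot \<theta> k m) *
          (P k (L(k := m)) + c * T (Suc k) (L(k := m)))) =
        (\<Sum>m\<in>inter \<theta> M k (L (Suc k)). of_real (I_weight \<theta> k (L (Suc k)) m * H_bot \<theta> k m) * (P (Suc k) L + c * 1))"
      by (simp add: W_def l_def)
  qed
  have k': "k \<le> N" "Suc k \<le> N" using k by auto
  have main': "EE \<theta> w M N k (P k) + c * EE \<theta> w M N k (T (Suc k)) = EE \<theta> w M N (Suc k) (P (Suc k)) + c"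
    using main unfolding EE_lincomb[OF \<theta>(1) w k'(1)] EE_lincomb[OF \<theta>(1) w k'(2)] EE_const[OF \<theta>(1) w k'(2)] by simp
  have "(\<Sum>j=k+1..N. EE \<theta> w M N k (T j)) = EE \<theta> w M N k (T (Suc k)) + (\<Sum>j=Suc k+1..N. EE \<theta> w M N (Suc k) (T j))"
    unfolding T[symmetric] using k by (simp add: sum.atLeast_Suc_atMost)
  then have "EE \<theta> w M N k (P k) + c * (\<Sum>j=k+1..N. EE \<theta> w M N k (T j)) =
     EE \<theta> w M N (Suc k) (P (Suc k)) + c * (\<Sum>j=Suc k+1..N. EE \<theta> w M N (Suc k) (T j)) + c"
    using main' by (simp add: algebra_simps)
  then show ?thesis unfolding R Q by (simp add: c_def algebra_simps)
qed

text \<open>Every tuple on the upper levels extends to level \<open>k\<close>, so no exceptional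
  point is lost when \<open>k\<close> decreases.\<close>

lemma sing_Suc:
  assumes k: "k < N"
  shows "R1_sing \<theta> M N (Suc k) \<subseteq> R1_sing \<theta> M N k" "R2_sing \<theta> M N (Suc k) \<subseteq> R2_sing \<theta> M N k"
proof -
  have "\<exists>L'\<in>XX \<theta> M N k. \<forall>j\<in>{Suc k..N}. L' j = L j" if L: "L \<in> XX \<theta> M N (Suc k)" for L
  proof -
    have "L (Suc k) \<in> WW \<theta> M (Suc k)" using L k by (intro XX_level) auto
    then obtain m where "m \<in> inter \<theta> M k (L (Suc k))" using inter_nonempty by blast
    then show ?thesis by (intro bexI[OF _ XX_extend[OF k L]]) auto
  qed
  note ext = this
  have lift: "(\<Union>L\<in>XX \<theta> M N (Suc k). \<Union>j\<in>{Suc k..N}. \<Union>p\<in>{1..j}. F j (L j p)) \<subseteq>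
      (\<Union>L\<in>XX \<theta> M N k. \<Union>j\<in>{k..N}. \<Union>p\<in>{1..j}. F j (L j p))" for F :: "nat \<Rightarrow> real \<Rightarrow> complex set"
  proof (intro UN_least)
    fix L j p assume L: "L \<in> XX \<theta> M N (Suc k)" and j: "j \<in> {Suc k..N}" and p: "p \<in> {1..j}"
    obtain L' where L': "L' \<in> XX \<theta> M N k" "L' j = L j" using ext[OF L] j by blast
    have "j \<in> {k..N}" using j by auto
    then show "F j (L j p) \<subseteq> (\<Union>L\<in>XX \<theta> M N k. \<Union>j\<in>{k..N}. \<Union>p\<in>{1..j}. F j (L j p))"
      using L' p by (intro subsetI UN_I[of L'] UN_I[of j] UN_I[of p]) auto
  qed
  show "R1_sing \<theta> M N (Suc k) \<subseteq> R1_sing \<theta> M N k" "R2_sing \<theta> M N (Suc k) \<subseteq> R2_sing \<theta> M N k"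
    unfolding R1_sing_def R2_sing_def
    by (rule lift[of "\<lambda>j x. {complex_of_real x, complex_of_real (x + 1)}"],
        rule lift[of "\<lambda>j x. {complex_of_real (x - (real N - real j) * \<theta>), complex_of_real (x - (real N - real j) * \<theta> + 1)}"])
qed

lemma R1_reduce:
  assumes \<theta>: "\<theta> > 0" "\<theta> \<noteq> 1" and w: "\<forall>x\<in>{- real N * \<theta> .. real M - \<theta>}. w x > 0" and k: "1 \<le> k" "k \<le> N"
    and z: "z \<notin> R1_sing \<theta> M N k"
  shows "R1 \<theta> w M N k \<Phi>p \<Phi>m z = R1 \<theta> w M N N \<Phi>p \<Phi>m z + of_nat (N - k) * (of_real \<theta> / (1 - of_real \<theta>) * \<Phi>p z)"
  using k(2,1) z
proof (induction rule: inc_induct)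
  case (step k)
  then have "N - k = Suc (N - Suc k)" by simp
  moreover have "z \<notin> R1_sing \<theta> M N (Suc k)" using sing_Suc(1)[of k N] step by auto
  moreover have "R1 \<theta> w M N k \<Phi>p \<Phi>m z = R1 \<theta> w M N (Suc k) \<Phi>p \<Phi>m z + of_real \<theta> * \<Phi>p z / (1 - of_real \<theta>)"
    using step by (intro R1_step[OF \<theta> w]) auto
  moreover have "R1 \<theta> w M N (Suc k) \<Phi>p \<Phi>m z = R1 \<theta> w M N N \<Phi>p \<Phi>m z + of_nat (N - Suc k) * (of_real \<theta> / (1 - of_real \<theta>) * \<Phi>p z)"
    using step calculation(2) by auto
  ultimately show ?case by (simp only: of_nat_Suc distrib_right mult_1 add_ac times_divide_eq_left)
qed simp

lemma R2_reduce:
  assumes \<theta>: "\<theta> > 0" "\<theta> \<noteq> 1" and w: "\<forall>x\<in>{- real N * \<theta> .. real M - \<theta>}. w x > 0" and k: "1 \<le> k" "k \<le> N"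
    and z: "z \<notin> R2_sing \<theta> M N k"
  shows "R2 \<theta> w M N k \<Phi>p \<Phi>m z = R2 \<theta> w M N N \<Phi>p \<Phi>m z + of_nat (N - k) * (of_real \<theta> / (1 - of_real \<theta>) * \<Phi>m z)"
  using k(2,1) z
proof (induction rule: inc_induct)
  case (step k)
  then have "N - k = Suc (N - Suc k)" by simp
  moreover have "z \<notin> R2_sing \<theta> M N (Suc k)" using sing_Suc(2)[of k N] step by auto
  moreover have "R2 \<theta> w M N k \<Phi>p \<Phi>m z = R2 \<theta> w M N (Suc k) \<Phi>p \<Phi>m z + of_real \<theta> * \<Phi>m z / (1 - of_real \<theta>)"
    using step by (intro R2_step[OF \<theta> w]) auto
  moreover have "R2 \<theta> w M N (Suc k) \<Phi>p \<Phi>m z = R2 \<theta> w M N N \<Phi>p \<Phi>m z + of_nat (N - Suc k) * (of_real \<theta> / (1 - of_real \<theta>) * \<Phi>m z)"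
    using step calculation(2) by auto
  ultimately show ?case by (simp only: of_nat_Suc distrib_right mult_1 add_ac times_divide_eq_left)
qed simp

lemma R2_top: "R2 \<theta> w M N N \<Phi>p \<Phi>m z = R1 \<theta> w M N N \<Phi>p \<Phi>m z"
  by (simp add: R1_def R2_def)

section \<open>A single level\<close>

text \<open>The numerator is monic of degree equal to the number of nodes, so the leading term of
  the interpolation formula gives the \<open>1\<close>, and the other terms give the simple
  poles.\<close>

lemma partial_fractions:
  fixes x :: "nat \<Rightarrow> 'a::field"
  assumes S: "finite S" and inj: "inj_on x S" and z: "\<And>p. p \<in> S \<Longrightarrow> z \<noteq> x p"
  shows "(\<Prod>p\<in>S. (z - x p - a) / (z - x p)) =
    1 + (\<Sum>p\<in>S. - a * (\<Prod>q\<in>S-{p}. (x p - x q - a) / (x p - x q)) / (z - x p))"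
proof -
  define f where "f = (\<Prod>p\<in>S. [:- (x p + a), 1:])"
  have deg: "degree f = card S" unfolding f_def using S by (subst degree_prod_eq_sum_degree) auto
  have "lead_coeff f = 1" unfolding f_def lead_coeff_prod by simp
  then have lc: "coeff f (card S) = 1" by (simp add: deg)
  have pf: "poly f u = (\<Prod>p\<in>S. u - x p - a)" for u unfolding f_def poly_prod by (simp add: algebra_simps)
  have "poly f z = (\<Prod>p\<in>S. z - x p) + (\<Sum>p\<in>S. poly f (x p) * (\<Prod>q\<in>S-{p}. (z - x q) / (x p - x q)))"
    using lagrange_interpolation[OF S inj, of f z] deg lc by simp
  moreover have nz: "(\<Prod>p\<in>S. z - x p) \<noteq> 0" using S z by (auto simp: prod_zero_iff)
  ultimately have "(\<Prod>p\<in>S. (z - x p - a) / (z - x p)) =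
     1 + (\<Sum>p\<in>S. poly f (x p) * (\<Prod>q\<in>S-{p}. (z - x q) / (x p - x q))) / (\<Prod>p\<in>S. z - x p)"
    by (simp add: prod_dividef pf add_divide_distrib)
  also have "(\<Sum>p\<in>S. poly f (x p) * (\<Prod>q\<in>S-{p}. (z - x q) / (x p - x q))) / (\<Prod>p\<in>S. z - x p) =
     (\<Sum>p\<in>S. - a * (\<Prod>q\<in>S-{p}. (x p - x q - a) / (x p - x q)) / (z - x p))"
    unfolding sum_divide_distrib
  proof (intro sum.cong refl)
    fix p assume p: "p \<in> S"
    have 1: "poly f (x p) = - a * (\<Prod>q\<in>S-{p}. x p - x q - a)"
      unfolding pf using S p by (simp add: prod.remove)
    have 2: "(\<Prod>p\<in>S. z - x p) = (z - x p) * (\<Prod>q\<in>S-{p}. z - x q)" using S p by (simp add: prod.remove)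
    have "(\<Prod>q\<in>S-{p}. z - x q) \<noteq> 0" using S z by (auto simp: prod_zero_iff)
    then show "poly f (x p) * (\<Prod>q\<in>S-{p}. (z - x q) / (x p - x q)) / (\<Prod>p\<in>S. z - x p) =
      - a * (\<Prod>q\<in>S-{p}. (x p - x q - a) / (x p - x q)) / (z - x p)"
      unfolding 1 2 prod_dividef by simp
  qed
  finally show ?thesis .
qed

text \<open>\<open>H_top\<close> and \<open>H_bot\<close> combined at the same level: the weight of
  a discrete beta ensemble with \<open>beta = 2 * \<theta>\<close>.\<close>

definition omega :: "real \<Rightarrow> (real \<Rightarrow> real) \<Rightarrow> nat \<Rightarrow> (nat \<Rightarrow> real) \<Rightarrow> real" where
  "omega \<theta> w N l = (\<Prod>q\<in>{1..N}. \<Prod>p\<in>{1..<q}.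
      Gamma (l p - l q + 1) / Gamma (l p - l q + 1 - \<theta>) * (Gamma (l p - l q + \<theta>) / Gamma (l p - l q))) *
     (\<Prod>p\<in>{1..N}. w (l p))"

lemma sum_XX_top:
  "(\<Sum>L\<in>XX \<theta> M N N. of_real (weight \<theta> w N N L) * F (L N)) =
   (\<Sum>\<kappa>\<in>Lam M N. of_real (omega \<theta> w N (lat \<theta> \<kappa>)) * F (\<lambda>i\<in>{1..N}. lat \<theta> \<kappa> i) :: complex)"
proof -
  define emb where "emb = (\<lambda>\<kappa> :: nat \<Rightarrow> int. \<lambda>j\<in>{N}. \<lambda>i\<in>{1..N}. lat \<theta> \<kappa> i)"
  have "XX \<theta> M N N = emb ` Lam M N"
  proof (intro equalityI subsetI)
    fix L assume L: "L \<in> XX \<theta> M N N"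
    then have "L N \<in> WW \<theta> M N" by (intro XX_level) auto
    then obtain \<kappa> where \<kappa>: "\<kappa> \<in> Lam M N" "L N = (\<lambda>i\<in>{1..N}. lat \<theta> \<kappa> i)" by (auto simp: WW_eq)
    have "L = emb \<kappa>"
    proof
      fix j show "L j = emb \<kappa> j" using L \<kappa>(2) by (cases "j = N") (auto simp: emb_def XX_def PiE_iff extensional_def)
    qed
    then show "L \<in> emb ` Lam M N" using \<kappa> by blast
  next
    fix L assume "L \<in> emb ` Lam M N"
    then obtain \<kappa> where \<kappa>: "\<kappa> \<in> Lam M N" "L = emb \<kappa>" by blast
    then have "(\<lambda>i\<in>{1..N}. lat \<theta> \<kappa> i) \<in> WW \<theta> M N" unfolding WW_eq by (intro imageI)
    then show "L \<in> XX \<theta> M N N" unfolding XX_def \<kappa> by (auto simp: emb_def)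
  qed
  moreover have "inj_on emb (Lam M N)"
  proof (rule inj_onI)
    fix \<kappa> \<nu> assume \<kappa>: "\<kappa> \<in> Lam M N" "\<nu> \<in> Lam M N" and eq: "emb \<kappa> = emb \<nu>"
    have "lat \<theta> \<kappa> i = lat \<theta> \<nu> i" if "i \<in> {1..N}" for i
      using fun_cong[OF fun_cong[OF eq, of N], of i] that by (simp add: emb_def)
    then show "\<kappa> = \<nu>" using \<kappa> by (intro PiE_ext[of \<kappa> "{1..N}" "\<lambda>_. {0..int M}" \<nu>]) (auto simp: Lam_def lat_def)
  qed
  moreover have "weight \<theta> w N N (emb \<kappa>) = omega \<theta> w N (lat \<theta> \<kappa>)" for \<kappa>
  proof -
    have "(\<Prod>q\<in>{1..N}. \<Prod>p\<in>{1..<q}. G (emb \<kappa> N p - emb \<kappa> N q)) =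
       (\<Prod>q\<in>{1..N}. \<Prod>p\<in>{1..<q}. G (lat \<theta> \<kappa> p - lat \<theta> \<kappa> q))" for G :: "real \<Rightarrow> real"
      by (intro prod.cong refl) (simp add: emb_def)
    note * = this[of "\<lambda>d. Gamma (d + 1) / Gamma (d + 1 - \<theta>)"] this[of "\<lambda>d. Gamma (d + \<theta>) / Gamma d"]
    have "(\<Prod>p\<in>{1..N}. w (emb \<kappa> N p)) = (\<Prod>p\<in>{1..N}. w (lat \<theta> \<kappa> p))"
      by (intro prod.cong refl) (simp add: emb_def)
    then show ?thesis
      unfolding weight_def H_top_def H_bot_def omega_def * prod.distrib by (simp add: mult_ac)
  qed
  ultimately show ?thesis by (simp add: sum.reindex) (simp add: emb_def)
qed

text \<open>Removability of singularities is expressed by one holomorphic function on all of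
  \<open>U\<close>, because the values of \<open>F\<close> on \<open>S\<close> may stem from
  division by zero. This form is closed under finite sums.\<close>

definition extends_on :: "complex set \<Rightarrow> complex set \<Rightarrow> (complex \<Rightarrow> complex) \<Rightarrow> bool" where
  "extends_on U S F \<longleftrightarrow> (\<exists>g. g holomorphic_on U \<and> (\<forall>z\<in>U - S. g z = F z))"

lemma extends_on_holomorphic: "F holomorphic_on U \<Longrightarrow> extends_on U S F"
  unfolding extends_on_def by blast

lemma extends_on_add:
  assumes "extends_on U S F" "extends_on U S G"
  shows "extends_on U S (\<lambda>z. F z + G z)"
proof -
  obtain f g where "f holomorphic_on U" "g holomorphic_on U" "\<forall>z\<in>U - S. f z = F z" "\<forall>z\<in>U - S. g z = G z"
    using assms unfolding extends_on_def by blast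
  then show ?thesis
    unfolding extends_on_def by (intro exI[of _ "\<lambda>z. f z + g z"]) (simp add: holomorphic_on_add)
qed

lemma extends_on_sum:
  assumes "finite A" "\<And>i. i \<in> A \<Longrightarrow> extends_on U S (F i)"
  shows "extends_on U S (\<lambda>z. \<Sum>i\<in>A. F i z)"
  using assms
  by (induction A rule: finite_induct) (auto intro: extends_on_add extends_on_holomorphic)

text \<open>The extension is the difference quotient of \<open>h\<close> with value
  \<open>deriv h a\<close> at \<open>a\<close>. The point \<open>a\<close> has to lie in
  \<open>S\<close>, since there the quotient is zero by convention.\<close>

lemma extends_on_simple_zero:
  assumes h: "h holomorphic_on U" and U: "open U" and a: "h a = 0" "a \<in> S"
  shows "extends_on U S (\<lambda>z. h z / (z - a))"
  unfolding extends_on_def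
proof (intro exI conjI ballI)
  show "(\<lambda>z. if z = a then deriv h a else (h z - h a) / (z - a)) holomorphic_on U"
    by (rule pole_lemma_open[OF h U])
qed (use a in auto)

text \<open>In these two cases the pole at \<open>lat \<theta> \<kappa> p\<close> has no partner and
  its residue must vanish on its own: by the zero of \<open>\<Phi>m\<close> in the first, by a
  vanishing factor of the partial fraction coefficient in the second.\<close>

lemma Lam_decrement:
  assumes \<kappa>: "\<kappa> \<in> Lam M n" and p: "p \<in> {1..n}" and not: "\<kappa>(p := \<kappa> p - 1) \<notin> Lam M n"
  shows "p = n \<and> \<kappa> p = 0 \<or> p < n \<and> \<kappa> (Suc p) = \<kappa> p"
proof (rule ccontr)
  assume neg: "\<not> ?thesis"
  have anti: "\<And>i j. i \<in> {1..n} \<Longrightarrow> j \<in> {1..n} \<Longrightarrow> i \<le> j \<Longrightarrow> \<kappa> j \<le> \<kappa> i"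
    and ext: "\<kappa> \<in> {1..n} \<rightarrow>\<^sub>E {0..int M}" using \<kappa> by (auto simp: Lam_def)
  have nn: "\<And>i. i \<in> {1..n} \<Longrightarrow> 0 \<le> \<kappa> i" using ext by (auto simp: PiE_iff)
  have less: "\<kappa> (Suc p) < \<kappa> p" if "p < n" using neg that anti[of p "Suc p"] p by fastforce
  have pos: "0 < \<kappa> p"
    using neg nn[OF p] nn[of "Suc p"] less p by (cases "p = n") force+
  have after: "\<kappa> j \<le> \<kappa> p - 1" if "j \<in> {1..n}" "p < j" for j
    using anti[of "Suc p" j] less that p by force
  have "\<kappa>(p := \<kappa> p - 1) \<in> Lam M n"
    unfolding Lam_def
  proof (intro CollectI conjI ballI impI)
    show "\<kappa>(p := \<kappa> p - 1) \<in> {1..n} \<rightarrow>\<^sub>E {0..int M}"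
      using ext p pos by (force simp: PiE_iff extensional_def)
    fix i j assume ij: "i \<in> {1..n}" "j \<in> {1..n}" "i \<le> j"
    show "(\<kappa>(p := \<kappa> p - 1)) j \<le> (\<kappa>(p := \<kappa> p - 1)) i"
      using anti[OF ij] after[of j] ij by (cases "i = p"; cases "j = p") auto
  qed
  then show False using not by simp
qed

text \<open>The mirror image for the poles at \<open>lat \<theta> \<kappa> p + 1\<close>, with
  \<open>\<Phi>p\<close> in place of \<open>\<Phi>m\<close>.\<close>

lemma Lam_increment:
  assumes \<kappa>: "\<kappa> \<in> Lam M n" and p: "p \<in> {1..n}" and not: "\<kappa>(p := \<kappa> p + 1) \<notin> Lam M n"
  shows "p = 1 \<and> \<kappa> p = int M \<or> 1 < p \<and> \<kappa> (p - 1) = \<kappa> p"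
proof (rule ccontr)
  assume neg: "\<not> ?thesis"
  have anti: "\<And>i j. i \<in> {1..n} \<Longrightarrow> j \<in> {1..n} \<Longrightarrow> i \<le> j \<Longrightarrow> \<kappa> j \<le> \<kappa> i"
    and ext: "\<kappa> \<in> {1..n} \<rightarrow>\<^sub>E {0..int M}" using \<kappa> by (auto simp: Lam_def)
  have le: "\<And>i. i \<in> {1..n} \<Longrightarrow> \<kappa> i \<le> int M" using ext by (auto simp: PiE_iff)
  have less: "\<kappa> p < \<kappa> (p - 1)" if "1 < p" using neg that anti[of "p - 1" p] p by fastforce
  have pos: "\<kappa> p < int M"
    using neg le[OF p] le[of "p - 1"] less p by (cases "p = 1") force+
  have before: "\<kappa> p + 1 \<le> \<kappa> i" if "i \<in> {1..n}" "i < p" for i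
    using anti[of i "p - 1"] less that p by force
  have "\<kappa>(p := \<kappa> p + 1) \<in> Lam M n"
    unfolding Lam_def
  proof (intro CollectI conjI ballI impI)
    show "\<kappa>(p := \<kappa> p + 1) \<in> {1..n} \<rightarrow>\<^sub>E {0..int M}"
      using ext p pos by (force simp: PiE_iff extensional_def)
    fix i j assume ij: "i \<in> {1..n}" "j \<in> {1..n}" "i \<le> j"
    show "(\<kappa>(p := \<kappa> p + 1)) j \<le> (\<kappa>(p := \<kappa> p + 1)) i"
      using anti[OF ij] before[of i] ij by (cases "i = p"; cases "j = p") auto
  qed
  then show False using not by simp
qed

text \<open>When the distance of two coordinates grows from \<open>u\<close> to
  \<open>u + 1\<close>, the pair weight is multiplied by
  \<open>(u + 1) * (u + \<theta>) / (u * (u + 1 - \<theta>))\<close>; the statement distributes this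
  factor over the two residues to be compared.\<close>

lemma gamma_ratio_step:
  fixes \<theta> u :: real
  assumes "\<theta> > 0" "u > 0" "u + 1 - \<theta> > 0"
  defines "G \<equiv> \<lambda>d. Gamma (d + 1) / Gamma (d + 1 - \<theta>) * (Gamma (d + \<theta>) / Gamma d)"
  shows "G (u + 1) * ((u + 1 - \<theta>) / (u + 1)) = G u * ((u + \<theta>) / u)"
proof -
  define v where "v = u + 1 - \<theta>"
  define x where "x = u + \<theta>"
  have pos: "v > 0" "x > 0" using assms by (simp_all add: v_def x_def)
  have r: "Gamma (u + 1 + 1) = (u + 1) * Gamma (u + 1)" "Gamma (v + 1) = v * Gamma v"
    "Gamma (x + 1) = x * Gamma x" "Gamma (u + 1) = u * Gamma u"
    using assms(2) pos by (intro Gamma_real_plus1; simp)+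
  have G: "G (u + 1) = Gamma (u + 1 + 1) / Gamma (v + 1) * (Gamma (x + 1) / Gamma (u + 1))"
    "G u = Gamma (u + 1) / Gamma v * (Gamma x / Gamma u)"
    by (simp_all add: G_def v_def x_def algebra_simps)
  have "Gamma u > 0" "Gamma v > 0" using assms(2) pos by (intro Gamma_real_pos; simp)+
  moreover define a b c where "a = Gamma u" and "b = Gamma v" and "c = Gamma x"
  ultimately have "a > 0" "b > 0" by simp_all
  moreover have "u > 0" "u + 1 > 0" using assms(2) by simp_all
  ultimately show ?thesis
    unfolding G r x_def[symmetric] v_def[symmetric] a_def[symmetric] b_def[symmetric] c_def[symmetric]
    using pos by (simp add: divide_simps)
qed

text \<open>The product on the left belongs to the pole of \<open>\<kappa>\<close> at
  \<open>l p\<close>, that on the right to the pole of the smaller vector at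
  \<open>l' p + 1\<close>, the same point. Removing a box widens the distances to the rows above and
  narrows those to the rows below, so \<open>gamma_ratio_step\<close> enters in both
  directions.\<close>

lemma omega_step:
  assumes \<theta>: "\<theta> > 0" and \<kappa>: "\<kappa> \<in> Lam M N" and p: "p \<in> {1..N}" and \<kappa>': "\<kappa>(p := \<kappa> p - 1) \<in> Lam M N"
  defines "l \<equiv> lat \<theta> \<kappa>" and "l' \<equiv> lat \<theta> (\<kappa>(p := \<kappa> p - 1))"
  shows "omega \<theta> w N l * (\<Prod>q\<in>{1..N}-{p}. (l p - l q - \<theta>) / (l p - l q)) * w (l p - 1) =
         omega \<theta> w N l' * (\<Prod>q\<in>{1..N}-{p}. (l' p - l' q + \<theta>) / (l' p - l' q)) * w (l p)"
proof -
  define G where "G = (\<lambda>d. Gamma (d + 1) / Gamma (d + 1 - \<theta>) * (Gamma (d + \<theta>) / Gamma d))"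
  have l'p: "l' p = l p - 1" and l'q: "q \<noteq> p \<Longrightarrow> l' q = l q" for q
    by (simp_all add: l_def l'_def lat_def)
  define R where "R = (\<lambda>l :: nat \<Rightarrow> real. \<Prod>q\<in>{1..N}-{p}. \<Prod>r\<in>{1..<q}-{p}. G (l r - l q))"
  have R: "R l' = R l" unfolding R_def by (intro prod.cong refl) (simp add: l'q)
  define Wp where "Wp = (\<Prod>q\<in>{1..N}-{p}. w (l q))"
  have om: "omega \<theta> w N l = (\<Prod>q\<in>{1..N}-{p}. if q < p then G (l q - l p) else G (l p - l q)) * R l * (w (l p) * (\<Prod>q\<in>{1..N}-{p}. w (l q)))" for l
  proof -
    have "(\<Prod>q\<in>{1..N}. \<Prod>r\<in>{1..<q}. G (l r - l q)) =
       (\<Prod>q\<in>{1..N}-{p}. if q < p then G (l q - l p) else G (l p - l q)) * R l"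
      unfolding R_def by (rule prod_pairs_split[OF p])
    moreover have "(\<Prod>q\<in>{1..N}. w (l q)) = w (l p) * (\<Prod>q\<in>{1..N}-{p}. w (l q))"
      using p by (simp add: prod.remove)
    ultimately show ?thesis unfolding omega_def G_def by simp
  qed
  have Wp': "(\<Prod>q\<in>{1..N}-{p}. w (l' q)) = Wp" unfolding Wp_def by (intro prod.cong refl) (simp add: l'q)
  have "(if q < p then G (l q - l p) else G (l p - l q)) * ((l p - l q - \<theta>) / (l p - l q)) =
     (if q < p then G (l' q - l' p) else G (l' p - l' q)) * ((l' p - l' q + \<theta>) / (l' p - l' q))"
    if q: "q \<in> {1..N} - {p}" for q
  proof (cases "q < p")
    case True
    define e where "e = l q - l p"
    have "e \<ge> \<theta>" using lat_diff_ge[OF \<theta> Lam_antimono[OF \<kappa>], of q p] q p True by (force simp: e_def l_def)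
    then have "G (e + 1) * ((e + 1 - \<theta>) / (e + 1)) = G e * ((e + \<theta>) / e)"
      unfolding G_def using \<theta> by (intro gamma_ratio_step) auto
    moreover have "(l p - l q - \<theta>) / (l p - l q) = (e + \<theta>) / e"
      using minus_divide_divide[of "e + \<theta>" e] by (simp add: e_def)
    moreover have "(l' p - l' q + \<theta>) / (l' p - l' q) = (e + 1 - \<theta>) / (e + 1)"
    proof -
      have "l' p - l' q + \<theta> = - (e + 1 - \<theta>)" "l' p - l' q = - (e + 1)" using q by (simp_all add: e_def l'p l'q)
      then show ?thesis by (metis minus_divide_divide)
    qed
    moreover have "l' q - l' p = e + 1" using q by (simp add: e_def l'p l'q)
    ultimately show ?thesis using True by (simp add: e_def[symmetric])
  next
    case False
    define u where "u = l' p - l' q"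
    have "u \<ge> \<theta>" using lat_diff_ge[OF \<theta> Lam_antimono[OF \<kappa>'], of p q] q p False by (force simp: u_def l'_def)
    then have "G (u + 1) * ((u + 1 - \<theta>) / (u + 1)) = G u * ((u + \<theta>) / u)"
      unfolding G_def using \<theta> by (intro gamma_ratio_step) auto
    moreover have "l p - l q = u + 1" using q by (simp add: u_def l'p l'q)
    ultimately show ?thesis using False by (simp add: u_def[symmetric])
  qed
  then have "(\<Prod>q\<in>{1..N}-{p}. (if q < p then G (l q - l p) else G (l p - l q)) * ((l p - l q - \<theta>) / (l p - l q))) =
     (\<Prod>q\<in>{1..N}-{p}. (if q < p then G (l' q - l' p) else G (l' p - l' q)) * ((l' p - l' q + \<theta>) / (l' p - l' q)))"
    by (rule prod.cong[OF refl])
  then have "(\<Prod>q\<in>{1..N}-{p}. if q < p then G (l q - l p) else G (l p - l q)) * (\<Prod>q\<in>{1..N}-{p}. (l p - l q - \<theta>) / (l p - l q)) =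
     (\<Prod>q\<in>{1..N}-{p}. if q < p then G (l' q - l' p) else G (l' p - l' q)) * (\<Prod>q\<in>{1..N}-{p}. (l' p - l' q + \<theta>) / (l' p - l' q))"
    unfolding prod.distrib .
  moreover define a where "a = (\<Prod>q\<in>{1..N}-{p}. if q < p then G (l q - l p) else G (l p - l q))"
  moreover define a' where "a' = (\<Prod>q\<in>{1..N}-{p}. if q < p then G (l' q - l' p) else G (l' p - l' q))"
  moreover define b where "b = (\<Prod>q\<in>{1..N}-{p}. (l p - l q - \<theta>) / (l p - l q))"
  moreover define b' where "b' = (\<Prod>q\<in>{1..N}-{p}. (l' p - l' q + \<theta>) / (l' p - l' q))"
  ultimately have ab: "a * b = a' * b'" by simp
  have o: "omega \<theta> w N l = a * R l * (w (l p) * Wp)" "omega \<theta> w N l' = a' * R l * (w (l p - 1) * Wp)"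
    unfolding om[of l] om[of l'] a_def a'_def R Wp' l'p[symmetric] Wp_def by (rule refl)+
  have "omega \<theta> w N l * b * w (l p - 1) = (a * b) * (R l * w (l p) * Wp * w (l p - 1))" unfolding o by (simp only: mult_ac)
  also have "\<dots> = omega \<theta> w N l' * b' * w (l p)" unfolding ab o by (simp only: mult_ac)
  finally show ?thesis unfolding b_def b'_def .
qed

lemma lat_bounds:
  assumes \<theta>: "\<theta> > 0" and \<kappa>: "\<kappa> \<in> Lam M N" and p: "p \<in> {1..N}"
  shows "- real N * \<theta> + of_int (\<kappa> p) \<le> lat \<theta> \<kappa> p" "lat \<theta> \<kappa> p \<le> of_int (\<kappa> p) - \<theta>"
    "0 \<le> \<kappa> p" "\<kappa> p \<le> int M"
proof -
  show "0 \<le> \<kappa> p" "\<kappa> p \<le> int M" using \<kappa> p by (auto simp: Lam_def PiE_iff)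
  have "real p * \<theta> \<le> real N * \<theta>" "1 * \<theta> \<le> real p * \<theta>" using p \<theta> by (intro mult_right_mono; simp)+
  then show "- real N * \<theta> + of_int (\<kappa> p) \<le> lat \<theta> \<kappa> p" "lat \<theta> \<kappa> p \<le> of_int (\<kappa> p) - \<theta>"
    by (simp_all add: lat_def)
qed

text \<open>Contained in both \<open>R1_sing\<close> and \<open>R2_sing\<close>, so one extension of
  the case \<open>k = N\<close> serves both functions.\<close>

definition top_sing :: "real \<Rightarrow> nat \<Rightarrow> nat \<Rightarrow> complex set" where
  "top_sing \<theta> M N = (\<Union>\<kappa>\<in>Lam M N. \<Union>p\<in>{1..N}. {of_real (lat \<theta> \<kappa> p), of_real (lat \<theta> \<kappa> p) + 1})"

text \<open>The poles of the two expectations coincide in pairs: at \<open>l \<kappa> p\<close> for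
  \<open>\<kappa>\<close> and at \<open>l \<kappa>' p + 1\<close> for
  \<open>\<kappa>' = \<kappa> - e\<^sub>p\<close>. Paired residues cancel by
  \<open>omega_step\<close> and the ratio identity for \<open>w\<close>; a pole without a partner
  has residue zero.\<close>

lemma extends_on_R1_top:
  fixes \<Phi>p \<Phi>m :: "complex \<Rightarrow> complex"
  assumes \<theta>: "\<theta> > 0" and w: "\<forall>x\<in>{- real N * \<theta> .. real M - \<theta>}. w x > 0"
    and U: "open U" and hol: "\<Phi>p holomorphic_on U" "\<Phi>m holomorphic_on U"
    and ratio: "\<And>x. x \<in> {- real N * \<theta> + 1 .. real M - \<theta>} \<Longrightarrow>
           \<Phi>m (complex_of_real x) \<noteq> 0 \<and>
           complex_of_real (w x / w (x - 1)) = \<Phi>p (complex_of_real x) / \<Phi>m (complex_of_real x)"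
    and bdry: "\<Phi>m (complex_of_real (- real N * \<theta>)) = 0" "\<Phi>p (complex_of_real (real M + 1 - \<theta>)) = 0"
  shows "extends_on U (top_sing \<theta> M N) (\<lambda>z. R1 \<theta> w M N N \<Phi>p \<Phi>m z)"
proof -
  define l where "l = lat \<theta>"
  define om where "om = (\<lambda>\<kappa>. omega \<theta> w N (l \<kappa>))"
  \<comment> \<open>\<open>r\<close> and \<open>s\<close> are the partial fraction coefficients at
    the poles \<open>l \<kappa> p\<close> and \<open>l \<kappa> p + 1\<close>.\<close>
  define r where "r = (\<lambda>\<kappa> p. - \<theta> * (\<Prod>q\<in>{1..N}-{p}. (l \<kappa> p - l \<kappa> q - \<theta>) / (l \<kappa> p - l \<kappa> q)))"
  define s where "s = (\<lambda>\<kappa> p. \<theta> * (\<Prod>q\<in>{1..N}-{p}. (l \<kappa> p - l \<kappa> q + \<theta>) / (l \<kappa> p - l \<kappa> q)))"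
  define A where "A = Lam M N \<times> {1..N}"
  define A1 where "A1 = {(\<kappa>, p)\<in>A. \<kappa>(p := \<kappa> p - 1) \<in> Lam M N}"
  define A2 where "A2 = {(\<kappa>, p)\<in>A. \<kappa>(p := \<kappa> p + 1) \<in> Lam M N}"
  define f1 where "f1 = (\<lambda>(\<kappa>, p) z. of_real (om \<kappa> * r \<kappa> p) * \<Phi>m z / (z - of_real (l \<kappa> p)))"
  define f2 where "f2 = (\<lambda>(\<kappa>, p) z. of_real (om \<kappa> * s \<kappa> p) * \<Phi>p z / (z - (of_real (l \<kappa> p) + 1)))"
  have sum_A: "(\<Sum>x\<in>A. f x z) = (\<Sum>\<kappa>\<in>Lam M N. \<Sum>p\<in>{1..N}. f (\<kappa>, p) z)"
    for f :: "(nat \<Rightarrow> int) \<times> nat \<Rightarrow> complex \<Rightarrow> complex" and z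
    unfolding A_def by (simp add: sum.cartesian_product case_prod_unfold)
  define S where "S = top_sing \<theta> M N"
  \<comment> \<open>Bijection from \<open>A1\<close> to \<open>A2\<close> that pairs a pole of
    \<open>f1\<close> with the pole of \<open>f2\<close> at the same point.\<close>
  define dn where "dn = (\<lambda>(\<kappa> :: nat \<Rightarrow> int, p). (\<kappa>(p := \<kappa> p - 1), p))"
  have finL: "finite (Lam M N)"
    unfolding Lam_def by (rule finite_subset[OF _ finite_PiE[of "{1..N}" "\<lambda>_. {0..int M}"]]) auto
  then have finA: "finite A" by (simp add: A_def)
  have A12: "A1 \<subseteq> A" "A2 \<subseteq> A" by (auto simp: A1_def A2_def)
  have inS: "of_real (l \<kappa> p) \<in> S" "of_real (l \<kappa> p) + 1 \<in> S" if "(\<kappa>, p) \<in> A" for \<kappa> p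
    using that unfolding S_def top_sing_def A_def l_def
    by (intro UN_I[of \<kappa>] UN_I[of p]; simp)+
  have pair: "extends_on U S (\<lambda>z. f1 x z + f2 (dn x) z)" if x: "x \<in> A1" for x
  proof -
    obtain \<kappa> p where xe: "x = (\<kappa>, p)" by (cases x)
    have \<kappa>: "\<kappa> \<in> Lam M N" "p \<in> {1..N}" "\<kappa>(p := \<kappa> p - 1) \<in> Lam M N" and xA: "(\<kappa>, p) \<in> A"
      using x by (auto simp: A1_def A_def xe)
    define \<kappa>' where "\<kappa>' = \<kappa>(p := \<kappa> p - 1)"
    define a where "a = l \<kappa> p"
    have l': "l \<kappa>' p = a - 1" by (simp add: l_def lat_def \<kappa>'_def a_def)
    define h where "h = (\<lambda>z. of_real (om \<kappa> * r \<kappa> p) * \<Phi>m z + of_real (om \<kappa>' * s \<kappa>' p) * \<Phi>p z)"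
    define b where "b = (\<Prod>q\<in>{1..N}-{p}. (l \<kappa> p - l \<kappa> q - \<theta>) / (l \<kappa> p - l \<kappa> q))"
    define b' where "b' = (\<Prod>q\<in>{1..N}-{p}. (l \<kappa>' p - l \<kappa>' q + \<theta>) / (l \<kappa>' p - l \<kappa>' q))"
    have 1: "om \<kappa> * b * w (a - 1) = om \<kappa>' * b' * w a"
      unfolding om_def b_def b'_def a_def l_def \<kappa>'_def using \<kappa> by (intro omega_step[OF \<theta>])
    have rs: "r \<kappa> p = - \<theta> * b" "s \<kappa>' p = \<theta> * b'" by (simp_all add: r_def s_def b_def b'_def)
    \<comment> \<open>A box can be removed from row \<open>p\<close>, so its length is at least one;
      this puts \<open>a\<close> into the interval of the ratio identity.\<close>
    have "0 \<le> (\<kappa>(p := \<kappa> p - 1)) p" using lat_bounds(3)[OF \<theta> \<kappa>(3,2)] .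
    then have "1 \<le> real_of_int (\<kappa> p)" by simp
    moreover have "real_of_int (\<kappa> p) \<le> real M" using lat_bounds(4)[OF \<theta> \<kappa>(1,2)] by linarith
    ultimately have "- real N * \<theta> + 1 \<le> a" "a \<le> real M - \<theta>"
      using lat_bounds(1,2)[OF \<theta> \<kappa>(1,2)] by (simp_all add: a_def l_def)
    then have a: "a \<in> {- real N * \<theta> + 1 .. real M - \<theta>}" "a - 1 \<in> {- real N * \<theta> .. real M - \<theta>}" by auto
    have wp: "w (a - 1) \<noteq> 0" using w a(2) by force
    have "of_real (w a) / of_real (w (a - 1)) = \<Phi>p (of_real a) / \<Phi>m (of_real a)" "\<Phi>m (of_real a) \<noteq> 0"
      using ratio[OF a(1)] by simp_all
    then have \<Phi>: "of_real (w a) * \<Phi>m (of_real a) = of_real (w (a - 1)) * \<Phi>p (of_real a)"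
      using wp by (simp add: field_simps)
    \<comment> \<open>The factor \<open>w (a - 1)\<close> makes \<open>omega_step\<close> applicable
      to the coefficient of \<open>\<Phi>m\<close>.\<close>
    have "of_real (w (a - 1)) * h (of_real a) =
       of_real \<theta> * (of_real (om \<kappa>' * b' ) * of_real (w (a - 1)) * \<Phi>p (of_real a) - of_real (om \<kappa> * b * w (a - 1)) * \<Phi>m (of_real a))"
      by (simp add: h_def rs algebra_simps)
    also have "\<dots> = of_real \<theta> * (of_real (om \<kappa>' * b' ) * (of_real (w (a - 1)) * \<Phi>p (of_real a) - of_real (w a) * \<Phi>m (of_real a)))"
      unfolding 1 by (simp add: algebra_simps)
    also have "\<dots> = 0" unfolding \<Phi> by simp
    finally have "h (of_real a) = 0" using wp by simp
    moreover have "h holomorphic_on U" unfolding h_def using hol by (intro holomorphic_intros)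
    ultimately have "extends_on U S (\<lambda>z. h z / (z - of_real a))"
      using inS(1)[OF xA] by (intro extends_on_simple_zero U) (simp_all add: a_def)
    moreover have "h z / (z - of_real a) = f1 x z + f2 (dn x) z" for z
      unfolding f1_def f2_def dn_def xe h_def
      by (simp add: \<kappa>'_def[symmetric] a_def[symmetric] l' add_divide_distrib)
    ultimately show ?thesis by simp
  qed
  have rest1: "extends_on U S (f1 x)" if x: "x \<in> A - A1" for x
  proof -
    obtain \<kappa> p where xe: "x = (\<kappa>, p)" by (cases x)
    have \<kappa>: "\<kappa> \<in> Lam M N" "p \<in> {1..N}" and n: "\<kappa>(p := \<kappa> p - 1) \<notin> Lam M N" and xA: "(\<kappa>, p) \<in> A"
      using x by (auto simp: A1_def A_def xe)
    have "r \<kappa> p * \<Phi>m (of_real (l \<kappa> p)) = 0"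
      using Lam_decrement[OF \<kappa> n]
    proof
      assume "p = N \<and> \<kappa> p = 0"
      then have "l \<kappa> p = - real N * \<theta>" by (auto simp: l_def lat_def)
      then show ?thesis using bdry by simp
    next
      assume c: "p < N \<and> \<kappa> (Suc p) = \<kappa> p"
      \<comment> \<open>Consecutive rows of equal length lie at distance exactly
        \<open>\<theta>\<close>, so the factor for \<open>q = Suc p\<close> vanishes.\<close>
      then have "l \<kappa> p - l \<kappa> (Suc p) - \<theta> = 0" by (simp add: l_def lat_def algebra_simps)
      then have "(\<Prod>q\<in>{1..N}-{p}. (l \<kappa> p - l \<kappa> q - \<theta>) / (l \<kappa> p - l \<kappa> q)) = 0"
        using c \<kappa> by (intro prod_zero) (auto intro!: bexI[of _ "Suc p"])
      then have "r \<kappa> p = 0" unfolding r_def by (simp only: mult_zero_right)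
      then show ?thesis by simp
    qed
    then have "extends_on U S (\<lambda>z. (of_real (om \<kappa> * r \<kappa> p) * \<Phi>m z) / (z - of_real (l \<kappa> p)))"
      using inS(1)[OF xA] hol by (intro extends_on_simple_zero U) (auto intro!: holomorphic_intros)
    then show ?thesis by (simp add: f1_def xe)
  qed
  have rest2: "extends_on U S (f2 x)" if x: "x \<in> A - A2" for x
  proof -
    obtain \<kappa> p where xe: "x = (\<kappa>, p)" by (cases x)
    have \<kappa>: "\<kappa> \<in> Lam M N" "p \<in> {1..N}" and n: "\<kappa>(p := \<kappa> p + 1) \<notin> Lam M N" and xA: "(\<kappa>, p) \<in> A"
      using x by (auto simp: A2_def A_def xe)
    have "s \<kappa> p * \<Phi>p (of_real (l \<kappa> p) + 1) = 0"
      using Lam_increment[OF \<kappa> n]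
    proof
      assume "p = 1 \<and> \<kappa> p = int M"
      then have "of_real (l \<kappa> p) + 1 = complex_of_real (real M + 1 - \<theta>)" by (auto simp: l_def lat_def)
      then show ?thesis using bdry(2) by (simp only: mult_zero_right)
    next
      assume c: "1 < p \<and> \<kappa> (p - 1) = \<kappa> p"
      then have "l \<kappa> p - l \<kappa> (p - 1) + \<theta> = 0" by (simp add: l_def lat_def algebra_simps of_nat_diff)
      then have "(\<Prod>q\<in>{1..N}-{p}. (l \<kappa> p - l \<kappa> q + \<theta>) / (l \<kappa> p - l \<kappa> q)) = 0"
        using c \<kappa> by (intro prod_zero) (auto intro!: bexI[of _ "p - 1"])
      then have "s \<kappa> p = 0" unfolding s_def by (simp only: mult_zero_right)
      then show ?thesis by simp
    qed
    then have "extends_on U S (\<lambda>z. (of_real (om \<kappa> * s \<kappa> p) * \<Phi>p z) / (z - (of_real (l \<kappa> p) + 1)))"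
      using inS(2)[OF xA] hol by (intro extends_on_simple_zero U) (auto intro!: holomorphic_intros)
    then show ?thesis by (simp add: f2_def xe)
  qed
  define g where "g = (\<lambda>z. of_real (\<Sum>\<kappa>\<in>Lam M N. om \<kappa>) * (\<Phi>m z + \<Phi>p z) + (\<Sum>x\<in>A1. f1 x z + f2 (dn x) z)
       + (\<Sum>x\<in>A - A1. f1 x z) + (\<Sum>x\<in>A - A2. f2 x z))"
  have "extends_on U S g"
    unfolding g_def using hol finA A12 finite_subset[OF A12(1) finA]
    by (intro extends_on_add extends_on_sum pair rest1 rest2 extends_on_holomorphic holomorphic_intros) auto
  moreover define Z where "Z = partition_fun \<theta> w M N N"
  ultimately obtain G where G: "G holomorphic_on U" "\<forall>z\<in>U - S. G z = g z"
    unfolding extends_on_def by blast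
  have g: "R1 \<theta> w M N N \<Phi>p \<Phi>m z = g z / of_real Z" if z: "z \<in> U - S" for z
  proof -
    define F1 where "F1 = (\<lambda>l. \<Prod>p=1..N. (z - complex_of_real (l p) - of_real \<theta>) / (z - of_real (l p)))"
    define F2 where "F2 = (\<lambda>l. \<Prod>p=1..N. (z - complex_of_real (l p) + of_real \<theta> - 1) / (z - of_real (l p) - 1))"
    have "R1 \<theta> w M N N \<Phi>p \<Phi>m z = \<Phi>m z * EE \<theta> w M N N (\<lambda>L. F1 (L N)) + \<Phi>p z * EE \<theta> w M N N (\<lambda>L. F2 (L N))"
      by (simp add: R1_def F1_def F2_def)
    also have "\<dots> = (\<Phi>m z * (\<Sum>\<kappa>\<in>Lam M N. of_real (om \<kappa>) * F1 (\<lambda>i\<in>{1..N}. l \<kappa> i)) +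
         \<Phi>p z * (\<Sum>\<kappa>\<in>Lam M N. of_real (om \<kappa>) * F2 (\<lambda>i\<in>{1..N}. l \<kappa> i))) / of_real Z"
      unfolding EE_eq[OF \<theta> w order.refl] sum_XX_top Z_def om_def l_def by (simp add: add_divide_distrib)
    also have "\<Phi>m z * (\<Sum>\<kappa>\<in>Lam M N. of_real (om \<kappa>) * F1 (\<lambda>i\<in>{1..N}. l \<kappa> i)) =
       of_real (\<Sum>\<kappa>\<in>Lam M N. om \<kappa>) * \<Phi>m z + (\<Sum>x\<in>A. f1 x z)"
    proof -
      have "F1 (\<lambda>i\<in>{1..N}. l \<kappa> i) = 1 + (\<Sum>p\<in>{1..N}. of_real (r \<kappa> p) / (z - of_real (l \<kappa> p)))"
        if \<kappa>: "\<kappa> \<in> Lam M N" for \<kappa>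
      proof -
        have "F1 (\<lambda>i\<in>{1..N}. l \<kappa> i) = (\<Prod>p\<in>{1..N}. (z - of_real (l \<kappa> p) - of_real \<theta>) / (z - of_real (l \<kappa> p)))"
          unfolding F1_def by (intro prod.cong refl) simp
        also have "\<dots> = 1 + (\<Sum>p\<in>{1..N}. - of_real \<theta> * (\<Prod>q\<in>{1..N}-{p}. (of_real (l \<kappa> p) - of_real (l \<kappa> q) - of_real \<theta>) / (of_real (l \<kappa> p) - of_real (l \<kappa> q))) / (z - of_real (l \<kappa> p)))"
        proof (rule partial_fractions)
          show "inj_on (\<lambda>p. complex_of_real (l \<kappa> p)) {1..N}"
          proof (rule linorder_inj_onI)
            fix p q assume "p < q" "p \<in> {1..N}" "q \<in> {1..N}"
            then have "lat \<theta> \<kappa> p - lat \<theta> \<kappa> q > 0" using lat_diff_ge[OF \<theta> Lam_antimono[OF \<kappa>], of p q] \<theta> by force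
            then show "complex_of_real (l \<kappa> p) \<noteq> complex_of_real (l \<kappa> q)" by (simp add: l_def)
          qed auto
        qed (use z inS(1) \<kappa> in \<open>auto simp: A_def\<close>)
        finally show ?thesis by (simp add: r_def)
      qed
      then have "(\<Sum>\<kappa>\<in>Lam M N. of_real (om \<kappa>) * F1 (\<lambda>i\<in>{1..N}. l \<kappa> i)) =
         (\<Sum>\<kappa>\<in>Lam M N. of_real (om \<kappa>) + (\<Sum>p\<in>{1..N}. of_real (om \<kappa> * r \<kappa> p) / (z - of_real (l \<kappa> p))))"
        by (intro sum.cong refl) (simp add: distrib_left sum_distrib_left)
      then show ?thesis
        unfolding sum_A f1_def
        by (simp add: sum.distrib distrib_left sum_distrib_left mult_ac)
    qed
    also have "\<Phi>p z * (\<Sum>\<kappa>\<in>Lam M N. of_real (om \<kappa>) * F2 (\<lambda>i\<in>{1..N}. l \<kappa> i)) =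
       of_real (\<Sum>\<kappa>\<in>Lam M N. om \<kappa>) * \<Phi>p z + (\<Sum>x\<in>A. f2 x z)"
    proof -
      have "F2 (\<lambda>i\<in>{1..N}. l \<kappa> i) = 1 + (\<Sum>p\<in>{1..N}. of_real (s \<kappa> p) / (z - (of_real (l \<kappa> p) + 1)))"
        if \<kappa>: "\<kappa> \<in> Lam M N" for \<kappa>
      proof -
        \<comment> \<open>The same partial fraction formula with nodes
          \<open>l \<kappa> p + 1\<close> and \<open>a = - \<theta>\<close>.\<close>
        have "F2 (\<lambda>i\<in>{1..N}. l \<kappa> i) = (\<Prod>p\<in>{1..N}. (z - (of_real (l \<kappa> p) + 1) - (- of_real \<theta>)) / (z - (of_real (l \<kappa> p) + 1)))"
          unfolding F2_def by (intro prod.cong refl) (simp add: algebra_simps)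
        also have "\<dots> = 1 + (\<Sum>p\<in>{1..N}. - (- of_real \<theta>) * (\<Prod>q\<in>{1..N}-{p}. ((of_real (l \<kappa> p) + 1) - (of_real (l \<kappa> q) + 1) - (- of_real \<theta>)) / ((of_real (l \<kappa> p) + 1) - (of_real (l \<kappa> q) + 1))) / (z - (of_real (l \<kappa> p) + 1)))"
        proof (rule partial_fractions)
          show "inj_on (\<lambda>p. complex_of_real (l \<kappa> p) + 1) {1..N}"
          proof (rule linorder_inj_onI)
            fix p q assume "p < q" "p \<in> {1..N}" "q \<in> {1..N}"
            then have "lat \<theta> \<kappa> p - lat \<theta> \<kappa> q > 0" using lat_diff_ge[OF \<theta> Lam_antimono[OF \<kappa>], of p q] \<theta> by force
            then show "complex_of_real (l \<kappa> p) + 1 \<noteq> complex_of_real (l \<kappa> q) + 1" by (simp add: l_def)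
          qed auto
        qed (use z inS(2) \<kappa> in \<open>auto simp: A_def\<close>)
        finally show ?thesis by (simp add: s_def)
      qed
      then have "(\<Sum>\<kappa>\<in>Lam M N. of_real (om \<kappa>) * F2 (\<lambda>i\<in>{1..N}. l \<kappa> i)) =
         (\<Sum>\<kappa>\<in>Lam M N. of_real (om \<kappa>) + (\<Sum>p\<in>{1..N}. of_real (om \<kappa> * s \<kappa> p) / (z - (of_real (l \<kappa> p) + 1))))"
        by (intro sum.cong refl) (simp add: distrib_left sum_distrib_left)
      then show ?thesis
        unfolding sum_A f2_def
        by (simp add: sum.distrib distrib_left sum_distrib_left mult_ac)
    qed
    also have "(\<Sum>x\<in>A. f1 x z) = (\<Sum>x\<in>A1. f1 x z) + (\<Sum>x\<in>A - A1. f1 x z)"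
      using sum.subset_diff[OF A12(1) finA] by (simp add: add.commute)
    also have "(\<Sum>x\<in>A. f2 x z) = (\<Sum>x\<in>A2. f2 x z) + (\<Sum>x\<in>A - A2. f2 x z)"
      using sum.subset_diff[OF A12(2) finA] by (simp add: add.commute)
    also have "(\<Sum>x\<in>A2. f2 x z) = (\<Sum>x\<in>A1. f2 (dn x) z)"
      by (rule sum.reindex_bij_witness[of _ dn "\<lambda>(\<kappa>, p). (\<kappa>(p := \<kappa> p + 1), p)"])
         (auto simp: A1_def A2_def A_def dn_def fun_upd_idem)
    finally show ?thesis by (simp add: g_def sum.distrib algebra_simps)
  qed
  show ?thesis
    unfolding extends_on_def
  proof (intro exI[of _ "\<lambda>z. G z / of_real Z"] conjI ballI)
    have "Z > 0" unfolding Z_def by (rule partition_fun_pos[OF \<theta> w order.refl])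
    then show "(\<lambda>z. G z / of_real Z) holomorphic_on U" using G(1) by (intro holomorphic_intros) auto
    fix z assume "z \<in> U - top_sing \<theta> M N"
    then show "G z / of_real Z = R1 \<theta> w M N N \<Phi>p \<Phi>m z" using g G(2) by (simp add: S_def)
  qed
qed

lemma top_sing_subset:
  assumes "1 \<le> k" "k \<le> N"
  shows "top_sing \<theta> M N \<subseteq> R1_sing \<theta> M N k" "top_sing \<theta> M N \<subseteq> R2_sing \<theta> M N k"
  using assms(2,1)
proof (induction rule: inc_induct)
  case base
  have *: "(\<lambda>j\<in>{N}. \<lambda>i\<in>{1..N}. lat \<theta> \<kappa> i) \<in> XX \<theta> M N N" if "\<kappa> \<in> Lam M N" for \<kappa>
    using that by (auto simp: XX_def WW_eq)
  have **: "(\<lambda>j\<in>{N}. \<lambda>i\<in>{1..N}. lat \<theta> \<kappa> i) N p = lat \<theta> \<kappa> p" if "p \<in> {1..N}" for \<kappa> p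
    using that by simp
  { case 1
    show ?case
      unfolding top_sing_def R1_sing_def
    proof (intro UN_least)
      fix \<kappa> p assume \<kappa>: "\<kappa> \<in> Lam M N" "p \<in> {1..N}"
      show "{complex_of_real (lat \<theta> \<kappa> p), complex_of_real (lat \<theta> \<kappa> p) + 1} \<subseteq>
         (\<Union>L\<in>XX \<theta> M N N. \<Union>j\<in>{N..N}. \<Union>p\<in>{1..j}. {complex_of_real (L j p), complex_of_real (L j p + 1)})"
        using \<kappa>(2) by (intro subsetI UN_I[OF *[OF \<kappa>(1)]] UN_I[of N] UN_I[of p]) auto
    qed
  next
    case 2
    show ?case
      unfolding top_sing_def R2_sing_def
    proof (intro UN_least)
      fix \<kappa> p assume \<kappa>: "\<kappa> \<in> Lam M N" "p \<in> {1..N}"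
      show "{complex_of_real (lat \<theta> \<kappa> p), complex_of_real (lat \<theta> \<kappa> p) + 1} \<subseteq>
         (\<Union>L\<in>XX \<theta> M N N. \<Union>j\<in>{N..N}. \<Union>p\<in>{1..j}.
           {complex_of_real (L j p - (real N - real j) * \<theta>), complex_of_real (L j p - (real N - real j) * \<theta> + 1)})"
        using \<kappa>(2) by (intro subsetI UN_I[OF *[OF \<kappa>(1)]] UN_I[of N] UN_I[of p]) auto
    qed
  }
next
  case (step k)
  { case 1 then show ?case using step sing_Suc(1)[of k N \<theta> M] by auto
  next
    case 2 then show ?case using step sing_Suc(2)[of k N \<theta> M] by auto
  }
qed

theorem theorem1p4:
  fixes \<theta> :: real and N k M :: nat
    and w :: "real \<Rightarrow> real"
    and U :: "complex set"
    and \<Phi>p \<Phi>m :: "complex \<Rightarrow> complex"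
  assumes "\<theta> > 0" and "\<theta> \<noteq> 1"
    and "k \<in> {1..N}"
    and "\<And>x. x \<in> {- real N * \<theta> .. real M - \<theta>} \<Longrightarrow> w x > 0"
    and "open U"
    and "complex_of_real ` {- real N * \<theta> .. real M + 1 - \<theta>} \<subseteq> U"
    and "\<Phi>p holomorphic_on U" and "\<Phi>m holomorphic_on U"
    and "\<And>x. x \<in> {- real N * \<theta> + 1 .. real M - \<theta>} \<Longrightarrow>
           \<Phi>m (complex_of_real x) \<noteq> 0 \<and>
           complex_of_real (w x / w (x - 1)) = \<Phi>p (complex_of_real x) / \<Phi>m (complex_of_real x)"
    and "\<Phi>m (complex_of_real (- real N * \<theta>)) = 0"
    and "\<Phi>p (complex_of_real (real M + 1 - \<theta>)) = 0"
  shows "(\<exists>g. g holomorphic_on U \<and> (\<forall>z\<in>U - R1_sing \<theta> M N k. g z = R1 \<theta> w M N k \<Phi>p \<Phi>m z)) \<and>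
         (\<exists>g. g holomorphic_on U \<and> (\<forall>z\<in>U - R2_sing \<theta> M N k. g z = R2 \<theta> w M N k \<Phi>p \<Phi>m z))"
proof -
  have w: "\<forall>x\<in>{- real N * \<theta> .. real M - \<theta>}. w x > 0" using assms(4) by blast
  have k: "1 \<le> k" "k \<le> N" using assms(3) by auto
  \<comment> \<open>By \<open>R2_top\<close> the extension for the single level is available to both
    functions.\<close>
  obtain g where g: "g holomorphic_on U" "\<forall>z\<in>U - top_sing \<theta> M N. g z = R1 \<theta> w M N N \<Phi>p \<Phi>m z"
    using extends_on_R1_top[OF assms(1) w assms(5,7,8) assms(9-11)] unfolding extends_on_def by blast
  \<comment> \<open>Each of the \<open>N - k\<close> levels summed out contributes the same multiple
    of \<open>\<Phi>p\<close>, respectively \<open>\<Phi>m\<close>.\<close>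
  define c where "c = of_nat (N - k) * (of_real \<theta> / (1 - of_real \<theta> :: complex))"
  show ?thesis
  proof (intro conjI exI ballI)
    show "(\<lambda>z. g z + c * \<Phi>p z) holomorphic_on U" "(\<lambda>z. g z + c * \<Phi>m z) holomorphic_on U"
      using g(1) assms(7,8) by (intro holomorphic_intros; simp)+
    show "g z + c * \<Phi>p z = R1 \<theta> w M N k \<Phi>p \<Phi>m z" if "z \<in> U - R1_sing \<theta> M N k" for z
      using that g(2) top_sing_subset(1)[OF k, of \<theta> M] R1_reduce[OF assms(1,2) w k, of z \<Phi>p \<Phi>m]
      by (auto simp: c_def mult_ac)
    show "g z + c * \<Phi>m z = R2 \<theta> w M N k \<Phi>p \<Phi>m z" if "z \<in> U - R2_sing \<theta> M N k" for z
      using that g(2) top_sing_subset(2)[OF k, of \<theta> M] R2_reduce[OF assms(1,2) w k, of z \<Phi>p \<Phi>m]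
      by (auto simp: c_def R2_top mult_ac)
  qed
qed

end
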